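(* Opetopes are equivalent to reduced opetopic directed complexes, in the following sense. For every integer $n\geq 0$, the assignment $$K\longmapsto \bigl(G_0^-(\langle K\rangle)\to G_1^-(\langle K\rangle)\to\ldots\to G_n^-(\langle K\rangle)\bigr)$$ induces a bijection from isomorphism classes of $n$-dimensional reduced opetopic directed complexes to isomorphism classes of $n$-dimensional opetopes.
   Context: **Complexes.** A *free augmented directed complex* $K$ is an augmented chain complex of free abelian groups $K_q$, $q\geq 0$ (boundary $\partial\colon K_{q+1}\to K_q$ with $\partial\partial=0$, $\partial=0$ on $K_0$, augmentation $\epsilon\colon K_0\to\mathbb{Z}$ with $\epsilon\partial=0$), together with a distinguished basis for each $K_q$. Members of the basis of $K_q$ are the $q$-dimensional basis elements. A "sum of basis elements" is a (possibly empty, possibly with repetitions) finite sum of basis elements; its terms are the basis elements occurring in it. For a chain $c$ write $\partial c=\partial^+c-\partial^-c$ where $\partial^+c,\partial^-c$ are sums of basis elements with no common terms; $(\partial^\pm)^r$ denotes the $r$-fold iterate of $\partial^\pm$. $K$ is *unital* if $\epsilon(\partial^-)^q a=\epsilon(\partial^+)^q a=1$ for each basis element $a$ of dimension $q$. $K$ is *loop-free* if its basis elements can be partially ordered so that, for any basis element $a$ and any integer $r>0$, the basis elements which are terms in $(\partial^-)^r a$ (strictly) precede those which are terms in $(\partial^+)^r a$. $K$ is *atomic of dimension $n$* (or $n$-dimensional atomic) if it has no basis elements of dimension greater than $n$, exactly one basis element of dimension $n$, and every basis element of dimension less than $n$ is a term in $\partial^-a$ or $\partial^+a$ for some higher-dimensional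 basis element $a$. An *opetopic directed complex* is an atomic loop-free unital free augmented directed complex with a distinguished class of positive-dimensional basis elements called *thin*, such that: (1) if $a$ is a positive-dimensional basis element then $\partial^+a$ is a non-thin basis element; (2) if $a$ is a thin basis element then $\partial^-a$ is a non-thin basis element. It is *reduced* if every thin basis element is of the form $\partial^-a$ for some other basis element $a$. Isomorphisms of opetopic directed complexes are isomorphisms of augmented chain complexes restricting to bijections between the distinguished bases and between the thin basis elements. **Networks.** A *network* consists of finite sets $E$ (edges) and $V$ (vertices), subsets $I\subseteq E$ (input edges) and $O\subseteq E$ (output edges), and functions $s\colon E\setminus I\to V$, $t\colon E\setminus O\to V$ (source and target). A *path* from an edge $e'$ to an edge $e$ is a sequence $e_0,v_1,e_1,\dots,v_k,e_k$ ($k\ge 0$) of edges $e_r$ and vertices $v_r$ with $v_r=t(e_{r-1})=s(e_r)$, $e_0=e'$, $e_k=e$. A network is *acyclic* if there is no path from any edge $e$ to itself other than the single-term path $e$; it is *linear* if it is acyclic and consists of a single path (all its edges and vertices are those of one path). An *opetopic network* is an acyclic network with a unique output edge, with distinguished sets of *thin* edges and *thin* vertices, such that every thin edge is an input edge, and every thin vertex is the target for a unique edge, which is not thin. It is *reduced* if every thin edge has a target vertex, and this vertex is not the target for any other edge. A *constellation* from an opetopic network $N$ to an opetopic network $P$ is a bijection $c$ from the set of vertices of $N$ to the set of input edges of $P$ such that thin vertices of $N$ correspond to thin edges of $P$ and such that: if $e$ is an edge of $P$ and $I_e$ is the set of input edges $e'$ of $P$ such that there is a path in $P$ from $e'$ to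 $e$, then there is exactly one edge in $N$ with a source but not a target in $c^{-1}(I_e)$. An $n$-dimensional *opetope* is a sequence of reduced opetopic networks and constellations $N_0\to N_1\to\ldots\to N_n$ such that $N_0$ is linear with no thin edges and $N_n$ consists of a single edge. Isomorphisms of such sequences are families of network isomorphisms preserving thin edges and vertices and compatible with the constellations. **The sequence associated to $K$.** If $K$ is an $n$-dimensional opetopic directed complex with $n$-dimensional basis element $g$, let $x_q^\alpha=(\partial^\alpha)^{n-q}g$ for $0\leq q\leq n$ and $x_q^\alpha=0$ for $q>n$ ($\alpha=\pm$), and let $\langle K\rangle=(x_0^-,x_0^+\mid x_1^-,x_1^+\mid\ldots)$. Writing $x_{q+1}^-=a_1+\ldots+a_k$ as a sum of basis elements, put $g_q^-(\langle K\rangle)=x_q^-+\partial^+a_1+\ldots+\partial^+a_k$. The network $G_q^-(\langle K\rangle)$ has as edges the basis elements which are terms in $g_q^-(\langle K\rangle)$ and as vertices the $(q+1)$-dimensional basis elements which are terms in $x_{q+1}^-$; the edges with target the vertex $a$ are the terms of $\partial^-a$, and the edges with source the vertex $a$ are the terms of $\partial^+a$; edges without a source are input edges and edges without a target are output edges. Thin edges and vertices are those given by thin basis elements. The input edges of $G_{q+1}^-(\langle K\rangle)$ are the terms of $x_{q+1}^-$, and the map $G_q^-(\langle K\rangle)\to G_{q+1}^-(\langle K\rangle)$ is the bijection from vertices to input edges sending the vertex given by a basis element $a$ to the input edge given by $a$. *)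

theory Defs
  imports "HOL-Algebra.Free_Abelian_Groups" "HOL-Algebra.Elementary_Groups"
begin

section \<open>Free augmented directed complexes\<close>

text \<open>
  The chain group in dimension \<open>q\<close> is the library's free abelian group on the set of
  \<open>q\<close>-dimensional basis elements; the basis element \<open>a\<close> is the chain \<open>frag_of a\<close>. All dimensions
  share the type \<open>'a \<Rightarrow>\<^sub>0 int\<close>, so a single function \<open>bd\<close> serves as boundary in all dimensions.
\<close>

record 'a dcomplex =
  elems :: "'a set"
  edim :: "'a \<Rightarrow> nat"
  bd :: "('a \<Rightarrow>\<^sub>0 int) \<Rightarrow> ('a \<Rightarrow>\<^sub>0 int)"
  aug :: "('a \<Rightarrow>\<^sub>0 int) \<Rightarrow> int"

definition basis_of :: "('a, 'z) dcomplex_scheme \<Rightarrow> nat \<Rightarrow> 'a set"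
  where "basis_of K q = {a \<in> elems K. edim K a = q}"

definition chain_gp :: "('a, 'z) dcomplex_scheme \<Rightarrow> nat \<Rightarrow> ('a \<Rightarrow>\<^sub>0 int) monoid"
  where "chain_gp K q = free_Abelian_group (basis_of K q)"

definition free_aug_dcomplex :: "('a, 'z) dcomplex_scheme \<Rightarrow> bool"
  where "free_aug_dcomplex K \<longleftrightarrow>
    (\<forall>q. bd K \<in> hom (chain_gp K (Suc q)) (chain_gp K q)) \<and>
    (\<forall>q. \<forall>c \<in> carrier (chain_gp K q). bd K (bd K c) = 0) \<and>
    (\<forall>c \<in> carrier (chain_gp K 0). bd K c = 0) \<and>
    aug K \<in> hom (chain_gp K 0) integer_group \<and>
    (\<forall>c \<in> carrier (chain_gp K 1). aug K (bd K c) = 0)"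

text \<open>
  A sum of basis elements is a chain with nonnegative coefficients, and its terms are its keys.
\<close>

definition basis_sum :: "('a \<Rightarrow>\<^sub>0 int) \<Rightarrow> bool"
  where "basis_sum c \<longleftrightarrow> (\<forall>a. 0 \<le> Poly_Mapping.lookup c a)"

definition bd_plus :: "('a, 'z) dcomplex_scheme \<Rightarrow> ('a \<Rightarrow>\<^sub>0 int) \<Rightarrow> ('a \<Rightarrow>\<^sub>0 int)"
  where "bd_plus K c = Poly_Mapping.map (\<lambda>k. max 0 k) (bd K c)"

definition bd_minus :: "('a, 'z) dcomplex_scheme \<Rightarrow> ('a \<Rightarrow>\<^sub>0 int) \<Rightarrow> ('a \<Rightarrow>\<^sub>0 int)"
  where "bd_minus K c = Poly_Mapping.map (\<lambda>k. max 0 (- k)) (bd K c)"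

lemma lookup_bd_plus: "Poly_Mapping.lookup (bd_plus K c) a = max 0 (Poly_Mapping.lookup (bd K c) a)"
  by (simp add: bd_plus_def map.rep_eq when_def)

lemma lookup_bd_minus: "Poly_Mapping.lookup (bd_minus K c) a = max 0 (- Poly_Mapping.lookup (bd K c) a)"
  by (simp add: bd_minus_def map.rep_eq when_def)

text \<open>The two parts are the unique sums of basis elements without common terms whose difference
  is the boundary.\<close>

lemma bd_plus_minus_iff:
  "p = bd_plus K c \<and> m = bd_minus K c \<longleftrightarrow>
   basis_sum p \<and> basis_sum m \<and> Poly_Mapping.keys p \<inter> Poly_Mapping.keys m = {} \<and> bd K c = p - m"
  (is "?L \<longleftrightarrow> ?R")
proof
  assume ?L
  then show ?R
    by (auto simp: basis_sum_def lookup_bd_plus lookup_bd_minus in_keys_iff lookup_minus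
        intro!: poly_mapping_eqI)
next
  assume R: ?R
  have *: "Poly_Mapping.lookup p a = 0 \<or> Poly_Mapping.lookup m a = 0" for a
    using R by (auto simp: in_keys_iff)
  have "Poly_Mapping.lookup p a = max 0 (Poly_Mapping.lookup (bd K c) a) \<and>
        Poly_Mapping.lookup m a = max 0 (- Poly_Mapping.lookup (bd K c) a)" for a
    using R *[of a] by (auto simp: basis_sum_def lookup_minus max_def dest!: spec[of _ a])
  then show ?L
    by (auto intro!: poly_mapping_eqI simp: lookup_bd_plus lookup_bd_minus)
qed

definition unital :: "('a, 'z) dcomplex_scheme \<Rightarrow> bool"
  where "unital K \<longleftrightarrow> (\<forall>a \<in> elems K.
    aug K ((bd_minus K ^^ edim K a) (frag_of a)) = 1 \<and>
    aug K ((bd_plus K ^^ edim K a) (frag_of a)) = 1)"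

definition loop_free :: "('a, 'z) dcomplex_scheme \<Rightarrow> bool"
  where "loop_free K \<longleftrightarrow> (\<exists>R. partial_order_on (elems K) R \<and>
    (\<forall>a \<in> elems K. \<forall>r > 0.
      \<forall>x \<in> Poly_Mapping.keys ((bd_minus K ^^ r) (frag_of a)).
      \<forall>y \<in> Poly_Mapping.keys ((bd_plus K ^^ r) (frag_of a)). (x, y) \<in> R \<and> x \<noteq> y))"

definition atomic :: "nat \<Rightarrow> ('a, 'z) dcomplex_scheme \<Rightarrow> bool"
  where "atomic n K \<longleftrightarrow>
    (\<forall>a \<in> elems K. edim K a \<le> n) \<and>
    (\<exists>!g. g \<in> basis_of K n) \<and>
    (\<forall>b \<in> elems K. edim K b < n \<longrightarrow>
      (\<exists>a \<in> elems K. edim K b < edim K a \<and>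
        (b \<in> Poly_Mapping.keys (bd_minus K (frag_of a)) \<or>
         b \<in> Poly_Mapping.keys (bd_plus K (frag_of a)))))"


section \<open>Opetopic directed complexes\<close>

record 'a odcomplex = "'a dcomplex" +
  thin :: "'a set"

definition opetopic_dcomplex :: "nat \<Rightarrow> 'a odcomplex \<Rightarrow> bool"
  where "opetopic_dcomplex n K \<longleftrightarrow>
    free_aug_dcomplex K \<and> atomic n K \<and> loop_free K \<and> unital K \<and>
    thin K \<subseteq> {a \<in> elems K. 0 < edim K a} \<and>
    (\<forall>a \<in> elems K. 0 < edim K a \<longrightarrow>
      (\<exists>b \<in> elems K - thin K. bd_plus K (frag_of a) = frag_of b)) \<and>
    (\<forall>a \<in> thin K. \<exists>b \<in> elems K - thin K. bd_minus K (frag_of a) = frag_of b)"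

definition reduced_dcomplex :: "'a odcomplex \<Rightarrow> bool"
  where "reduced_dcomplex K \<longleftrightarrow>
    (\<forall>b \<in> thin K. \<exists>a \<in> elems K. a \<noteq> b \<and> bd_minus K (frag_of a) = frag_of b)"

definition dcomplex_iso :: "(nat \<Rightarrow> ('a \<Rightarrow>\<^sub>0 int) \<Rightarrow> ('b \<Rightarrow>\<^sub>0 int)) \<Rightarrow> 'a odcomplex \<Rightarrow> 'b odcomplex \<Rightarrow> bool"
  where "dcomplex_iso f K L \<longleftrightarrow>
    (\<forall>q. f q \<in> iso (chain_gp K q) (chain_gp L q)) \<and>
    (\<forall>q. \<forall>c \<in> carrier (chain_gp K (Suc q)). bd L (f (Suc q) c) = f q (bd K c)) \<and>
    (\<forall>c \<in> carrier (chain_gp K 0). aug L (f 0 c) = aug K c) \<and>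
    (\<forall>q. bij_betw (f q) (frag_of ` basis_of K q) (frag_of ` basis_of L q)) \<and>
    (\<forall>q. bij_betw (f q) (frag_of ` (basis_of K q \<inter> thin K)) (frag_of ` (basis_of L q \<inter> thin L)))"

definition reduced_opetopic_dcomplexes :: "nat \<Rightarrow> 'a odcomplex set"
  where "reduced_opetopic_dcomplexes n = {K. opetopic_dcomplex n K \<and> reduced_dcomplex K}"

definition dcomplex_iso_rel :: "nat \<Rightarrow> ('a odcomplex \<times> 'a odcomplex) set"
  where "dcomplex_iso_rel n = {(K, L).
    K \<in> reduced_opetopic_dcomplexes n \<and> L \<in> reduced_opetopic_dcomplexes n \<and>
    (\<exists>f. dcomplex_iso f K L)}"


section \<open>Networks\<close>

text \<open>
  The source and target maps are partial: \<open>src\<close> is only meaningful on \<open>edges - inputs\<close> and \<open>tgt\<close>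
  only on \<open>edges - outputs\<close>.
\<close>

record ('e, 'v) network =
  edges :: "'e set"
  verts :: "'v set"
  inputs :: "'e set"
  outputs :: "'e set"
  src :: "'e \<Rightarrow> 'v"
  tgt :: "'e \<Rightarrow> 'v"

definition is_network :: "('e, 'v, 'z) network_scheme \<Rightarrow> bool"
  where "is_network N \<longleftrightarrow>
    finite (edges N) \<and> finite (verts N) \<and> inputs N \<subseteq> edges N \<and> outputs N \<subseteq> edges N \<and>
    src N \<in> (edges N - inputs N) \<rightarrow> verts N \<and>
    tgt N \<in> (edges N - outputs N) \<rightarrow> verts N"

definition edges_out_of :: "('e, 'v, 'z) network_scheme \<Rightarrow> 'v \<Rightarrow> 'e set"
  where "edges_out_of N v = {e \<in> edges N - inputs N. src N e = v}"

definition edges_into :: "('e, 'v, 'z) network_scheme \<Rightarrow> 'v \<Rightarrow> 'e set"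
  where "edges_into N v = {e \<in> edges N - outputs N. tgt N e = v}"

text \<open>
  The path \<open>e\<^sub>0, v\<^sub>1, e\<^sub>1, \<dots>, v\<^sub>k, e\<^sub>k\<close> is given by the list of its \<open>k + 1\<close> edges and the list of its
  \<open>k\<close> vertices; thus \<open>vs ! r\<close> is \<open>v\<^sub>r\<^sub>+\<^sub>1\<close>.
\<close>

definition is_path :: "('e, 'v, 'z) network_scheme \<Rightarrow> 'e list \<Rightarrow> 'v list \<Rightarrow> bool"
  where "is_path N es vs \<longleftrightarrow>
    length es = Suc (length vs) \<and> set es \<subseteq> edges N \<and> set vs \<subseteq> verts N \<and>
    (\<forall>r < length vs. es ! r \<in> edges_into N (vs ! r) \<and> es ! Suc r \<in> edges_out_of N (vs ! r))"

definition path_from_to :: "('e, 'v, 'z) network_scheme \<Rightarrow> 'e \<Rightarrow> 'e \<Rightarrow> 'e list \<Rightarrow> 'v list \<Rightarrow> bool"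
  where "path_from_to N e' e es vs \<longleftrightarrow> is_path N es vs \<and> hd es = e' \<and> last es = e"

definition acyclic_network :: "('e, 'v, 'z) network_scheme \<Rightarrow> bool"
  where "acyclic_network N \<longleftrightarrow> (\<forall>e es vs. path_from_to N e e es vs \<longrightarrow> es = [e] \<and> vs = [])"

definition linear_network :: "('e, 'v, 'z) network_scheme \<Rightarrow> bool"
  where "linear_network N \<longleftrightarrow> acyclic_network N \<and>
    (\<exists>es vs. is_path N es vs \<and> edges N = set es \<and> verts N = set vs)"


section \<open>Opetopic networks, constellations and opetopes\<close>

record ('e, 'v) onetwork = "('e, 'v) network" +
  thin_edges :: "'e set"
  thin_verts :: "'v set"

definition opetopic_network :: "('e, 'v) onetwork \<Rightarrow> bool"
  where "opetopic_network N \<longleftrightarrow>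
    is_network N \<and> acyclic_network N \<and> (\<exists>!e. e \<in> outputs N) \<and>
    thin_edges N \<subseteq> edges N \<and> thin_verts N \<subseteq> verts N \<and>
    thin_edges N \<subseteq> inputs N \<and>
    (\<forall>v \<in> thin_verts N. \<exists>e. edges_into N v = {e} \<and> e \<notin> thin_edges N)"

definition reduced_network :: "('e, 'v) onetwork \<Rightarrow> bool"
  where "reduced_network N \<longleftrightarrow> (\<forall>e \<in> thin_edges N. \<exists>v \<in> verts N. edges_into N v = {e})"

definition inputs_to :: "('e, 'v, 'z) network_scheme \<Rightarrow> 'e \<Rightarrow> 'e set"
  where "inputs_to P e = {e' \<in> inputs P. \<exists>es vs. path_from_to P e' e es vs}"

definition constellation ::
    "('e, 'v) onetwork \<Rightarrow> ('e2, 'v2) onetwork \<Rightarrow> ('v \<Rightarrow> 'e2) \<Rightarrow> bool"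
  where "constellation N P c \<longleftrightarrow>
    bij_betw c (verts N) (inputs P) \<and>
    (\<forall>v \<in> verts N. v \<in> thin_verts N \<longleftrightarrow> c v \<in> thin_edges P) \<and>
    (\<forall>e \<in> edges P. let W = {v \<in> verts N. c v \<in> inputs_to P e} in
      \<exists>!d. d \<in> edges N \<and> (\<exists>v \<in> W. d \<in> edges_out_of N v) \<and> \<not> (\<exists>v \<in> W. d \<in> edges_into N v))"

text \<open>
  A sequence of networks \<open>N\<^sub>0, \<dots>, N\<^sub>n\<close> with maps from the vertices of \<open>N\<^sub>i\<close> to the edges of \<open>N\<^sub>i\<^sub>+\<^sub>1\<close>.
  The values \<open>nets S i\<close> for \<open>i > n\<close> and \<open>maps S i\<close> for \<open>i \<ge> n\<close> are irrelevant, and are ignored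
  by isomorphisms.
\<close>

record ('e, 'v) network_seq =
  nets :: "nat \<Rightarrow> ('e, 'v) onetwork"
  maps :: "nat \<Rightarrow> 'v \<Rightarrow> 'e"

definition is_opetope :: "nat \<Rightarrow> ('e, 'v) network_seq \<Rightarrow> bool"
  where "is_opetope n S \<longleftrightarrow>
    (\<forall>i \<le> n. opetopic_network (nets S i) \<and> reduced_network (nets S i)) \<and>
    (\<forall>i < n. constellation (nets S i) (nets S (Suc i)) (maps S i)) \<and>
    linear_network (nets S 0) \<and> thin_edges (nets S 0) = {} \<and>
    (\<exists>e. edges (nets S n) = {e} \<and> verts (nets S n) = {})"

definition onetwork_iso ::
    "('e \<Rightarrow> 'e2) \<Rightarrow> ('v \<Rightarrow> 'v2) \<Rightarrow> ('e, 'v) onetwork \<Rightarrow> ('e2, 'v2) onetwork \<Rightarrow> bool"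
  where "onetwork_iso \<phi> \<psi> N P \<longleftrightarrow>
    bij_betw \<phi> (edges N) (edges P) \<and> bij_betw \<psi> (verts N) (verts P) \<and>
    \<phi> ` inputs N = inputs P \<and> \<phi> ` outputs N = outputs P \<and>
    (\<forall>e \<in> edges N - inputs N. src P (\<phi> e) = \<psi> (src N e)) \<and>
    (\<forall>e \<in> edges N - outputs N. tgt P (\<phi> e) = \<psi> (tgt N e)) \<and>
    \<phi> ` thin_edges N = thin_edges P \<and> \<psi> ` thin_verts N = thin_verts P"

definition network_seq_iso ::
    "nat \<Rightarrow> (nat \<Rightarrow> 'e \<Rightarrow> 'e2) \<Rightarrow> (nat \<Rightarrow> 'v \<Rightarrow> 'v2) \<Rightarrow>
     ('e, 'v) network_seq \<Rightarrow> ('e2, 'v2) network_seq \<Rightarrow> bool"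
  where "network_seq_iso n \<phi> \<psi> S T \<longleftrightarrow>
    (\<forall>i \<le> n. onetwork_iso (\<phi> i) (\<psi> i) (nets S i) (nets T i)) \<and>
    (\<forall>i < n. \<forall>v \<in> verts (nets S i). maps T i (\<psi> i v) = \<phi> (Suc i) (maps S i v))"

definition opetopes :: "nat \<Rightarrow> ('e, 'v) network_seq set"
  where "opetopes n = {S. is_opetope n S}"

definition opetope_iso_rel :: "nat \<Rightarrow> (('e, 'v) network_seq \<times> ('e, 'v) network_seq) set"
  where "opetope_iso_rel n = {(S, T).
    S \<in> opetopes n \<and> T \<in> opetopes n \<and> (\<exists>\<phi> \<psi>. network_seq_iso n \<phi> \<psi> S T)}"


section \<open>The sequence of networks associated to a complex\<close>

definition top_elem :: "nat \<Rightarrow> ('a, 'z) dcomplex_scheme \<Rightarrow> 'a"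
  where "top_elem n K = (THE g. g \<in> basis_of K n)"

text \<open>
  The components \<open>x\<^sub>q\<^sup>-\<close> of the double sequence; the components \<open>x\<^sub>q\<^sup>+\<close> do not enter into the networks.
\<close>

definition x_minus :: "nat \<Rightarrow> ('a, 'z) dcomplex_scheme \<Rightarrow> nat \<Rightarrow> ('a \<Rightarrow>\<^sub>0 int)"
  where "x_minus n K q =
    (if q \<le> n then (bd_minus K ^^ (n - q)) (frag_of (top_elem n K)) else 0)"

text \<open>\<open>frag_extend\<close> adds up the \<open>\<partial>\<^sup>+a\<close> over the terms \<open>a\<close> of \<open>x\<^sub>q\<^sub>+\<^sub>1\<^sup>-\<close>, with multiplicity.\<close>

definition g_minus :: "nat \<Rightarrow> ('a, 'z) dcomplex_scheme \<Rightarrow> nat \<Rightarrow> ('a \<Rightarrow>\<^sub>0 int)"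
  where "g_minus n K q =
    x_minus n K q + frag_extend (\<lambda>a. bd_plus K (frag_of a)) (x_minus n K (Suc q))"

definition G_network :: "nat \<Rightarrow> 'a odcomplex \<Rightarrow> nat \<Rightarrow> ('a, 'a) onetwork"
  where "G_network n K q =
    (let E = Poly_Mapping.keys (g_minus n K q);
         V = Poly_Mapping.keys (x_minus n K (Suc q));
         from = (\<lambda>a. Poly_Mapping.keys (bd_plus K (frag_of a)));
         into = (\<lambda>a. Poly_Mapping.keys (bd_minus K (frag_of a)))
     in \<lparr>edges = E, verts = V,
         inputs = {e \<in> E. \<forall>a \<in> V. e \<notin> from a},
         outputs = {e \<in> E. \<forall>a \<in> V. e \<notin> into a},
         src = (\<lambda>e. THE a. a \<in> V \<and> e \<in> from a),
         tgt = (\<lambda>e. THE a. a \<in> V \<and> e \<in> into a),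
         thin_edges = E \<inter> thin K, thin_verts = V \<inter> thin K\<rparr>)"

text \<open>
  The definition of \<open>G_network\<close> is meaningful if the terms of \<open>\<partial>\<^sup>\<plusminus>a\<close>, for a vertex \<open>a\<close>, are
  edges, and if every edge has at most one source and at most one target. This holds if and only
  if the edges out of and into the vertex \<open>a\<close> are precisely the terms of \<open>\<partial>\<^sup>+a\<close> and \<open>\<partial>\<^sup>-a\<close>.
\<close>

definition G_well_defined :: "nat \<Rightarrow> 'a odcomplex \<Rightarrow> nat \<Rightarrow> bool"
  where "G_well_defined n K q \<longleftrightarrow> (\<forall>a \<in> verts (G_network n K q).
    edges_out_of (G_network n K q) a = Poly_Mapping.keys (bd_plus K (frag_of a)) \<and>
    edges_into (G_network n K q) a = Poly_Mapping.keys (bd_minus K (frag_of a)))"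

definition opetope_of :: "nat \<Rightarrow> 'a odcomplex \<Rightarrow> ('a, 'a) network_seq"
  where "opetope_of n K = \<lparr>nets = G_network n K, maps = (\<lambda>q a. a)\<rparr>"


section \<open>The isomorphism relations are equivalence relations\<close>

lemma dcomplex_iso_refl: "dcomplex_iso (\<lambda>q c. c) K K"
  by (auto simp: dcomplex_iso_def iso_def hom_def bij_betw_def inj_on_def)

lemma dcomplex_iso_trans:
  assumes f: "dcomplex_iso f K L" and g: "dcomplex_iso g L M"
  shows "dcomplex_iso (\<lambda>q. g q \<circ> f q) K M"
proof -
  have fc: "f q c \<in> carrier (chain_gp L q)" if "c \<in> carrier (chain_gp K q)" for q c
    using f that by (auto simp: dcomplex_iso_def iso_def hom_def)
  have "g q \<circ> f q \<in> iso (chain_gp K q) (chain_gp M q)" for q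
    using f g by (intro iso_set_trans) (auto simp: dcomplex_iso_def)
  moreover have "bij_betw (g q \<circ> f q) (frag_of ` basis_of K q) (frag_of ` basis_of M q)"
    "bij_betw (g q \<circ> f q) (frag_of ` (basis_of K q \<inter> thin K)) (frag_of ` (basis_of M q \<inter> thin M))" for q
    using f g unfolding dcomplex_iso_def by (blast intro: bij_betw_trans)+
  ultimately show ?thesis
    using f g fc unfolding dcomplex_iso_def by simp
qed

lemma chain_gp_bd:
  assumes "free_aug_dcomplex K" "c \<in> carrier (chain_gp K (Suc q))"
  shows "bd K c \<in> carrier (chain_gp K q)"
  using assms by (auto simp: free_aug_dcomplex_def hom_def)

lemma frag_of_chain_gp: "a \<in> basis_of K q \<Longrightarrow> frag_of a \<in> carrier (chain_gp K q)"
  by (simp add: chain_gp_def free_Abelian_group_def)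

lemma dcomplex_iso_sym:
  assumes f: "dcomplex_iso f K L" and L: "free_aug_dcomplex L"
    and K: "free_aug_dcomplex K"
  shows "dcomplex_iso (\<lambda>q. inv_into (carrier (chain_gp K q)) (f q)) L K"
proof -
  let ?g = "\<lambda>q. inv_into (carrier (chain_gp K q)) (f q)"
  have iso: "f q \<in> iso (chain_gp K q) (chain_gp L q)" for q
    using f by (auto simp: dcomplex_iso_def)
  have bij: "bij_betw (f q) (carrier (chain_gp K q)) (carrier (chain_gp L q))" for q
    using iso by (auto simp: iso_def)
  have gc: "?g q c \<in> carrier (chain_gp K q)" and fg: "f q (?g q c) = c"
    if "c \<in> carrier (chain_gp L q)" for q c
    using bij that by (auto simp: bij_betw_def inv_into_into f_inv_into_f)
  have gf: "?g q (f q c) = c" if "c \<in> carrier (chain_gp K q)" for q c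
    using bij that by (auto simp: bij_betw_def)
  have gr: "group (chain_gp K q)" for q by (simp add: chain_gp_def)
  have giso: "?g q \<in> iso (chain_gp L q) (chain_gp K q)" for q
    using group.iso_set_sym[OF gr iso] .
  have "bd K (?g (Suc q) c) = ?g q (bd L c)" if c: "c \<in> carrier (chain_gp L (Suc q))" for q c
  proof -
    have "f q (bd K (?g (Suc q) c)) = bd L c"
      using f gc[OF c] fg[OF c] by (metis dcomplex_iso_def)
    then show ?thesis
      using gf[OF chain_gp_bd[OF K gc[OF c]]] by simp
  qed
  moreover have "aug K (?g 0 c) = aug L c" if c: "c \<in> carrier (chain_gp L 0)" for c
    using f gc[OF c] fg[OF c] by (metis dcomplex_iso_def)
  moreover have "bij_betw (?g q) (frag_of ` basis_of L q) (frag_of ` basis_of K q)" for q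
    using f by (intro bij_betw_inv_into_subset[OF bij])
      (auto simp only: dcomplex_iso_def bij_betw_def intro: frag_of_chain_gp)
  moreover have "bij_betw (?g q) (frag_of ` (basis_of L q \<inter> thin L)) (frag_of ` (basis_of K q \<inter> thin K))" for q
    using f by (intro bij_betw_inv_into_subset[OF bij])
      (auto simp only: dcomplex_iso_def bij_betw_def intro: frag_of_chain_gp)
  ultimately show ?thesis
    using giso by (simp add: dcomplex_iso_def)
qed

lemma equiv_dcomplex_iso_rel: "equiv (reduced_opetopic_dcomplexes n) (dcomplex_iso_rel n)"
proof (rule equivI)
  show "dcomplex_iso_rel n \<subseteq> reduced_opetopic_dcomplexes n \<times> reduced_opetopic_dcomplexes n"
    by (auto simp: dcomplex_iso_rel_def)
  show "refl_on (reduced_opetopic_dcomplexes n) (dcomplex_iso_rel n)"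
    unfolding refl_on_def dcomplex_iso_rel_def using dcomplex_iso_refl by blast
  show "sym (dcomplex_iso_rel n)"
    unfolding sym_def dcomplex_iso_rel_def reduced_opetopic_dcomplexes_def opetopic_dcomplex_def
    by (blast dest: dcomplex_iso_sym)
  show "trans (dcomplex_iso_rel n)"
    unfolding trans_def dcomplex_iso_rel_def by (blast dest: dcomplex_iso_trans)
qed

lemma onetwork_iso_refl: "onetwork_iso (\<lambda>e. e) (\<lambda>v. v) N N"
  by (auto simp: onetwork_iso_def bij_betw_def inj_on_def)


lemma onetwork_iso_in_inputs:
  assumes "onetwork_iso \<phi> \<psi> N P" "is_network N" "e \<in> edges N"
  shows "\<phi> e \<in> edges P" "\<phi> e \<in> inputs P \<longleftrightarrow> e \<in> inputs N" "\<phi> e \<in> outputs P \<longleftrightarrow> e \<in> outputs N"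
proof -
  have b: "inj_on \<phi> (edges N)" "\<phi> ` edges N = edges P" "\<phi> ` inputs N = inputs P" "\<phi> ` outputs N = outputs P"
    using assms(1) by (simp_all add: onetwork_iso_def bij_betw_def)
  have s: "inputs N \<subseteq> edges N" "outputs N \<subseteq> edges N"
    using assms(2) by (simp_all add: is_network_def)
  show "\<phi> e \<in> edges P" using b(2) assms(3) by blast
  show "\<phi> e \<in> inputs P \<longleftrightarrow> e \<in> inputs N"
    using inj_on_image_mem_iff[OF b(1) assms(3) s(1)] b(3) by simp
  show "\<phi> e \<in> outputs P \<longleftrightarrow> e \<in> outputs N"
    using inj_on_image_mem_iff[OF b(1) assms(3) s(2)] b(4) by simp
qed

lemma onetwork_iso_trans:
  assumes f: "onetwork_iso \<phi> \<psi> N P" and g: "onetwork_iso \<phi>' \<psi>' P Q" and N: "is_network N"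
  shows "onetwork_iso (\<lambda>e. \<phi>' (\<phi> e)) (\<lambda>v. \<psi>' (\<psi> v)) N Q"
proof -
  note i = onetwork_iso_in_inputs[OF f N]
  have "bij_betw (\<phi>' \<circ> \<phi>) (edges N) (edges Q)" "bij_betw (\<psi>' \<circ> \<psi>) (verts N) (verts Q)"
    using f g by (auto simp: onetwork_iso_def intro: bij_betw_trans)
  moreover have "src Q (\<phi>' (\<phi> e)) = \<psi>' (\<psi> (src N e))" if "e \<in> edges N - inputs N" for e
  proof -
    have "\<phi> e \<in> edges P - inputs P" using that i by blast
    then show ?thesis using f g that by (simp add: onetwork_iso_def)
  qed
  moreover have "tgt Q (\<phi>' (\<phi> e)) = \<psi>' (\<psi> (tgt N e))" if "e \<in> edges N - outputs N" for e
  proof -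
    have "\<phi> e \<in> edges P - outputs P" using that i by blast
    then show ?thesis using f g that by (simp add: onetwork_iso_def)
  qed
  moreover have "(\<lambda>e. \<phi>' (\<phi> e)) ` inputs N = inputs Q" "(\<lambda>e. \<phi>' (\<phi> e)) ` outputs N = outputs Q"
    "(\<lambda>e. \<phi>' (\<phi> e)) ` thin_edges N = thin_edges Q" "(\<lambda>v. \<psi>' (\<psi> v)) ` thin_verts N = thin_verts Q"
    using f g by (simp_all add: onetwork_iso_def flip: image_image)
  ultimately show ?thesis by (simp add: onetwork_iso_def comp_def)
qed

lemma onetwork_iso_sym:
  assumes f: "onetwork_iso \<phi> \<psi> N P" and N: "opetopic_network N"
  shows "onetwork_iso (inv_into (edges N) \<phi>) (inv_into (verts N) \<psi>) P N"
proof -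
  let ?f = "inv_into (edges N) \<phi>" and ?g = "inv_into (verts N) \<psi>"
  have net: "is_network N" using N by (simp add: opetopic_network_def)
  note i = onetwork_iso_in_inputs[OF f net]
  have b: "bij_betw \<phi> (edges N) (edges P)" "bij_betw \<psi> (verts N) (verts P)"
    using f by (simp_all add: onetwork_iso_def)
  have s: "inputs N \<subseteq> edges N" "outputs N \<subseteq> edges N" "thin_edges N \<subseteq> edges N" "thin_verts N \<subseteq> verts N"
    using N by (auto simp: opetopic_network_def is_network_def)
  have f1: "?f e \<in> edges N" "\<phi> (?f e) = e" if "e \<in> edges P" for e
    using b(1) that by (auto simp: bij_betw_def inv_into_into f_inv_into_f)
  have g1: "?g (\<psi> v) = v" if "v \<in> verts N" for v
    using b(2) that by (auto simp: bij_betw_def)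
  have "bij_betw ?f (edges P) (edges N)" "bij_betw ?g (verts P) (verts N)"
    using b by (auto intro: bij_betw_inv_into)
  moreover have "inputs P = \<phi> ` inputs N" "outputs P = \<phi> ` outputs N"
    "thin_edges P = \<phi> ` thin_edges N" "thin_verts P = \<psi> ` thin_verts N"
    using f by (simp_all add: onetwork_iso_def)
  then have "?f ` inputs P = inputs N" "?f ` outputs P = outputs N"
    "?f ` thin_edges P = thin_edges N" "?g ` thin_verts P = thin_verts N"
    using s b by (simp_all only: bij_betw_def inv_into_image_cancel)
  moreover have "src N (?f e) = ?g (src P e)" if "e \<in> edges P - inputs P" for e
  proof -
    have e: "?f e \<in> edges N - inputs N" using that f1 i by (metis DiffD1 DiffD2 DiffI)
    then have "src P (\<phi> (?f e)) = \<psi> (src N (?f e))" using f by (simp add: onetwork_iso_def)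
    then have "src P e = \<psi> (src N (?f e))" using f1(2) that by simp
    moreover have "src N (?f e) \<in> verts N" using e net by (auto simp: is_network_def)
    ultimately show ?thesis using g1 by simp
  qed
  moreover have "tgt N (?f e) = ?g (tgt P e)" if "e \<in> edges P - outputs P" for e
  proof -
    have e: "?f e \<in> edges N - outputs N" using that f1 i by (metis DiffD1 DiffD2 DiffI)
    then have "tgt P (\<phi> (?f e)) = \<psi> (tgt N (?f e))" using f by (simp add: onetwork_iso_def)
    then have "tgt P e = \<psi> (tgt N (?f e))" using f1(2) that by simp
    moreover have "tgt N (?f e) \<in> verts N" using e net by (auto simp: is_network_def)
    ultimately show ?thesis using g1 by simp
  qed
  ultimately show ?thesis by (simp add: onetwork_iso_def)
qed

lemma network_seq_iso_sym:
  assumes f: "network_seq_iso n \<phi> \<psi> S T" and S: "is_opetope n S"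
  shows "network_seq_iso n (\<lambda>i. inv_into (edges (nets S i)) (\<phi> i))
    (\<lambda>i. inv_into (verts (nets S i)) (\<psi> i)) T S"
proof -
  have "maps S i (inv_into (verts (nets S i)) (\<psi> i) w) =
      inv_into (edges (nets S (Suc i))) (\<phi> (Suc i)) (maps T i w)"
    if i: "i < n" and w: "w \<in> verts (nets T i)" for i w
  proof -
    define v where "v = inv_into (verts (nets S i)) (\<psi> i) w"
    have b: "bij_betw (\<psi> i) (verts (nets S i)) (verts (nets T i))"
      "bij_betw (\<phi> (Suc i)) (edges (nets S (Suc i))) (edges (nets T (Suc i)))"
      using f i by (auto simp: network_seq_iso_def onetwork_iso_def)
    have v: "v \<in> verts (nets S i)" "\<psi> i v = w"
      using b(1) w by (auto simp: v_def bij_betw_def inv_into_into f_inv_into_f)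
    have "bij_betw (maps S i) (verts (nets S i)) (inputs (nets S (Suc i)))"
      using S i by (simp add: is_opetope_def constellation_def)
    moreover have "opetopic_network (nets S (Suc i))" using S i by (simp add: is_opetope_def)
    ultimately have "maps S i v \<in> edges (nets S (Suc i))"
      using v(1) by (auto simp: bij_betw_def opetopic_network_def is_network_def)
    moreover have "maps T i w = \<phi> (Suc i) (maps S i v)"
      using f i v by (auto simp: network_seq_iso_def)
    ultimately show ?thesis using b(2) by (simp add: bij_betw_def v_def)
  qed
  then show ?thesis
    using f S by (simp add: network_seq_iso_def is_opetope_def onetwork_iso_sym)
qed

lemma network_seq_iso_trans:
  assumes f: "network_seq_iso n \<phi> \<psi> S T" and g: "network_seq_iso n \<phi>' \<psi>' T U" and S: "is_opetope n S"
  shows "network_seq_iso n (\<lambda>i e. \<phi>' i (\<phi> i e)) (\<lambda>i v. \<psi>' i (\<psi> i v)) S U"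
proof -
  have "onetwork_iso (\<lambda>e. \<phi>' i (\<phi> i e)) (\<lambda>v. \<psi>' i (\<psi> i v)) (nets S i) (nets U i)" if "i \<le> n" for i
    by (rule onetwork_iso_trans)
      (use f g S that in \<open>auto simp: network_seq_iso_def is_opetope_def opetopic_network_def\<close>)
  moreover have "\<psi> i v \<in> verts (nets T i)" if "i < n" "v \<in> verts (nets S i)" for i v
    using f that bij_betwE less_imp_le unfolding network_seq_iso_def onetwork_iso_def by metis
  ultimately show ?thesis
    using f g by (simp add: network_seq_iso_def)
qed

lemma equiv_opetope_iso_rel: "equiv (opetopes n :: ('e, 'v) network_seq set) (opetope_iso_rel n)"
proof (rule equivI)
  show "opetope_iso_rel n \<subseteq> opetopes n \<times> opetopes n"
    by (auto simp: opetope_iso_rel_def)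
  have "network_seq_iso n (\<lambda>i e. e) (\<lambda>i v. v) S S" for S :: "('e, 'v) network_seq"
    by (simp add: network_seq_iso_def onetwork_iso_refl)
  then show "refl_on (opetopes n :: ('e, 'v) network_seq set) (opetope_iso_rel n)"
    unfolding refl_on_def opetope_iso_rel_def by blast
  show "sym (opetope_iso_rel n)"
    unfolding sym_def opetope_iso_rel_def opetopes_def by (blast dest: network_seq_iso_sym)
  show "trans (opetope_iso_rel n)"
    unfolding trans_def opetope_iso_rel_def opetopes_def by (blast dest: network_seq_iso_trans)
qed

end

theory Submission
  imports Defs
begin

text \<open>
  Everything rests on two facts about an opetopic directed complex. First, boundaries and the chains
  \<open>g\<^sub>q\<^sup>-\<close> have no repeated terms; this follows from loop-freeness by induction on the dimension, starting
  from the augmentation. Second, the networks \<open>G\<^sub>q\<^sup>-\<close> are trees, and since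
  \<open>\<partial>\<partial>\<^sup>+a = \<partial>\<partial>\<^sup>-a\<close>, climbing the tree \<open>G\<^sub>q\<^sub>+\<^sub>1\<^sup>-\<close> from its inputs shows that the boundary of each
  edge \<open>e\<close> is the sum of the boundaries of the inputs below \<open>e\<close>. These inputs are the vertices of
  \<open>G\<^sub>q\<^sup>-\<close>, so the opetope determines all boundaries and hence the complex. Conversely, in an opetope
  every vertex of \<open>N\<^sub>q\<close> with \<open>q < n\<close> has exactly one edge out of it, and the same formula, with
  \<open>\<partial>v\<close> for a vertex \<open>v\<close> the edge out of \<open>v\<close> minus the edges into \<open>v\<close>, defines boundaries on the
  edges; the tree structure gives \<open>\<partial>\<partial> = 0\<close>, and the constellation condition says precisely that
  \<open>\<partial>\<^sup>+e\<close> is a single edge. The higher iterates in the unitality and loop-freeness conditions take care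
  of themselves, because \<open>(\<partial>\<^sup>-)\<^sup>r\<^sup>+\<^sup>1a = \<partial>\<^sup>-(\<partial>\<^sup>+)\<^sup>ra\<close>.
\<close>

section \<open>Chains\<close>

text \<open>The induction for multiplicity-freeness cannot be confined to the chains \<partial>^- a,
  because the auxiliary chain in the argument by contradiction need not be the negative boundary of
  any basis element. It is run on all nonnegative chains \<open>parallel\<close> to a basis element,
  that is with the same boundary; in dimension 0, where boundaries say nothing, augmentation 1 takes
  their place. That an opetope determines its complex also requires every basis element to be
  visible as an edge of some network. This is where atomicity enters, by downward induction on the
  dimension. In the other direction, the single edge out of a vertex of \<open>N q\<close> comes
  from the constellation condition at the corresponding input edge of \<open>N (Suc q)\<close>, and
  the condition at the output edge of \<open>N (Suc q)\<close> shows that the output of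
  \<open>N q\<close> is not an input. Finally, the networks of an opetope may use the same name for
  edges in different dimensions, so the edges are relabelled injectively before they can serve as
  basis elements of one complex; being finite in number, they fit into any infinite type.\<close>

abbreviation coef :: "('a \<Rightarrow>\<^sub>0 int) \<Rightarrow> 'a \<Rightarrow> int"
  where "coef \<equiv> Poly_Mapping.lookup"

abbreviation terms :: "('a \<Rightarrow>\<^sub>0 int) \<Rightarrow> 'a set"
  where "terms \<equiv> Poly_Mapping.keys"

lemma coef_frag_extend: "coef (frag_extend f c) x = (\<Sum>a\<in>terms c. coef c a * coef (f a) x)"
  by (simp add: frag_extend_def lookup_sum)

definition set_chain :: "'a set \<Rightarrow> 'a \<Rightarrow>\<^sub>0 int"
  where "set_chain A = (\<Sum>a\<in>A. frag_of a)"

lemma coef_set_chain: "finite A \<Longrightarrow> coef (set_chain A) x = of_bool (x \<in> A)"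
  by (simp add: set_chain_def lookup_sum sum.delta)

lemma terms_set_chain [simp]: "finite A \<Longrightarrow> terms (set_chain A) = A"
  by (auto simp: in_keys_iff coef_set_chain)

lemma set_chain_singleton [simp]: "set_chain {a} = frag_of a"
  by (simp add: set_chain_def)

lemma set_chain_empty [simp]: "set_chain {} = 0"
  by (simp add: set_chain_def)

lemma frag_extend_set_chain: "finite A \<Longrightarrow> frag_extend f (set_chain A) = (\<Sum>a\<in>A. f a)"
  by (simp add: set_chain_def frag_extend_sum comp_def)

lemma frag_extend_set_chain_image:
  assumes "finite A" "inj_on f A"
  shows "frag_extend (frag_of \<circ> f) (set_chain A) = set_chain (f ` A)"
  using assms by (simp add: frag_extend_set_chain) (simp add: set_chain_def sum.reindex comp_def)

lemma basis_sum_set_chain: "finite A \<Longrightarrow> basis_sum (set_chain A)"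
  by (simp add: basis_sum_def coef_set_chain)

lemma set_chain_terms:
  assumes "\<And>x. 0 \<le> coef c x" "\<And>x. coef c x \<le> 1"
  shows "set_chain (terms c) = c"
proof (rule poly_mapping_eqI)
  fix x
  have "coef c x = 0 \<or> coef c x = 1" using assms[of x] by linarith
  then show "coef (set_chain (terms c)) x = coef c x"
    by (auto simp: coef_set_chain in_keys_iff)
qed

lemma set_chain_diff:
  assumes "finite A" "finite B"
  shows "set_chain A - set_chain B = set_chain (A - B) - set_chain (B - A)"
  using assms by (auto intro!: poly_mapping_eqI simp: lookup_minus coef_set_chain)

lemma set_chain_Union:
  assumes "finite W" "\<And>v. v \<in> W \<Longrightarrow> finite (F v)"
    and "\<And>v w. v \<in> W \<Longrightarrow> w \<in> W \<Longrightarrow> v \<noteq> w \<Longrightarrow> F v \<inter> F w = {}"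
  shows "set_chain (\<Union>v\<in>W. F v) = (\<Sum>v\<in>W. set_chain (F v))"
  unfolding set_chain_def using assms by (intro sum.UNION_disjoint) auto

section \<open>Paths in networks\<close>

text \<open>Relates consecutive edges of a path. For edges, existence of a path becomes
  \<open>rtrancl\<close>, and acyclicity of the network becomes \<open>acyclic\<close>, so that
  well-founded induction is available.\<close>

definition step :: "('e, 'v, 'z) network_scheme \<Rightarrow> ('e \<times> 'e) set"
  where "step N = {(e, e'). \<exists>v \<in> verts N. e \<in> edges_into N v \<and> e' \<in> edges_out_of N v}"

lemma step_edges: "(e, e') \<in> step N \<Longrightarrow> e \<in> edges N - outputs N \<and> e' \<in> edges N - inputs N"
  by (auto simp: step_def edges_into_def edges_out_of_def)

lemma step_rtrancl_edges: "(e, e') \<in> (step N)\<^sup>* \<Longrightarrow> e' \<in> edges N \<longleftrightarrow> e \<in> edges N"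
  by (induction rule: rtrancl_induct) (auto dest: step_edges)

lemma is_path_Cons:
  "is_path N (x # es) (v # vs) \<longleftrightarrow>
    x \<in> edges_into N v \<and> hd es \<in> edges_out_of N v \<and> v \<in> verts N \<and> is_path N es vs"
proof -
  have "es \<noteq> [] \<Longrightarrow> es ! 0 = hd es" by (simp add: hd_conv_nth)
  then show ?thesis
    by (cases es) (auto simp: is_path_def All_less_Suc2 edges_into_def)
qed

lemma is_path_snoc:
  assumes "is_path N es vs" "last es \<in> edges_into N v" "e \<in> edges_out_of N v" "v \<in> verts N"
  shows "is_path N (es @ [e]) (vs @ [v])"
  using assms
proof (induction vs arbitrary: es)
  case Nil
  then obtain x where "es = [x]" by (cases es) (auto simp: is_path_def)
  with Nil show ?case by (auto simp: is_path_def edges_into_def edges_out_of_def)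
next
  case (Cons w vs)
  then obtain x fs where es: "es = x # fs" by (cases es) (auto simp: is_path_def)
  with Cons.prems have "fs \<noteq> []" by (auto simp: is_path_def)
  with Cons es show ?case by (simp add: is_path_Cons)
qed

lemma path_imp_relpow:
  "path_from_to N e' e es vs \<Longrightarrow> (e', e) \<in> step N ^^ length vs"
proof (induction vs arbitrary: e' es)
  case Nil
  then show ?case by (cases es) (auto simp: path_from_to_def is_path_def)
next
  case (Cons v vs)
  then obtain x fs where es: "es = x # fs" by (cases es) (auto simp: path_from_to_def is_path_def)
  with Cons.prems have "fs \<noteq> []" by (auto simp: path_from_to_def is_path_def)
  with Cons.prems es have "(e', hd fs) \<in> step N" "path_from_to N (hd fs) e fs vs"
    by (auto simp: path_from_to_def is_path_Cons step_def)
  with Cons.IH show ?case by (metis relpow_Suc_I2 length_Cons)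
qed

lemma relpow_imp_path:
  "(e', e) \<in> step N ^^ k \<Longrightarrow> e' \<in> edges N \<Longrightarrow> \<exists>es vs. path_from_to N e' e es vs \<and> length vs = k"
proof (induction k arbitrary: e')
  case 0
  then have "path_from_to N e' e [e'] []" by (simp add: path_from_to_def is_path_def)
  then show ?case by (metis list.size(3))
next
  case (Suc k)
  obtain y where y: "(e', y) \<in> step N" "(y, e) \<in> step N ^^ k"
    using relpow_Suc_D2[OF Suc.prems(1)] by blast
  obtain es vs where p: "path_from_to N y e es vs" "length vs = k"
    using Suc.IH[OF y(2)] step_edges[OF y(1)] by blast
  obtain v where "v \<in> verts N" "e' \<in> edges_into N v" "y \<in> edges_out_of N v"
    using y(1) by (auto simp: step_def)
  moreover have "es \<noteq> []" using p by (auto simp: path_from_to_def is_path_def)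
  ultimately have "path_from_to N e' e (e' # es) (v # vs)"
    using p by (auto simp: path_from_to_def is_path_Cons)
  then show ?case using p(2) by (metis length_Cons)
qed

lemma acyclic_network_iff: "acyclic_network N \<longleftrightarrow> acyclic (step N)"
proof
  assume ac: "acyclic_network N"
  have False if "(e, e) \<in> (step N)\<^sup>+" for e
  proof -
    have "\<exists>k>0. (e, e) \<in> step N ^^ k" using that by (simp only: trancl_power)
    then obtain k where k: "k > 0" "(e, e) \<in> step N ^^ k" by blast
    have "e \<in> edges N" using that by (auto dest!: tranclD step_edges)
    then obtain es vs where "path_from_to N e e es vs" "length vs = k"
      using relpow_imp_path[OF k(2)] by blast
    with k(1) ac show False by (auto simp: acyclic_network_def)
  qed
  then show "acyclic (step N)" by (auto simp: acyclic_def)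
next
  assume ac: "acyclic (step N)"
  have "es = [e] \<and> vs = []" if p: "path_from_to N e e es vs" for e es vs
  proof -
    have "vs = []"
    proof (rule ccontr)
      assume "vs \<noteq> []"
      then have "\<exists>k>0. (e, e) \<in> step N ^^ k" using path_imp_relpow[OF p] by auto
      then have "(e, e) \<in> (step N)\<^sup>+" by (simp only: trancl_power)
      with ac show False by (auto simp: acyclic_def)
    qed
    with p show ?thesis by (cases es) (auto simp: path_from_to_def is_path_def)
  qed
  then show "acyclic_network N" by (simp add: acyclic_network_def)
qed

lemma inputs_to_eq:
  assumes "is_network N"
  shows "inputs_to N e = {e' \<in> inputs N. (e', e) \<in> (step N)\<^sup>*}"
proof -
  have "(\<exists>es vs. path_from_to N e' e es vs) \<longleftrightarrow> (e', e) \<in> (step N)\<^sup>*" if "e' \<in> inputs N" for e'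
  proof -
    have "e' \<in> edges N" using that assms by (auto simp: is_network_def)
    show ?thesis
    proof
      assume "\<exists>es vs. path_from_to N e' e es vs"
      then show "(e', e) \<in> (step N)\<^sup>*" unfolding rtrancl_power using path_imp_relpow by fast
    next
      assume "(e', e) \<in> (step N)\<^sup>*"
      then obtain k where "(e', e) \<in> step N ^^ k" unfolding rtrancl_power by fast
      from relpow_imp_path[OF this \<open>e' \<in> edges N\<close>] show "\<exists>es vs. path_from_to N e' e es vs" by fast
    qed
  qed
  then show ?thesis by (auto simp: inputs_to_def)
qed

lemma inputs_to_input:
  assumes "is_network N" "e \<in> inputs N"
  shows "inputs_to N e = {e}"
proof -
  have "e' = e" if "(e', e) \<in> (step N)\<^sup>*" for e'
    using that assms(2) by (auto elim: rtranclE dest: step_edges)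
  then show ?thesis using assms by (auto simp: inputs_to_eq)
qed

section \<open>Boundaries of sets of vertices\<close>

definition outs :: "('e, 'v, 'z) network_scheme \<Rightarrow> 'v set \<Rightarrow> 'e set"
  where "outs N W = {d \<in> edges N - inputs N. src N d \<in> W}"

definition ins :: "('e, 'v, 'z) network_scheme \<Rightarrow> 'v set \<Rightarrow> 'e set"
  where "ins N W = {d \<in> edges N - outputs N. tgt N d \<in> W}"

definition vertex_bd :: "('e, 'v, 'z) network_scheme \<Rightarrow> 'v \<Rightarrow> 'e \<Rightarrow>\<^sub>0 int"
  where "vertex_bd N v = set_chain (edges_out_of N v) - set_chain (edges_into N v)"

definition verts_bd :: "('e, 'v, 'z) network_scheme \<Rightarrow> 'v set \<Rightarrow> 'e \<Rightarrow>\<^sub>0 int"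
  where "verts_bd N W = (\<Sum>v\<in>W. vertex_bd N v)"

lemma outs_Union: "outs N W = (\<Union>v\<in>W. edges_out_of N v)"
  by (auto simp: outs_def edges_out_of_def)

lemma ins_Union: "ins N W = (\<Union>v\<in>W. edges_into N v)"
  by (auto simp: ins_def edges_into_def)

lemma finite_network_sets:
  assumes "is_network N"
  shows "finite (edges N)" "finite (verts N)" "finite (inputs N)" "finite (outputs N)"
    "finite (edges_out_of N v)" "finite (edges_into N v)" "finite (outs N W)" "finite (ins N W)"
    "finite (inputs_to N e)"
  using assms
  by (auto simp: is_network_def edges_out_of_def edges_into_def outs_def ins_def inputs_to_def
      intro: finite_subset)

lemma verts_bd_eq:
  assumes "is_network N" "W \<subseteq> verts N"
  shows "verts_bd N W = set_chain (outs N W) - set_chain (ins N W)"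
proof -
  have W: "finite W" using assms finite_network_sets(2) finite_subset by blast
  have "set_chain (outs N W) = (\<Sum>v\<in>W. set_chain (edges_out_of N v))"
    unfolding outs_Union using W finite_network_sets[OF assms(1)]
    by (intro set_chain_Union) (auto simp: edges_out_of_def)
  moreover have "set_chain (ins N W) = (\<Sum>v\<in>W. set_chain (edges_into N v))"
    unfolding ins_Union using W finite_network_sets[OF assms(1)]
    by (intro set_chain_Union) (auto simp: edges_into_def)
  ultimately show ?thesis by (simp add: verts_bd_def vertex_bd_def sum_subtractf)
qed

text \<open>An edge running between two vertices of \<open>W\<close> occurs once with each sign and
  cancels. What remains is a difference of two disjoint sets, the form in which positive and
  negative parts can be read off.\<close>

lemma verts_bd_disjoint:
  assumes "is_network N" "W \<subseteq> verts N"
  shows "verts_bd N W = set_chain (outs N W - ins N W) - set_chain (ins N W - outs N W)"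
  unfolding verts_bd_eq[OF assms] using finite_network_sets[OF assms(1)] by (intro set_chain_diff)

text \<open>In terms of \<open>outs\<close> and \<open>ins\<close>, the last condition says that the
  positive part of \<open>verts_bd N W\<close> is a single edge, where \<open>W\<close> consists of
  the vertices corresponding to the inputs below \<open>e\<close>.\<close>

lemma constellation_iff:
  "constellation N P c \<longleftrightarrow>
    bij_betw c (verts N) (inputs P) \<and>
    (\<forall>v \<in> verts N. v \<in> thin_verts N \<longleftrightarrow> c v \<in> thin_edges P) \<and>
    (\<forall>e \<in> edges P. \<exists>d. outs N {v \<in> verts N. c v \<in> inputs_to P e} -
      ins N {v \<in> verts N. c v \<in> inputs_to P e} = {d})"
proof -
  have "(\<exists>!d. d \<in> edges N \<and> (\<exists>v \<in> W. d \<in> edges_out_of N v) \<and> \<not> (\<exists>v \<in> W. d \<in> edges_into N v))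
    \<longleftrightarrow> (\<exists>d. outs N W - ins N W = {d})" for W
  proof -
    have "outs N W - ins N W =
        {d. d \<in> edges N \<and> (\<exists>v \<in> W. d \<in> edges_out_of N v) \<and> \<not> (\<exists>v \<in> W. d \<in> edges_into N v)}"
      by (auto simp: outs_Union ins_Union edges_out_of_def)
    moreover have "(\<exists>!d. Q d) \<longleftrightarrow> (\<exists>d. {d. Q d} = {d})" for Q :: "'a \<Rightarrow> bool"
      unfolding Ex1_def set_eq_iff mem_Collect_eq singleton_iff by blast
    ultimately show ?thesis by simp
  qed
  then show ?thesis by (simp add: constellation_def Let_def)
qed

section \<open>Networks with one edge out of each vertex\<close>

text \<open>Every edge that is not an output leads on to a unique next edge, so the network is a
  forest directed towards its outputs, and a tree if there is one output. The networks of a complex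
  and those of an opetope are both instances.\<close>

locale tree_network =
  fixes N :: "('e, 'v, 'z) network_scheme"
  assumes network: "is_network N" and acyclic: "acyclic_network N"
    and single_out: "v \<in> verts N \<Longrightarrow> \<exists>e. edges_out_of N v = {e}"
begin

definition outedge :: "'v \<Rightarrow> 'e"
  where "outedge v = the_elem (edges_out_of N v)"

lemma edges_out_of: "v \<in> verts N \<Longrightarrow> edges_out_of N v = {outedge v}"
  using single_out by (fastforce simp: outedge_def)

lemma outedge_edges: "v \<in> verts N \<Longrightarrow> outedge v \<in> edges N - inputs N"
  and src_outedge: "v \<in> verts N \<Longrightarrow> src N (outedge v) = v"
  using edges_out_of by (auto simp: edges_out_of_def)

lemma outedge_src:
  assumes "e \<in> edges N - inputs N"
  shows "src N e \<in> verts N \<and> outedge (src N e) = e"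
proof -
  have "src N e \<in> verts N" using assms network by (auto simp: is_network_def)
  moreover have "e \<in> edges_out_of N (src N e)" using assms by (simp add: edges_out_of_def)
  ultimately show ?thesis using edges_out_of[of "src N e"] by simp
qed

lemma step_outedge:
  assumes v: "v \<in> verts N"
  shows "(e, outedge v) \<in> step N \<longleftrightarrow> e \<in> edges_into N v"
proof
  assume "(e, outedge v) \<in> step N"
  then obtain w where w: "e \<in> edges_into N w" "outedge v \<in> edges_out_of N w"
    by (auto simp: step_def)
  then have "w = v" using src_outedge[OF v] by (simp add: edges_out_of_def)
  with w show "e \<in> edges_into N v" by simp
next
  assume "e \<in> edges_into N v"
  then show "(e, outedge v) \<in> step N" using v edges_out_of[OF v] by (auto simp: step_def)
qed

lemma stepE:
  assumes "(e, e') \<in> step N"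
  obtains v where "v \<in> verts N" "e \<in> edges_into N v" "e' = outedge v"
  using assms edges_out_of by (auto simp: step_def)

lemma single_valued_step: "single_valued (step N)"
  unfolding single_valued_def by (auto elim!: stepE simp: edges_into_def)

lemma acyclic_step: "acyclic (step N)"
  using acyclic by (simp add: acyclic_network_iff)

lemma no_cycle: "(e, f) \<in> step N \<Longrightarrow> (f, e) \<in> (step N)\<^sup>* \<Longrightarrow> False"
  using acyclic_step by (meson acyclic_def rtrancl_into_trancl2)

lemma finite_step: "finite (step N)"
  by (rule finite_subset[of _ "edges N \<times> edges N"])
    (use finite_network_sets(1)[OF network] in \<open>auto dest: step_edges\<close>)

lemma wf_step: "wf (step N)" and wf_converse_step: "wf ((step N)\<inverse>)"
  using finite_step acyclic_step by (auto intro: finite_acyclic_wf finite_acyclic_wf_converse)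

text \<open>A non-input edge is \<open>outedge\<close> of its source, and the edges into that vertex
  precede it in the well-founded relation \<open>step\<close>. A vertex with no edges into it is
  covered by the second case with a vacuous hypothesis.\<close>

lemma edge_induct [consumes 1, case_names input outedge]:
  assumes "e \<in> edges N"
    and inp: "\<And>e. e \<in> inputs N \<Longrightarrow> P e"
    and out: "\<And>v. v \<in> verts N \<Longrightarrow> (\<And>e'. e' \<in> edges_into N v \<Longrightarrow> P e') \<Longrightarrow> P (outedge v)"
  shows "P e"
  using assms(1)
proof (induction e rule: wf_induct_rule[OF wf_step])
  case (1 e)
  show ?case
  proof (cases "e \<in> inputs N")
    case False
    then have "src N e \<in> verts N" "outedge (src N e) = e" using outedge_src 1 by auto
    then have "P e'" if "e' \<in> edges_into N (src N e)" for e'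
      using that 1(1)[of e'] step_outedge[of "src N e" e'] step_edges[of e' e N] by simp
    then show ?thesis using out[of "src N e"] \<open>src N e \<in> verts N\<close> \<open>outedge (src N e) = e\<close> by simp
  qed (rule inp)
qed

text \<open>The only edge following \<open>d1\<close> is \<open>outedge v\<close>, which also
  follows \<open>d2\<close>; a nontrivial path from \<open>d1\<close> to \<open>d2\<close> would
  therefore close up to a cycle through \<open>outedge v\<close>.\<close>

lemma edges_into_incomparable:
  assumes "v \<in> verts N" "d1 \<in> edges_into N v" "d2 \<in> edges_into N v" "(d1, d2) \<in> (step N)\<^sup>*"
  shows "d1 = d2"
  using assms(4)
proof (cases rule: converse_rtranclE)
  case (step x)
  have "x = outedge v"
    using single_valuedD[OF single_valued_step step(1)] step_outedge[OF assms(1)] assms(2) by simp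
  then show ?thesis using step(2) assms no_cycle step_outedge by blast
qed

section \<open>The inputs below an edge\<close>

lemma inputs_to_outedge:
  assumes v: "v \<in> verts N"
  shows "inputs_to N (outedge v) = (\<Union>e'\<in>edges_into N v. inputs_to N e')"
proof -
  have "(e, outedge v) \<in> (step N)\<^sup>* \<longleftrightarrow> (\<exists>e'\<in>edges_into N v. (e, e') \<in> (step N)\<^sup>*)"
    if "e \<in> inputs N" for e
  proof
    assume "(e, outedge v) \<in> (step N)\<^sup>*"
    then show "\<exists>e'\<in>edges_into N v. (e, e') \<in> (step N)\<^sup>*"
    proof (cases rule: rtranclE)
      case base
      then show ?thesis using outedge_edges[OF v] that by simp
    next
      case (step y)
      then show ?thesis using step_outedge[OF v] by blast
    qed
  next
    assume "\<exists>e'\<in>edges_into N v. (e, e') \<in> (step N)\<^sup>*"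
    then show "(e, outedge v) \<in> (step N)\<^sup>*"
      using step_outedge[OF v] by (auto intro: rtrancl_into_rtrancl)
  qed
  then show ?thesis by (auto simp: inputs_to_eq[OF network])
qed

text \<open>Since \<open>step\<close> is single-valued, of two paths starting at a common edge one
  continues the other, so \<open>e1\<close> and \<open>e2\<close> would be comparable.\<close>

lemma inputs_to_disjoint:
  assumes "v \<in> verts N" "e1 \<in> edges_into N v" "e2 \<in> edges_into N v" "e1 \<noteq> e2"
  shows "inputs_to N e1 \<inter> inputs_to N e2 = {}"
proof -
  have False if "(e, e1) \<in> (step N)\<^sup>*" "(e, e2) \<in> (step N)\<^sup>*" for e
    using single_valued_confluent[OF single_valued_step that] edges_into_incomparable[OF assms(1)]
      assms(2-4) by blast
  then show ?thesis by (auto simp: inputs_to_eq[OF network])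
qed

lemma sum_inputs_to_outedge:
  fixes F :: "'e \<Rightarrow> 'c::comm_monoid_add"
  assumes v: "v \<in> verts N"
  shows "(\<Sum>i\<in>inputs_to N (outedge v). F i) = (\<Sum>e'\<in>edges_into N v. \<Sum>i\<in>inputs_to N e'. F i)"
  unfolding inputs_to_outedge[OF v] using finite_network_sets[OF network] inputs_to_disjoint[OF v]
  by (intro sum.UNION_disjoint) auto

text \<open>Induction from the inputs, splitting the inputs below \<open>outedge v\<close> among the
  edges into \<open>v\<close>. The intended \<open>F\<close> is the boundary of an edge, additive at
  vertices because \<partial>\<partial> = 0.\<close>

lemma sum_inputs_to_unique:
  fixes F :: "'e \<Rightarrow> 'c::comm_monoid_add"
  assumes e: "e \<in> edges N"
    and out: "\<And>v. v \<in> verts N \<Longrightarrow> F (outedge v) = (\<Sum>e'\<in>edges_into N v. F e')"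
  shows "F e = (\<Sum>i\<in>inputs_to N e. F i)"
  using e
proof (induction e rule: edge_induct)
  case (input e)
  then show ?case by (simp add: inputs_to_input[OF network])
next
  case (outedge v)
  then show ?case by (simp add: out sum_inputs_to_outedge)
qed

lemma step_to_output:
  assumes "outputs N = {out}" "e \<in> edges N"
  shows "(e, out) \<in> (step N)\<^sup>*"
  using assms(2)
proof (induction e rule: wf_induct_rule[OF wf_converse_step])
  case (1 e)
  show ?case
  proof (cases "e = out")
    case False
    then have e: "e \<in> edges N - outputs N" using 1 assms by auto
    then have "tgt N e \<in> verts N" using network by (auto simp: is_network_def)
    with e have s: "(e, outedge (tgt N e)) \<in> step N" by (simp add: step_outedge edges_into_def)
    then have "(outedge (tgt N e), out) \<in> (step N)\<^sup>*"
      using 1(1)[of "outedge (tgt N e)"] step_edges[OF s] by simp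
    with s show ?thesis by (rule converse_rtrancl_into_rtrancl)
  qed simp
qed

lemma inputs_to_output: "outputs N = {out} \<Longrightarrow> inputs_to N out = inputs N"
  using step_to_output network by (auto simp: inputs_to_eq[OF network] is_network_def)

text \<open>Follow the path from \<open>d\<close>: an edge of \<open>ins N W\<close> leads to a
  vertex of \<open>W\<close>, and the edge out of that vertex either is in \<open>ins N W\<close>
  again or has left \<open>W\<close> and is then \<open>t\<close>. This will give
  loop-freeness.\<close>

lemma ins_step_top:
  assumes W: "W \<subseteq> verts N" and top: "outs N W - ins N W = {t}" and d: "d \<in> ins N W"
  shows "(d, t) \<in> (step N)\<^sup>+"
  using d
proof (induction d rule: wf_induct_rule[OF wf_converse_step])
  case (1 d)
  define v where "v = tgt N d"
  have v: "v \<in> W" "v \<in> verts N" "d \<in> edges_into N v"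
    using 1 W by (auto simp: ins_def v_def edges_into_def)
  then have s: "(d, outedge v) \<in> step N" by (simp add: step_outedge)
  have "outedge v \<in> outs N W" using v edges_out_of by (auto simp: outs_Union)
  show ?case
  proof (cases "outedge v \<in> ins N W")
    case True
    then have "(outedge v, t) \<in> (step N)\<^sup>+" using 1 s by simp
    with s show ?thesis by (rule trancl_into_trancl2)
  next
    case False
    with \<open>outedge v \<in> outs N W\<close> top have "outedge v = t" by blast
    with s show ?thesis by auto
  qed
qed

text \<open>Going backwards from \<open>f\<close> through vertices of \<open>W\<close> can only stop
  at an edge with no source in \<open>W\<close>; \<open>ne\<close> ensures that it does not get
  stuck at a vertex without edges into it.\<close>

lemma outs_ins_step_bottom:
  assumes W: "W \<subseteq> verts N" and ne: "\<And>v. v \<in> W \<Longrightarrow> edges_into N v \<noteq> {}"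
    and f: "f \<in> outs N W \<union> ins N W"
  shows "\<exists>d \<in> ins N W - outs N W. (d, f) \<in> (step N)\<^sup>*"
  using f
proof (induction f rule: wf_induct_rule[OF wf_step])
  case (1 f)
  show ?case
  proof (cases "f \<in> outs N W")
    case True
    define v where "v = src N f"
    have v: "v \<in> W" "v \<in> verts N" "outedge v = f"
      using True W outedge_src[of f] by (auto simp: outs_def v_def)
    obtain d where d: "d \<in> edges_into N v" using ne v by blast
    then have s: "(d, f) \<in> step N" using v step_outedge by blast
    moreover have "d \<in> ins N W" using d v by (auto simp: ins_Union)
    ultimately obtain d' where "d' \<in> ins N W - outs N W" "(d', d) \<in> (step N)\<^sup>*"
      using 1 by blast
    with s show ?thesis by (meson rtrancl.rtrancl_into_rtrancl)
  next
    case False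
    then show ?thesis using 1 by blast
  qed
qed

text \<open>Let \<open>v\<close> be the target of \<open>b\<close>. Every edge into \<open>v\<close>
  has a bottom edge of \<open>W\<close> below it, which must be \<open>b\<close>; as edges into one
  vertex are incomparable, it equals \<open>b\<close>. This supplies the vertex required in a
  reduced network.\<close>

lemma single_bottom_edges_into:
  assumes W: "W \<subseteq> verts N" and ne: "\<And>v. v \<in> W \<Longrightarrow> edges_into N v \<noteq> {}"
    and b: "ins N W - outs N W = {b}"
  shows "\<exists>v \<in> W. edges_into N v = {b}"
proof -
  define v where "v = tgt N b"
  have v: "v \<in> W" "v \<in> verts N" "b \<in> edges_into N v"
    using b W by (auto simp: ins_def v_def edges_into_def)
  have "f = b" if f: "f \<in> edges_into N v" for f
  proof -
    have "f \<in> ins N W" using f v by (auto simp: ins_Union)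
    then have "\<exists>d \<in> ins N W - outs N W. (d, f) \<in> (step N)\<^sup>*"
      by (intro outs_ins_step_bottom[OF W ne]) auto
    then have "(b, f) \<in> (step N)\<^sup>*" unfolding b by simp
    then show ?thesis using edges_into_incomparable[OF v(2,3) f] by simp
  qed
  with v show ?thesis by blast
qed

lemma linear_network_if:
  assumes inp: "inputs N = {i}" and outp: "outputs N = {out}"
    and into: "\<And>v. v \<in> verts N \<Longrightarrow> \<exists>e. edges_into N v = {e}"
  shows "linear_network N"
proof -
  \<comment> \<open>The path to \<open>e\<close> is built together with the fact that it contains
    everything below \<open>e\<close>; at the output edge this is the whole network.\<close>
  have "\<exists>es vs. path_from_to N i e es vs \<and> set es = {e'. (e', e) \<in> (step N)\<^sup>*} \<and>
      set vs = {v \<in> verts N. (outedge v, e) \<in> (step N)\<^sup>*}" if "e \<in> edges N" for e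
    using that
  proof (induction e rule: edge_induct)
    case (input e)
    then have e: "e = i" "e \<in> edges N" using inp network by (auto simp: is_network_def)
    have "{e'. (e', e) \<in> (step N)\<^sup>*} = {e}"
      using input by (auto elim: rtranclE dest: step_edges)
    moreover have "(outedge v, e) \<notin> (step N)\<^sup>*" if "v \<in> verts N" for v
      using calculation outedge_edges[OF that] input by auto
    ultimately show ?case
      using e by (intro exI[of _ "[i]"] exI[of _ "[]"]) (auto simp: path_from_to_def is_path_def)
  next
    case (outedge v)
    obtain e0 where e0: "edges_into N v = {e0}" using into outedge(1) by blast
    then obtain es vs where p: "path_from_to N i e0 es vs" "set es = {e'. (e', e0) \<in> (step N)\<^sup>*}"
      "set vs = {v \<in> verts N. (outedge v, e0) \<in> (step N)\<^sup>*}"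
      using outedge by auto
    have iff: "(e', outedge v) \<in> (step N)\<^sup>* \<longleftrightarrow> e' = outedge v \<or> (e', e0) \<in> (step N)\<^sup>*" for e'
      using step_outedge[OF outedge(1)] e0 by (auto elim: rtranclE intro: rtrancl_into_rtrancl)
    have "is_path N (es @ [outedge v]) (vs @ [v])"
      using p e0 outedge(1) edges_out_of by (intro is_path_snoc) (auto simp: path_from_to_def)
    moreover have "es \<noteq> []" using p by (auto simp: path_from_to_def is_path_def)
    ultimately have "path_from_to N i (outedge v) (es @ [outedge v]) (vs @ [v])"
      using p by (auto simp: path_from_to_def)
    moreover have "set (vs @ [v]) = {w \<in> verts N. (outedge w, outedge v) \<in> (step N)\<^sup>*}"
      using p(3) outedge(1) iff src_outedge by (auto dest: arg_cong[of _ _ "src N"])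
    moreover have "set (es @ [outedge v]) = {e'. (e', outedge v) \<in> (step N)\<^sup>*}"
      using p(2) iff by auto
    ultimately show ?case by blast
  qed
  moreover have o: "out \<in> edges N" using outp network by (auto simp: is_network_def)
  ultimately obtain es vs where p: "path_from_to N i out es vs"
    "set es = {e'. (e', out) \<in> (step N)\<^sup>*}"
    "set vs = {v \<in> verts N. (outedge v, out) \<in> (step N)\<^sup>*}"
    by blast
  have "set es = edges N"
    using p(2) step_to_output[OF outp] step_rtrancl_edges[of _ out N] o by auto
  moreover have "set vs = verts N"
    using p(3) step_to_output[OF outp] outedge_edges by auto
  ultimately show ?thesis
    using p(1) acyclic unfolding linear_network_def path_from_to_def by metis
qed

text \<open>Along the single path any two edges are comparable, whereas distinct edges into the same
  vertex are not.\<close>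

lemma linear_network_edges_into:
  assumes lin: "linear_network N" and v: "v \<in> verts N"
  shows "\<exists>e. edges_into N v = {e}"
proof -
  obtain es vs where p: "is_path N es vs" "edges N = set es" "verts N = set vs"
    using lin by (auto simp: linear_network_def)
  have len: "length es = Suc (length vs)" using p by (simp add: is_path_def)
  have reach: "r \<le> s \<Longrightarrow> s \<le> length vs \<Longrightarrow> (es ! r, es ! s) \<in> (step N)\<^sup>*" for r s
  proof (induction rule: dec_induct)
    case (step k)
    then have "es ! k \<in> edges_into N (vs ! k) \<and> es ! Suc k \<in> edges_out_of N (vs ! k)" "vs ! k \<in> verts N"
      using p by (auto simp: is_path_def)
    then have "(es ! k, es ! Suc k) \<in> step N" by (auto simp: step_def)
    with step show ?case by (simp add: rtrancl.rtrancl_into_rtrancl)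
  qed simp
  obtain r where r: "r < length vs" "vs ! r = v" using v p(3) by (auto simp: in_set_conv_nth)
  then have e: "es ! r \<in> edges_into N v" using p(1) by (auto simp: is_path_def)
  have "f = es ! r" if f: "f \<in> edges_into N v" for f
  proof -
    have "f \<in> set es" using f p(2) by (auto simp: edges_into_def)
    then obtain s where s: "s \<le> length vs" "f = es ! s"
      using len by (auto simp: in_set_conv_nth less_Suc_eq_le)
    then have "(es ! r, f) \<in> (step N)\<^sup>* \<or> (f, es ! r) \<in> (step N)\<^sup>*"
      using reach[of r s] reach[of s r] r(1) by (cases "r \<le> s") auto
    then show ?thesis using edges_into_incomparable[OF v] e f by blast
  qed
  with e show ?thesis by blast
qed

end

section \<open>Isomorphisms of networks\<close>

lemma onetwork_iso_edges_out_into: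
  assumes iso: "onetwork_iso \<phi> \<psi> N P" and N: "is_network N" and v: "v \<in> verts N"
  shows "edges_out_of P (\<psi> v) = \<phi> ` edges_out_of N v"
    and "edges_into P (\<psi> v) = \<phi> ` edges_into N v"
proof -
  note i = onetwork_iso_in_inputs[OF iso N]
  have sur: "edges P = \<phi> ` edges N" and inj: "inj_on \<psi> (verts N)"
    and src: "\<And>e. e \<in> edges N - inputs N \<Longrightarrow> src P (\<phi> e) = \<psi> (src N e) \<and> src N e \<in> verts N"
    and tgt: "\<And>e. e \<in> edges N - outputs N \<Longrightarrow> tgt P (\<phi> e) = \<psi> (tgt N e) \<and> tgt N e \<in> verts N"
    using iso N by (auto simp: onetwork_iso_def bij_betw_def is_network_def)
  show "edges_out_of P (\<psi> v) = \<phi> ` edges_out_of N v"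
  proof
    show "edges_out_of P (\<psi> v) \<subseteq> \<phi> ` edges_out_of N v"
    proof
      fix e assume e: "e \<in> edges_out_of P (\<psi> v)"
      then obtain d where d: "e = \<phi> d" "d \<in> edges N - inputs N"
        using sur i by (auto simp: edges_out_of_def)
      then show "e \<in> \<phi> ` edges_out_of N v"
        using e src[OF d(2)] inj v by (auto simp: edges_out_of_def dest: inj_onD)
    qed
    show "\<phi> ` edges_out_of N v \<subseteq> edges_out_of P (\<psi> v)"
      using i src by (auto simp: edges_out_of_def)
  qed
  show "edges_into P (\<psi> v) = \<phi> ` edges_into N v"
  proof
    show "edges_into P (\<psi> v) \<subseteq> \<phi> ` edges_into N v"
    proof
      fix e assume e: "e \<in> edges_into P (\<psi> v)"
      then obtain d where d: "e = \<phi> d" "d \<in> edges N - outputs N"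
        using sur i by (auto simp: edges_into_def)
      then show "e \<in> \<phi> ` edges_into N v"
        using e tgt[OF d(2)] inj v by (auto simp: edges_into_def dest: inj_onD)
    qed
    show "\<phi> ` edges_into N v \<subseteq> edges_into P (\<psi> v)"
      using i tgt by (auto simp: edges_into_def)
  qed
qed

lemma onetwork_iso_step:
  assumes iso: "onetwork_iso \<phi> \<psi> N P" and N: "is_network N"
  shows "step P = map_prod \<phi> \<phi> ` step N"
proof -
  have "verts P = \<psi> ` verts N" using iso by (simp add: onetwork_iso_def bij_betw_def)
  then show ?thesis
    using onetwork_iso_edges_out_into[OF iso N] by (fastforce simp: step_def image_iff)
qed

lemma onetwork_iso_inputs_to:
  assumes iso: "onetwork_iso \<phi> \<psi> N P" and N: "is_network N" and P: "is_network P"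
    and e: "e \<in> edges N"
  shows "inputs_to P (\<phi> e) = \<phi> ` inputs_to N e"
proof -
  have inj: "inj_on \<phi> (edges N)" and inp: "inputs P = \<phi> ` inputs N"
    using iso by (auto simp: onetwork_iso_def bij_betw_def)
  have s: "step P = map_prod \<phi> \<phi> ` step N" by (rule onetwork_iso_step[OF iso N])
  have 1: "(\<phi> x, \<phi> y) \<in> (step P)\<^sup>*" if "(x, y) \<in> (step N)\<^sup>*" for x y
    using that
  proof (induction rule: rtrancl_induct)
    case (step y z)
    then have "(\<phi> y, \<phi> z) \<in> step P" by (force simp: s)
    with step.IH show ?case by (rule rtrancl_into_rtrancl)
  qed simp
  \<comment> \<open>A path that starts in the image of \<open>\<phi>\<close> stays there, and
    injectivity identifies the intermediate edges, so it lifts to \<open>N\<close>.\<close>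
  have 2: "\<exists>y \<in> edges N. w = \<phi> y \<and> (x, y) \<in> (step N)\<^sup>*"
    if "(\<phi> x, w) \<in> (step P)\<^sup>*" "x \<in> edges N" for x w
    using that
  proof (induction rule: rtrancl_induct)
    case (step y z)
    then obtain y' where y': "y' \<in> edges N" "y = \<phi> y'" "(x, y') \<in> (step N)\<^sup>*" by blast
    obtain a b where ab: "(a, b) \<in> step N" "y = \<phi> a" "z = \<phi> b" using step(2) s by auto
    then have "a = y'" using y' inj_onD[OF inj, of a y'] step_edges[OF ab(1)] by simp
    then show ?case
      using ab y' step_edges[OF ab(1)] rtrancl_into_rtrancl[of x a "step N" b] by auto
  qed auto
  have "(\<phi> x, \<phi> e) \<in> (step P)\<^sup>* \<longleftrightarrow> (x, e) \<in> (step N)\<^sup>*" if "x \<in> inputs N" for x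
  proof -
    have "x \<in> edges N" using that N by (auto simp: is_network_def)
    then show ?thesis using 1 2[of x "\<phi> e"] inj e by (auto dest: inj_onD)
  qed
  then show ?thesis by (auto simp: inputs_to_eq[OF N] inputs_to_eq[OF P] inp)
qed

lemma onetwork_iso_verts_bd:
  assumes iso: "onetwork_iso \<phi> \<psi> N P" and N: "is_network N" and W: "W \<subseteq> verts N"
  shows "verts_bd P (\<psi> ` W) = frag_extend (frag_of \<circ> \<phi>) (verts_bd N W)"
proof -
  have inj: "inj_on \<phi> (edges N)" "inj_on \<psi> W"
    using iso W by (auto simp: onetwork_iso_def bij_betw_def intro: inj_on_subset)
  have fin: "finite W" using W finite_network_sets(2)[OF N] finite_subset by blast
  have "vertex_bd P (\<psi> v) = frag_extend (frag_of \<circ> \<phi>) (vertex_bd N v)" if "v \<in> W" for v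
  proof -
    have "inj_on \<phi> (edges_out_of N v)" "inj_on \<phi> (edges_into N v)"
      using inj(1) by (auto simp: edges_out_of_def edges_into_def intro: inj_on_subset)
    moreover have "v \<in> verts N" using that W by blast
    ultimately show ?thesis
      using finite_network_sets[OF N]
      by (simp add: vertex_bd_def onetwork_iso_edges_out_into[OF iso N] frag_extend_diff
          frag_extend_set_chain_image)
  qed
  then show ?thesis
    using inj(2) fin by (simp add: verts_bd_def sum.reindex frag_extend_sum comp_def)
qed

section \<open>Complexes in which every boundary has a single positive term\<close>

text \<open>The augmentation with value 1 on every basis element. Unitality forces
  \<open>aug\<close> to be this map on 0-chains, and it is the augmentation chosen for the complex
  of an opetope.\<close>

definition coef_sum :: "('a \<Rightarrow>\<^sub>0 int) \<Rightarrow> int"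
  where "coef_sum c = (\<Sum>a\<in>terms c. coef c a)"

text \<open>Collapsing all basis elements to one point exhibits \<open>coef_sum\<close> as a
  coefficient of a \<open>frag_extend\<close>, from which it inherits linearity.\<close>

lemma coef_sum_conv_coef: "coef_sum c = coef (frag_extend (\<lambda>_. frag_of ()) c) ()"
  by (simp add: coef_sum_def coef_frag_extend)

lemma coef_sum_diff: "coef_sum (c - d) = coef_sum c - coef_sum d"
  by (simp add: coef_sum_conv_coef frag_extend_diff lookup_minus)

lemma coef_sum_cmul: "coef_sum (frag_cmul k c) = k * coef_sum c"
  by (simp add: coef_sum_conv_coef frag_extend_cmul)

lemma coef_sum_sum: "finite I \<Longrightarrow> coef_sum (\<Sum>i\<in>I. c i) = (\<Sum>i\<in>I. coef_sum (c i))"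
  by (simp add: coef_sum_conv_coef frag_extend_sum lookup_sum)

lemma coef_sum_frag_of [simp]: "coef_sum (frag_of a) = 1"
  by (simp add: coef_sum_conv_coef)

lemma coef_sum_set_chain: "finite A \<Longrightarrow> coef_sum (set_chain A) = int (card A)"
  by (simp add: set_chain_def coef_sum_sum)

lemma coef_le_coef_sum: "(\<And>y. 0 \<le> coef c y) \<Longrightarrow> coef c x \<le> coef_sum c"
  unfolding coef_sum_def by (cases "x \<in> terms c") (auto simp: in_keys_iff intro: member_le_sum sum_nonneg)

lemma carrier_chain_gp: "c \<in> carrier (chain_gp K q) \<longleftrightarrow> terms c \<subseteq> basis_of K q"
  by (simp add: chain_gp_def)

text \<open>The calculus of sources and targets, shared by opetopic complexes and by the complex
  built from an opetope, whose loop-freeness and unitality are obtained with its help.\<close>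

locale single_target =
  fixes K :: "('a, 'z) dcomplex_scheme"
  assumes complex: "free_aug_dcomplex K"
    and single: "a \<in> elems K \<Longrightarrow> 0 < edim K a \<Longrightarrow> \<exists>b \<in> elems K. bd_plus K (frag_of a) = frag_of b"
begin

abbreviation basis :: "nat \<Rightarrow> 'a set"
  where "basis \<equiv> basis_of K"

abbreviation source :: "'a \<Rightarrow> 'a \<Rightarrow>\<^sub>0 int"
  where "source a \<equiv> bd_minus K (frag_of a)"

definition target :: "'a \<Rightarrow> 'a"
  where "target a = (THE b. bd_plus K (frag_of a) = frag_of b)"

text \<open>Agrees with \<open>bd K\<close> on chains of a single dimension, which is where the
  axioms constrain \<open>bd K\<close>; as a \<open>frag_extend\<close> it is linear with no
  conditions on dimensions.\<close>

definition lin_bd :: "('a \<Rightarrow>\<^sub>0 int) \<Rightarrow> 'a \<Rightarrow>\<^sub>0 int"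
  where "lin_bd c = frag_extend (\<lambda>a. bd K (frag_of a)) c"

lemma bd_terms: "terms c \<subseteq> basis (Suc q) \<Longrightarrow> terms (bd K c) \<subseteq> basis q"
  using chain_gp_bd[OF complex] by (simp add: carrier_chain_gp)

lemma bd_0: "terms c \<subseteq> basis 0 \<Longrightarrow> bd K c = 0"
  using complex by (simp add: free_aug_dcomplex_def carrier_chain_gp)

lemma bd_add:
  assumes "terms c \<subseteq> basis q" "terms d \<subseteq> basis q"
  shows "bd K (c + d) = bd K c + bd K d"
proof (cases q)
  case 0
  then show ?thesis using assms bd_0 keys_add[of c d] by (metis Un_least add_0 subset_trans)
next
  case (Suc p)
  then have "bd K \<in> hom (chain_gp K q) (chain_gp K p)"
    using complex by (simp add: free_aug_dcomplex_def)
  then show ?thesis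
    using assms by (auto simp: hom_def chain_gp_def)
qed

lemma bd_diff:
  assumes "terms c \<subseteq> basis q" "terms d \<subseteq> basis q"
  shows "bd K (c - d) = bd K c - bd K d"
proof -
  have "terms (c - d) \<subseteq> basis q" using assms keys_diff[of c d] by blast
  from bd_add[OF this assms(2)] show ?thesis by simp
qed

lemma bd_eq_lin_bd:
  assumes "terms c \<subseteq> basis q"
  shows "bd K c = lin_bd c"
proof (rule free_Abelian_group_induct[OF assms, where P = "\<lambda>c. bd K c = lin_bd c"])
  show "bd K 0 = lin_bd 0" using bd_diff[of 0 q 0] by (simp add: lin_bd_def)
next
  fix x y assume "terms x \<subseteq> basis q" "terms y \<subseteq> basis q" "bd K x = lin_bd x" "bd K y = lin_bd y"
  then show "bd K (x - y) = lin_bd (x - y)" by (simp add: bd_diff lin_bd_def frag_extend_diff)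
next
  show "bd K (frag_of a) = lin_bd (frag_of a)" for a by (simp add: lin_bd_def)
qed

lemma bd_bd: "terms c \<subseteq> basis q \<Longrightarrow> lin_bd (bd K c) = 0"
proof (cases q)
  case 0
  then show "terms c \<subseteq> basis q \<Longrightarrow> lin_bd (bd K c) = 0" by (simp add: bd_0 lin_bd_def)
next
  case (Suc p)
  assume c: "terms c \<subseteq> basis q"
  then have "lin_bd (bd K c) = bd K (bd K c)" using bd_eq_lin_bd bd_terms Suc by metis
  also have "\<dots> = 0" using complex c by (simp add: free_aug_dcomplex_def carrier_chain_gp)
  finally show ?thesis .
qed

lemma aug_diff:
  assumes "terms c \<subseteq> basis 0" "terms d \<subseteq> basis 0"
  shows "aug K (c - d) = aug K c - aug K d"
proof -
  have "aug K \<in> hom (chain_gp K 0) integer_group"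
    using complex by (simp add: free_aug_dcomplex_def)
  moreover have "terms (c - d) \<subseteq> basis 0" using assms keys_diff[of c d] by blast
  ultimately have "aug K ((c - d) \<otimes>\<^bsub>chain_gp K 0\<^esub> d) = aug K (c - d) + aug K d"
    using assms(2) hom_mult[of "aug K" "chain_gp K 0" integer_group "c - d" d]
    by (simp add: carrier_chain_gp)
  then show ?thesis by (simp add: chain_gp_def)
qed

lemma aug_bd: "terms c \<subseteq> basis (Suc 0) \<Longrightarrow> aug K (bd K c) = 0"
  using complex by (simp add: free_aug_dcomplex_def carrier_chain_gp)

lemma aug_eq_coef_sum:
  assumes "\<And>a. a \<in> basis 0 \<Longrightarrow> aug K (frag_of a) = 1" "terms c \<subseteq> basis 0"
  shows "aug K c = coef_sum c"
proof (rule free_Abelian_group_induct[OF assms(2), where P = "\<lambda>c. aug K c = coef_sum c"])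
  show "aug K 0 = coef_sum 0" using aug_diff[of 0 0] by (simp add: coef_sum_def)
next
  fix x y assume "terms x \<subseteq> basis 0" "terms y \<subseteq> basis 0" "aug K x = coef_sum x" "aug K y = coef_sum y"
  then show "aug K (x - y) = coef_sum (x - y)" by (simp add: aug_diff coef_sum_diff)
next
  show "aug K (frag_of a) = coef_sum (frag_of a)" if "a \<in> basis 0" for a using assms(1) that by simp
qed

lemma coef_source_nonneg: "0 \<le> coef (source a) x"
  by (simp add: lookup_bd_minus)

lemma target:
  assumes "a \<in> basis (Suc q)"
  shows "bd_plus K (frag_of a) = frag_of (target a)" "target a \<in> basis q"
    "terms (source a) \<subseteq> basis q" "bd K (frag_of a) = frag_of (target a) - source a"
    "target a \<notin> terms (source a)"
proof -
  have "a \<in> elems K" "0 < edim K a" using assms by (auto simp: basis_of_def)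
  from single[OF this] obtain b where b: "bd_plus K (frag_of a) = frag_of b" by (elim bexE)
  then have "target a = b"
    unfolding target_def by (intro the_equality) (simp_all add: frag_of_eq)
  with b show t: "bd_plus K (frag_of a) = frag_of (target a)" by simp
  have sub: "terms (bd K (frag_of a)) \<subseteq> basis q"
    using bd_terms[of "frag_of a" q] assms by simp
  have "coef (bd_plus K (frag_of a)) (target a) = 1" using t by simp
  then have "coef (bd K (frag_of a)) (target a) \<noteq> 0" by (auto simp: lookup_bd_plus)
  then show "target a \<in> basis q" using sub by (auto simp: in_keys_iff)
  show "terms (source a) \<subseteq> basis q"
    using sub by (auto simp: in_keys_iff lookup_bd_minus)
  show "bd K (frag_of a) = frag_of (target a) - source a" "target a \<notin> terms (source a)"
    using bd_plus_minus_iff[of "frag_of (target a)" K "frag_of a" "source a"] t by auto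
qed

text \<open>Disjoint sets whose difference is the boundary can only be its positive and negative
  parts. In this way boundaries computed in networks are matched with \<open>target\<close> and
  \<open>source\<close>.\<close>

lemma target_sourceI:
  assumes a: "a \<in> basis (Suc q)" and eq: "bd K (frag_of a) = set_chain A - set_chain B"
    and fin: "finite A" "finite B" and disj: "A \<inter> B = {}"
  shows "A = {target a}" "terms (source a) = B"
proof -
  have "set_chain A = bd_plus K (frag_of a) \<and> set_chain B = source a"
    unfolding bd_plus_minus_iff using assms by (simp add: basis_sum_set_chain)
  then show "A = {target a}" "terms (source a) = B"
    using target(1)[OF a] terms_set_chain fin by (metis keys_frag_of)+
qed

section \<open>Iterated positive and negative boundaries\<close>

lemma target_funpow: "a \<in> basis q \<Longrightarrow> r \<le> q \<Longrightarrow> (target ^^ r) a \<in> basis (q - r)"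
proof (induction r)
  case (Suc r)
  then have "(target ^^ r) a \<in> basis (Suc (q - Suc r))" by (simp add: Suc_diff_Suc)
  then show ?case using target(2) by simp
qed simp

lemma bd_plus_funpow:
  "a \<in> basis q \<Longrightarrow> r \<le> q \<Longrightarrow> (bd_plus K ^^ r) (frag_of a) = frag_of ((target ^^ r) a)"
proof (induction r)
  case (Suc r)
  then have "(target ^^ r) a \<in> basis (Suc (q - Suc r))"
    using target_funpow[of a q r] by (simp add: Suc_diff_Suc)
  then show ?case using Suc target(1) by simp
qed simp

text \<open>Loop-freeness quantifies over all \<open>r > 0\<close>, also beyond the dimension of
  \<open>a\<close>, where the iterates vanish because \<open>bd K\<close> is 0 on 0-chains.\<close>

lemma bd_plus_funpow_0:
  assumes "a \<in> basis q" "q < r"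
  shows "(bd_plus K ^^ r) (frag_of a) = 0"
  using assms(2)
proof (induction r rule: less_induct)
  case (less r)
  then obtain p where r: "r = Suc p" by (cases r) auto
  have zero: "bd_plus K c = 0" if "bd K c = 0" for c
    using that by (auto intro: poly_mapping_eqI simp: lookup_bd_plus)
  show ?case
  proof (cases "q = p")
    case True
    have "(target ^^ q) a \<in> basis 0" using target_funpow[of a q q] assms by simp
    then show ?thesis
      using bd_plus_funpow[of a q q] assms True r bd_0[of "frag_of ((target ^^ q) a)"]
      by (simp add: zero)
  next
    case False
    then have "(bd_plus K ^^ p) (frag_of a) = 0" using less r by simp
    then show ?thesis using r bd_0[of 0] by (simp add: zero)
  qed
qed

lemma lin_bd_source:
  assumes "a \<in> basis (Suc q)"
  shows "lin_bd (source a) = lin_bd (frag_of (target a))"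
proof -
  have "lin_bd (frag_of (target a) - source a) = 0"
    using bd_bd[of "frag_of a" "Suc q"] target[OF assms] assms by simp
  then show ?thesis by (simp add: lin_bd_def frag_extend_diff)
qed

text \<open>By \<partial>\<partial>a = 0 the chains \<open>source a\<close> and
  \<open>frag_of (target a)\<close> have the same boundary, hence the same negative part.\<close>

lemma bd_minus_source:
  assumes "a \<in> basis (Suc q)"
  shows "bd_minus K (source a) = source (target a)"
proof -
  have "bd K (source a) = lin_bd (source a)" using target(3)[OF assms] by (rule bd_eq_lin_bd)
  also have "\<dots> = bd K (frag_of (target a))"
    using lin_bd_source[OF assms] target(2)[OF assms] by (simp add: bd_eq_lin_bd[of _ q])
  finally show ?thesis by (simp add: bd_minus_def)
qed

lemma bd_minus_funpow:
  "a \<in> basis q \<Longrightarrow> r < q \<Longrightarrow> (bd_minus K ^^ Suc r) (frag_of a) = source ((target ^^ r) a)"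
proof (induction r)
  case (Suc r)
  then have t: "(target ^^ r) a \<in> basis (Suc (q - Suc r))"
    using target_funpow[of a q r] by (simp add: Suc_diff_Suc)
  have "(bd_minus K ^^ Suc (Suc r)) (frag_of a) = bd_minus K ((bd_minus K ^^ Suc r) (frag_of a))"
    by simp
  also have "\<dots> = bd_minus K (source ((target ^^ r) a))"
    by (rule arg_cong[OF Suc.IH[OF Suc.prems(1) Suc_lessD[OF Suc.prems(2)]]])
  also have "\<dots> = source ((target ^^ Suc r) a)" using bd_minus_source[OF t] by simp
  finally show ?case .
qed simp

lemma loop_freeI:
  assumes R: "partial_order_on (elems K) R"
    and less: "\<And>q a x. a \<in> basis (Suc q) \<Longrightarrow> x \<in> terms (source a) \<Longrightarrow> (x, target a) \<in> R \<and> x \<noteq> target a"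
  shows "loop_free K"
proof -
  have "(x, y) \<in> R \<and> x \<noteq> y"
    if a: "a \<in> elems K" "0 < r" and x: "x \<in> terms ((bd_minus K ^^ r) (frag_of a))"
      and y: "y \<in> terms ((bd_plus K ^^ r) (frag_of a))" for a r x y
  proof -
    define q where "q = edim K a"
    have aq: "a \<in> basis q" using a by (simp add: basis_of_def q_def)
    \<comment> \<open>The existence of \<open>y\<close> excludes \<open>r > q\<close>, where the
      positive iterate is 0.\<close>
    have rq: "r \<le> q" using bd_plus_funpow_0[OF aq, of r] y by (cases "q < r") auto
    obtain p where r: "r = Suc p" using a(2) by (cases r) auto
    have "(target ^^ p) a \<in> basis (Suc (q - r))"
      using target_funpow[OF aq, of p] rq r by (simp add: Suc_diff_Suc)
    moreover have "y = target ((target ^^ p) a)" using y bd_plus_funpow[OF aq rq] r by simp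
    moreover have "x \<in> terms (source ((target ^^ p) a))"
      using x bd_minus_funpow[OF aq, of p] rq r by simp
    ultimately show ?thesis using less by blast
  qed
  then show ?thesis using R unfolding loop_free_def by blast
qed

lemma aug_source:
  assumes "a \<in> basis (Suc 0)"
  shows "aug K (source a) = aug K (frag_of (target a))"
proof -
  have "aug K (frag_of (target a) - source a) = 0"
    using aug_bd[of "frag_of a"] target(4)[OF assms] assms by simp
  then show ?thesis using aug_diff target[OF assms] by simp
qed

text \<open>For positive \<open>q\<close> both iterates are governed by the one-dimensional element
  left after \<open>q - 1\<close> targets; its source and target have equal augmentation because
  \<epsilon>\<partial> = 0.\<close>

lemma unitalI:
  assumes one: "\<And>x. x \<in> basis 0 \<Longrightarrow> aug K (frag_of x) = 1"
  shows "unital K"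
proof -
  have "aug K ((bd_minus K ^^ q) (frag_of a)) = 1 \<and> aug K ((bd_plus K ^^ q) (frag_of a)) = 1"
    if a: "a \<in> basis q" for a q
  proof (cases q)
    case 0
    then show ?thesis using a one by simp
  next
    case (Suc p)
    have b: "(target ^^ p) a \<in> basis (Suc 0)" using target_funpow[OF a, of p] Suc by simp
    moreover have "(bd_minus K ^^ q) (frag_of a) = source ((target ^^ p) a)"
      using bd_minus_funpow[OF a, of p] Suc by simp
    moreover have "(bd_plus K ^^ q) (frag_of a) = frag_of (target ((target ^^ p) a))"
      using bd_plus_funpow[OF a, of q] Suc by simp
    ultimately show ?thesis using one target(2)[OF b] aug_source[OF b] by simp
  qed
  then show ?thesis by (simp add: unital_def basis_of_def)
qed

end

section \<open>Opetopic directed complexes have multiplicity-free boundaries\<close>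

lemma sum_le_one_disjoint:
  assumes "finite I" "\<And>i x. i \<in> I \<Longrightarrow> 0 \<le> coef (c i) x" "coef (\<Sum>i\<in>I. c i) x \<le> 1"
    and ij: "i \<in> I" "j \<in> I" "x \<in> terms (c i)" "x \<in> terms (c j)"
  shows "i = j"
proof (rule ccontr)
  assume "i \<noteq> j"
  then have "coef (c i) x + coef (c j) x = (\<Sum>k\<in>{i, j}. coef (c k) x)" by simp
  also have "\<dots> \<le> (\<Sum>k\<in>I. coef (c k) x)" using assms by (intro sum_mono2) auto
  also have "\<dots> \<le> 1" using assms(3) by (simp add: lookup_sum)
  finally show False
    using assms(2)[OF ij(1), of x] assms(2)[OF ij(2), of x] ij(3,4) by (auto simp: in_keys_iff)
qed

lemma terms_sum_nonneg:
  assumes "finite I" "\<And>i x. i \<in> I \<Longrightarrow> 0 \<le> coef (c i) x"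
  shows "terms (\<Sum>i\<in>I. c i) = (\<Union>i\<in>I. terms (c i))"
  using assms by (auto simp: in_keys_iff lookup_sum sum_nonneg_eq_0_iff)

lemma terms_add_nonneg:
  assumes "\<And>x. 0 \<le> coef c x" "\<And>x. 0 \<le> coef d x"
  shows "terms (c + d) = terms c \<union> terms d"
  using assms by (auto simp: in_keys_iff lookup_add add_nonneg_eq_0_iff)

locale opetopic =
  fixes n :: nat and K :: "'a odcomplex"
  assumes opetopic: "opetopic_dcomplex n K"

sublocale opetopic \<subseteq> single_target K
  using opetopic by unfold_locales (auto simp: opetopic_dcomplex_def)

context opetopic
begin

section \<open>Consequences of unitality and loop-freeness\<close>

lemma aug_basis: "a \<in> basis 0 \<Longrightarrow> aug K (frag_of a) = 1"
  using opetopic by (auto simp: opetopic_dcomplex_def unital_def basis_of_def)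

text \<open>The relations that loop-freeness demands for \<open>r = 1\<close>, in all dimensions at
  once. A cycle of edges in one of the networks would be a cycle of \<open>arrow\<close>.\<close>

definition arrow :: "('a \<times> 'a) set"
  where "arrow = {(x, target a) |x a. x \<in> terms (source a) \<and> a \<in> elems K \<and> 0 < edim K a}"

lemma arrowI: "a \<in> basis (Suc q) \<Longrightarrow> x \<in> terms (source a) \<Longrightarrow> (x, target a) \<in> arrow"
  by (auto simp: arrow_def basis_of_def)

lemma acyclic_arrow: "acyclic arrow"
proof -
  have "loop_free K" using opetopic by (simp add: opetopic_dcomplex_def)
  then obtain R where R: "partial_order_on (elems K) R" and
    less: "\<forall>a \<in> elems K. \<forall>r > 0. \<forall>x \<in> terms ((bd_minus K ^^ r) (frag_of a)).
      \<forall>y \<in> terms ((bd_plus K ^^ r) (frag_of a)). (x, y) \<in> R \<and> x \<noteq> y"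
    unfolding loop_free_def by (elim exE conjE)
  have arrow_R: "(x, y) \<in> R \<and> x \<noteq> y" if xy: "(x, y) \<in> arrow" for x y
  proof -
    obtain a where a: "x \<in> terms (source a)" "y = target a" "a \<in> elems K" "0 < edim K a"
      using xy by (auto simp: arrow_def)
    then have "a \<in> basis (Suc (edim K a - 1))" by (simp add: basis_of_def)
    then have "terms ((bd_plus K ^^ 1) (frag_of a)) = {target a}" by (simp add: target(1))
    moreover have "x \<in> terms ((bd_minus K ^^ 1) (frag_of a))" using a(1) by simp
    ultimately show ?thesis
      using less[rule_format, OF a(3), of 1 x y] a(2) by simp
  qed
  have "(x, y) \<in> R \<and> x \<noteq> y" if "(x, y) \<in> arrow\<^sup>+" for x y
    using that
  proof (induction rule: trancl_induct)
    case (base y)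
    then show ?case by (rule arrow_R)
  next
    case (step y z)
    then have "(y, z) \<in> R" "y \<noteq> z" "(x, y) \<in> R" using arrow_R by auto
    moreover have "trans R" "antisym R" using partial_order_onD[OF R] by auto
    ultimately show ?case by (metis antisymD transD)
  qed
  then show ?thesis by (auto simp: acyclic_def)
qed

text \<open>The class of chains for which multiplicities are bounded. It contains the sources, and
  it also contains chains obtained from \<open>t\<close> by subtracting boundaries as long as they
  stay nonnegative. The augmentation clause makes up for the boundary condition, which is void in
  dimension 0.\<close>

definition parallel :: "nat \<Rightarrow> ('a \<Rightarrow>\<^sub>0 int) \<Rightarrow> 'a \<Rightarrow> bool"
  where "parallel q z t \<longleftrightarrow> terms z \<subseteq> basis q \<and> (\<forall>x. 0 \<le> coef z x) \<and> t \<in> basis q \<and>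
    lin_bd z = lin_bd (frag_of t) \<and> (q = 0 \<longrightarrow> aug K z = 1)"

lemma coef_lin_bd:
  assumes "terms y \<subseteq> basis (Suc q)"
  shows "coef (lin_bd y) f =
    (\<Sum>c\<in>terms y. coef y c * of_bool (f = target c)) - (\<Sum>c\<in>terms y. coef y c * coef (source c) f)"
proof -
  have "coef (lin_bd y) f = (\<Sum>c\<in>terms y. coef y c * coef (bd K (frag_of c)) f)"
    by (simp add: lin_bd_def coef_frag_extend)
  also have "\<dots> = (\<Sum>c\<in>terms y. coef y c * of_bool (f = target c) - coef y c * coef (source c) f)"
  proof (rule sum.cong[OF refl])
    fix c assume "c \<in> terms y"
    then have "bd K (frag_of c) = frag_of (target c) - source c" using assms target(4) by blast
    then show "coef y c * coef (bd K (frag_of c)) f =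
        coef y c * of_bool (f = target c) - coef y c * coef (source c) f"
      by (simp add: lookup_minus right_diff_distrib)
  qed
  finally show ?thesis by (simp add: sum_subtractf)
qed

text \<open>
  A repeated term \<open>e\<close> would survive, still repeated, in the chain obtained from \<open>t\<close> by subtracting
  the boundaries of the terms of \<open>y\<close> lying above \<open>e\<close>; but that chain is parallel to \<open>t\<close>.
\<close>

lemma multiplicity_step:
  assumes IH: "\<And>z t x. parallel q z t \<Longrightarrow> coef z x \<le> 1"
    and y: "terms y \<subseteq> basis (Suc q)" "\<And>x. 0 \<le> coef y x"
    and t: "t \<in> basis q" and s: "\<And>x. 0 \<le> coef s x"
    and bd: "lin_bd y = frag_of t - s"
  shows "coef (frag_of t + frag_extend source y) e \<le> 1"
proof (rule ccontr)
  \<comment> \<open>\<open>S A f\<close> counts the occurrences of \<open>f\<close> in the sources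
    of the terms of \<open>y\<close> in \<open>A\<close>, and \<open>P A f\<close> its occurrences
    as their target.\<close>
  define S where "S A f = (\<Sum>c\<in>A. coef y c * coef (source c) f)" for A f
  define P where "P A f = (\<Sum>c\<in>A. coef y c * of_bool (f = target c))" for A f
  define U where "U = {c \<in> terms y. (e, target c) \<in> arrow\<^sup>+}"
  \<comment> \<open>Subtracting the boundary of \<open>c\<close> trades \<open>target c\<close> for
    \<open>source c\<close>, so \<open>z\<close> expands \<open>t\<close> downwards using exactly
    the terms of \<open>y\<close> with target strictly above \<open>e\<close>.\<close>
  define z where "z = frag_of t - (\<Sum>c\<in>U. frag_cmul (coef y c) (bd K (frag_of c)))"
  assume "\<not> coef (frag_of t + frag_extend source y) e \<le> 1"
  then have "\<not> of_bool (e = t) + S (terms y) e \<le> 1"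
    by (simp add: S_def lookup_add coef_frag_extend of_bool_def)
  then have e: "of_bool (e = t) + S (terms y) e \<ge> 2" by linarith
  have U: "U \<subseteq> terms y" "finite U" by (auto simp: U_def)
  have cz: "coef z f = of_bool (f = t) + S U f - P U f" for f
  proof -
    have "(\<Sum>c\<in>U. coef y c * coef (bd K (frag_of c)) f) = P U f - S U f"
      unfolding P_def S_def sum_subtractf[symmetric]
    proof (rule sum.cong[OF refl])
      fix c assume "c \<in> U"
      then have "bd K (frag_of c) = frag_of (target c) - source c" using U y(1) target(4) by blast
      then show "coef y c * coef (bd K (frag_of c)) f =
          coef y c * of_bool (f = target c) - coef y c * coef (source c) f"
        by (simp add: lookup_minus right_diff_distrib)
    qed
    then show ?thesis by (simp add: z_def lookup_minus lookup_sum)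
  qed
  \<comment> \<open>Conservation at \<open>f\<close>: occurrences as \<open>t\<close> or in sources
    balance occurrences in \<open>s\<close> or as targets.\<close>
  have h: "of_bool (f = t) + S (terms y) f = coef s f + P (terms y) f" for f
  proof -
    have "coef (lin_bd y) f = P (terms y) f - S (terms y) f"
      using coef_lin_bd[OF y(1), of f] by (simp only: S_def P_def)
    moreover have "coef (lin_bd y) f = of_bool (f = t) - coef s f"
      by (simp add: bd lookup_minus of_bool_def)
    ultimately show ?thesis by linarith
  qed
  have S0: "0 \<le> S U f" for f
    unfolding S_def using y(2) coef_source_nonneg by (intro sum_nonneg) auto
  have PU: "P U f \<le> P (terms y) f" for f
    unfolding P_def using U y(2) by (intro sum_mono2) auto
  \<comment> \<open>If \<open>f\<close> is in the source of \<open>c\<close>, then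
    \<open>target c\<close> lies above \<open>f\<close>, hence above \<open>e\<close>, and so
    \<open>c\<close> is in \<open>U\<close>: restricting to \<open>U\<close> loses no source
    occurrence of \<open>f\<close>.\<close>
  have SU: "S U f = S (terms y) f" if f: "f = e \<or> (e, f) \<in> arrow\<^sup>+" for f
  proof -
    have "coef (source c) f = 0" if c: "c \<in> terms y - U" for c
    proof (rule ccontr)
      assume "coef (source c) f \<noteq> 0"
      then have "(f, target c) \<in> arrow" using arrowI c y(1) by (auto simp: in_keys_iff)
      then have "(e, target c) \<in> arrow\<^sup>+" using f by auto
      then show False using c by (simp add: U_def)
    qed
    then show ?thesis unfolding S_def using U by (intro sum.mono_neutral_left) auto
  qed
  have P0: "P U f = 0" if "(e, f) \<notin> arrow\<^sup>+" for f
    unfolding P_def using that by (intro sum.neutral) (auto simp: U_def)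
  \<comment> \<open>For \<open>f\<close> above \<open>e\<close> the balance leaves
    \<open>coef s f\<close> plus the target occurrences outside \<open>U\<close>; for other
    \<open>f\<close> nothing is subtracted.\<close>
  have nonneg: "0 \<le> coef z f" for f
  proof (cases "(e, f) \<in> arrow\<^sup>+")
    case True
    then show ?thesis using cz[of f] SU[of f] h[of f] PU[of f] s[of f] by simp
  next
    case False
    then show ?thesis using cz[of f] P0[of f] S0[of f] by simp
  qed
  have "terms z \<subseteq> basis q"
  proof
    fix f assume f: "f \<in> terms z"
    show "f \<in> basis q"
    proof (rule ccontr)
      assume "f \<notin> basis q"
      then have "S U f = 0" "P U f = 0" "f \<noteq> t"
        unfolding S_def P_def using U y(1) t target(2,3)
        by (fastforce intro!: sum.neutral simp: in_keys_iff subset_iff)+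
      then show False using f cz[of f] by (simp add: in_keys_iff)
    qed
  qed
  moreover have "lin_bd z = lin_bd (frag_of t)"
  proof -
    have "lin_bd (bd K (frag_of c)) = 0" if "c \<in> U" for c
      using bd_bd[of "frag_of c" "Suc q"] that U y(1) by auto
    then show ?thesis using U(2)
      unfolding z_def lin_bd_def by (simp add: frag_extend_diff frag_extend_sum frag_extend_cmul comp_def)
  qed
  moreover have "aug K z = 1" if "q = 0"
  proof -
    have "coef_sum (bd K (frag_of c)) = 0" if "c \<in> U" for c
    proof -
      have "terms (frag_of c) \<subseteq> basis (Suc 0)" using that U y(1) \<open>q = 0\<close> by auto
      then show ?thesis using aug_bd aug_eq_coef_sum[OF aug_basis] bd_terms by metis
    qed
    then have "coef_sum z = 1"
      using U(2) by (simp add: z_def coef_sum_diff coef_sum_sum coef_sum_cmul)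
    then show ?thesis using aug_eq_coef_sum[OF aug_basis] \<open>terms z \<subseteq> basis q\<close> that by simp
  qed
  ultimately have "parallel q z t" using nonneg t by (simp add: parallel_def)
  \<comment> \<open>By acyclicity \<open>e\<close> is not above itself, so nothing cancels at
    \<open>e\<close> and its repetition survives in \<open>z\<close>.\<close>
  moreover have "(e, e) \<notin> arrow\<^sup>+" using acyclic_arrow by (auto simp: acyclic_def)
  then have "coef z e \<ge> 2" using cz[of e] SU[of e] P0[of e] e by simp
  ultimately show False using IH[of z t e] by simp
qed

text \<open>In dimension 0, a nonnegative chain of augmentation 1 has no coefficient above 1. One
  dimension up, the multiplicity of \<open>x\<close> in \<open>z\<close> is at most that of
  \<open>target x\<close> among the targets of the terms of \<open>z\<close>, and these are
  controlled by \<open>multiplicity_step\<close> with \<open>y = z\<close>.\<close>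

lemma parallel_coef_le_1: "parallel q z t \<Longrightarrow> coef z x \<le> 1"
proof (induction q arbitrary: z t x)
  case 0
  then have "coef_sum z = 1" using aug_eq_coef_sum[OF aug_basis, of z] by (simp add: parallel_def)
  then show ?case using coef_le_coef_sum[of z x] 0 by (simp add: parallel_def)
next
  case (Suc q)
  then have z: "terms z \<subseteq> basis (Suc q)" "\<And>x. 0 \<le> coef z x" "t \<in> basis (Suc q)"
    "lin_bd z = lin_bd (frag_of t)" by (auto simp: parallel_def)
  have bd: "lin_bd z = frag_of (target t) - source t"
    using z(3,4) target(4) by (simp add: lin_bd_def)
  show ?case
  proof (cases "x \<in> terms z")
    case True
    have "coef (frag_of (target t) + frag_extend source z) (target x) \<le> 1"
      using multiplicity_step[OF Suc.IH z(1,2) target(2)[OF z(3)] coef_source_nonneg bd] .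
    \<comment> \<open>The same chain, written as \<open>source t\<close> plus the targets of
      \<open>z\<close> instead of \<open>target t\<close> plus the sources.\<close>
    moreover have "coef (frag_of (target t) + frag_extend source z) (target x)
      = coef (source t) (target x) + (\<Sum>c\<in>terms z. coef z c * of_bool (target x = target c))"
      using coef_lin_bd[OF z(1), of "target x"] bd
      by (simp add: lookup_add lookup_minus coef_frag_extend)
    moreover have "coef z x * of_bool (target x = target x) \<le>
        (\<Sum>c\<in>terms z. coef z c * of_bool (target x = target c))"
      using True z(2) by (intro member_le_sum[of x]) auto
    ultimately show ?thesis using coef_source_nonneg[of t "target x"] by simp
  qed (simp add: in_keys_iff)
qed

lemma parallel_set_chain: "parallel q z t \<Longrightarrow> set_chain (terms z) = z"
  using parallel_coef_le_1 by (intro set_chain_terms) (auto simp: parallel_def)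

lemma parallel_source: "a \<in> basis (Suc q) \<Longrightarrow> parallel q (source a) (target a)"
  using target[of a q] coef_source_nonneg lin_bd_source[of a q] aug_source[of a] aug_basis
  by (auto simp: parallel_def)

lemma source_set_chain: "a \<in> basis (Suc q) \<Longrightarrow> set_chain (terms (source a)) = source a"
  using parallel_set_chain parallel_source .

text \<open>The zero chain has augmentation 0, which is excluded in dimension 0, and boundary 0,
  which is excluded above because the boundary of \<open>t\<close> has the positive term
  \<open>target t\<close>.\<close>

lemma parallel_nonempty:
  assumes "parallel q z t"
  shows "terms z \<noteq> {}"
proof
  assume "terms z = {}"
  then have z: "z = 0" by simp
  show False
  proof (cases q)
    case 0
    then show ?thesis
      using assms z aug_eq_coef_sum[OF aug_basis, of 0] by (simp add: parallel_def coef_sum_def)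
  next
    case (Suc p)
    then have "t \<in> basis (Suc p)" "bd K (frag_of t) = 0"
      using assms z by (auto simp: parallel_def lin_bd_def)
    then have "coef (bd_plus K (frag_of t)) (target t) = 1" "bd K (frag_of t) = 0"
      using target(1) by auto
    then show ?thesis by (simp add: lookup_bd_plus)
  qed
qed

lemma source_nonempty: "a \<in> basis (Suc q) \<Longrightarrow> terms (source a) \<noteq> {}"
  using parallel_nonempty parallel_source .

text \<open>All coefficients being 1, the augmentation counts the terms.\<close>

lemma source_dim1:
  assumes "a \<in> basis (Suc 0)"
  shows "\<exists>e. terms (source a) = {e}"
proof -
  have p: "parallel 0 (source a) (target a)" using parallel_source[OF assms] .
  then have "coef_sum (source a) = 1"
    using aug_eq_coef_sum[OF aug_basis, of "source a"] by (simp add: parallel_def)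
  then have "card (terms (source a)) = 1"
    using coef_sum_set_chain[of "terms (source a)"] parallel_set_chain[OF p] by simp
  then show ?thesis by (simp add: card_1_singleton_iff)
qed

section \<open>The networks of an opetopic directed complex\<close>

abbreviation xm :: "nat \<Rightarrow> 'a \<Rightarrow>\<^sub>0 int"
  where "xm \<equiv> x_minus n K"

text \<open>The single term of the iterated positive boundary of the top element; it turns out to be
  the output edge of \<open>G q\<close>.\<close>

definition out :: "nat \<Rightarrow> 'a"
  where "out q = (target ^^ (n - q)) (top_elem n K)"

abbreviation G :: "nat \<Rightarrow> ('a, 'a) onetwork"
  where "G \<equiv> G_network n K"

section \<open>The chains \<open>x_minus\<close> and \<open>g_minus\<close>\<close>

lemma basis_top: "basis n = {top_elem n K}"
proof -
  have ex: "\<exists>!g. g \<in> basis n" using opetopic by (simp add: opetopic_dcomplex_def atomic_def)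
  then have "top_elem n K \<in> basis n" unfolding top_elem_def by (rule theI')
  with ex show ?thesis by blast
qed

lemma out_top: "out n = top_elem n K"
  by (simp add: out_def)

lemma out_basis: "q \<le> n \<Longrightarrow> out q \<in> basis q"
  using target_funpow[of "top_elem n K" n "n - q"] basis_top by (simp add: out_def)

lemma target_out: "q < n \<Longrightarrow> target (out (Suc q)) = out q"
proof -
  assume "q < n"
  then have "n - q = Suc (n - Suc q)" by simp
  then show ?thesis by (simp add: out_def)
qed

lemma xm_top: "xm n = frag_of (top_elem n K)"
  by (simp add: x_minus_def)

lemma xm_less: "q < n \<Longrightarrow> xm q = source (out (Suc q))"
  using bd_minus_funpow[of "top_elem n K" n "n - Suc q"] basis_top
  by (simp add: x_minus_def out_def Suc_diff_Suc)

lemma xm_greater: "n < q \<Longrightarrow> xm q = 0"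
  by (simp add: x_minus_def)

lemma parallel_xm:
  assumes "q \<le> n"
  shows "parallel q (xm q) (out q)"
proof (cases "q = n")
  case True
  then show ?thesis
    using basis_top aug_basis by (auto simp: parallel_def xm_top out_top)
next
  case False
  then have "q < n" using assms by simp
  then show ?thesis using parallel_source[of "out (Suc q)" q] out_basis[of "Suc q"]
    by (simp add: xm_less target_out)
qed

lemma xm_terms: "terms (xm q) \<subseteq> basis q"
  using parallel_xm[of q] by (cases "q \<le> n") (auto simp: parallel_def xm_greater)

lemma xm_set_chain: "set_chain (terms (xm q)) = xm q"
  using parallel_set_chain[OF parallel_xm] by (cases "q \<le> n") (auto simp: xm_greater)

lemma xm_nonneg: "0 \<le> coef (xm q) x"
  using parallel_xm[of q] by (cases "q \<le> n") (auto simp: parallel_def xm_greater)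

lemma lin_bd_xm:
  assumes "q \<le> n"
  shows "lin_bd (xm (Suc q)) = frag_of (out q) - xm q"
proof (cases "q = n")
  \<comment> \<open>At the top \<open>xm (Suc n)\<close> is 0 by convention and \<open>xm n\<close>
    is the element \<open>out n\<close> itself, so both sides vanish and \<open>G n\<close> is
    covered by what follows.\<close>
  case True
  then show ?thesis by (simp add: xm_greater xm_top out_top lin_bd_def)
next
  case False
  then have q: "q < n" using assms by simp
  then have "lin_bd (xm (Suc q)) = lin_bd (frag_of (out (Suc q)))"
    using parallel_xm[of "Suc q"] by (simp add: parallel_def)
  then show ?thesis
    using target(4)[OF out_basis[of "Suc q"]] q by (simp add: lin_bd_def target_out xm_less)
qed

lemma g_minus_eq1: "g_minus n K q = xm q + (\<Sum>a\<in>terms (xm (Suc q)). frag_of (target a))"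
proof -
  have "frag_extend (\<lambda>a. bd_plus K (frag_of a)) (xm (Suc q)) =
      (\<Sum>a\<in>terms (xm (Suc q)). bd_plus K (frag_of a))"
    by (metis xm_set_chain frag_extend_set_chain finite_keys)
  also have "\<dots> = (\<Sum>a\<in>terms (xm (Suc q)). frag_of (target a))"
    using xm_terms target(1) by (intro sum.cong) auto
  finally show ?thesis by (simp add: g_minus_def)
qed

text \<open>Here edges are counted as the output or as terms of sources, in
  \<open>g_minus_eq1\<close> as inputs or as targets; \<open>lin_bd_xm\<close> says that the two
  counts agree.\<close>

lemma g_minus_eq2:
  assumes "q \<le> n"
  shows "g_minus n K q = frag_of (out q) + (\<Sum>a\<in>terms (xm (Suc q)). source a)"
proof -
  have "lin_bd (xm (Suc q)) = (\<Sum>a\<in>terms (xm (Suc q)). bd K (frag_of a))"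
    unfolding lin_bd_def by (metis xm_set_chain frag_extend_set_chain finite_keys)
  also have "\<dots> = (\<Sum>a\<in>terms (xm (Suc q)). frag_of (target a) - source a)"
    using xm_terms target(4) by (intro sum.cong) auto
  finally show ?thesis
    using lin_bd_xm[OF assms] by (simp add: g_minus_eq1 sum_subtractf algebra_simps)
qed

text \<open>This is \<open>multiplicity_step\<close> with \<open>y = xm (Suc q)\<close>,
  \<open>s = xm q\<close> and \<open>t = out q\<close>. Through the two expressions for
  \<open>g_minus\<close> it excludes edges with two sources, with two targets, with a source while
  being an input, or with a target while being the output.\<close>

lemma g_minus_le_1:
  assumes "q \<le> n"
  shows "coef (g_minus n K q) x \<le> 1"
proof -
  have "frag_extend source (xm (Suc q)) = (\<Sum>a\<in>terms (xm (Suc q)). source a)"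
    by (metis xm_set_chain frag_extend_set_chain finite_keys)
  then show ?thesis
    using multiplicity_step[OF parallel_coef_le_1 xm_terms xm_nonneg out_basis[OF assms] xm_nonneg
        lin_bd_xm[OF assms], where e = x] assms by (simp add: g_minus_eq2)
qed

lemma G_simps:
  "edges (G q) = terms (g_minus n K q)" "verts (G q) = terms (xm (Suc q))"
  "thin_edges (G q) = edges (G q) \<inter> thin K" "thin_verts (G q) = verts (G q) \<inter> thin K"
  by (simp_all add: G_network_def Let_def)

lemma G_edges1: "edges (G q) = terms (xm q) \<union> target ` terms (xm (Suc q))"
  unfolding G_simps g_minus_eq1
  by (subst terms_add_nonneg)
    (auto simp: xm_nonneg lookup_sum terms_sum_nonneg intro: sum_nonneg)

lemma G_edges2:
  "q \<le> n \<Longrightarrow> edges (G q) = insert (out q) (\<Union>a\<in>terms (xm (Suc q)). terms (source a))"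
  unfolding G_simps
  by (simp add: g_minus_eq2 terms_add_nonneg terms_sum_nonneg lookup_sum sum_nonneg coef_source_nonneg)

section \<open>Uniqueness of sources and targets of edges\<close>

lemma target_inj_xm:
  assumes "q \<le> n"
  shows "inj_on target (terms (xm (Suc q)))"
proof (rule inj_onI)
  fix a b assume ab: "a \<in> terms (xm (Suc q))" "b \<in> terms (xm (Suc q))" "target a = target b"
  have "coef (\<Sum>c\<in>terms (xm (Suc q)). frag_of (target c)) (target a) \<le> 1"
    using g_minus_le_1[OF assms, of "target a"] xm_nonneg[of q "target a"]
    by (simp add: g_minus_eq1 lookup_add)
  then show "a = b"
    by (rule sum_le_one_disjoint[rotated 2]) (use ab in auto)
qed

lemma target_notin_xm:
  assumes "q \<le> n" "a \<in> terms (xm (Suc q))"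
  shows "target a \<notin> terms (xm q)"
proof
  assume t: "target a \<in> terms (xm q)"
  have "(1::int) \<le> (\<Sum>c\<in>terms (xm (Suc q)). coef (frag_of (target c)) (target a))"
    using assms(2) member_le_sum[of a "terms (xm (Suc q))" "\<lambda>c. coef (frag_of (target c)) (target a)"]
    by simp
  moreover have "1 \<le> coef (xm q) (target a)"
    using t xm_nonneg[of q "target a"] by (simp add: in_keys_iff)
  ultimately show False
    using g_minus_le_1[OF assms(1), of "target a"] by (simp add: g_minus_eq1 lookup_add lookup_sum)
qed

lemma source_disjoint_xm:
  assumes q: "q \<le> n" and ab: "a \<in> terms (xm (Suc q))" "b \<in> terms (xm (Suc q))"
    "x \<in> terms (source a)" "x \<in> terms (source b)"
  shows "a = b"
proof -
  have "coef (\<Sum>c\<in>terms (xm (Suc q)). source c) x \<le> 1"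
    using g_minus_le_1[OF q, of x] q by (simp add: g_minus_eq2 lookup_add split: if_splits)
  then show ?thesis
    by (rule sum_le_one_disjoint[rotated 2]) (use ab coef_source_nonneg in auto)
qed

lemma out_notin_source:
  assumes q: "q \<le> n" and a: "a \<in> terms (xm (Suc q))"
  shows "out q \<notin> terms (source a)"
proof
  assume t: "out q \<in> terms (source a)"
  then have "1 \<le> coef (source a) (out q)"
    using coef_source_nonneg[of a "out q"] by (simp add: in_keys_iff)
  also have "\<dots> \<le> (\<Sum>c\<in>terms (xm (Suc q)). coef (source c) (out q))"
    using a coef_source_nonneg by (intro member_le_sum) auto
  finally show False
    using g_minus_le_1[OF q, of "out q"] q by (simp add: g_minus_eq2 lookup_add lookup_sum)
qed

lemma bd_plus_xm: "a \<in> terms (xm (Suc q)) \<Longrightarrow> bd_plus K (frag_of a) = frag_of (target a)"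
  using target(1) xm_terms by blast

lemma G_inputs: "q \<le> n \<Longrightarrow> inputs (G q) = terms (xm q)"
proof -
  assume q: "q \<le> n"
  have "inputs (G q) = {e \<in> edges (G q). \<forall>a \<in> terms (xm (Suc q)). e \<noteq> target a}"
    by (auto simp: G_network_def Let_def bd_plus_xm)
  then show ?thesis using target_notin_xm[OF q] by (auto simp: G_edges1)
qed

lemma G_outputs: "q \<le> n \<Longrightarrow> outputs (G q) = {out q}"
proof -
  assume q: "q \<le> n"
  have "outputs (G q) = {e \<in> edges (G q). \<forall>a \<in> terms (xm (Suc q)). e \<notin> terms (source a)}"
    by (auto simp: G_network_def Let_def)
  then show ?thesis using out_notin_source[OF q] by (auto simp: G_edges2[OF q])
qed

lemma G_src:
  assumes "q \<le> n" "a \<in> terms (xm (Suc q))"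
  shows "src (G q) (target a) = a"
proof -
  have "src (G q) (target a) =
      (THE b. b \<in> terms (xm (Suc q)) \<and> target a \<in> terms (bd_plus K (frag_of b)))"
    by (simp add: G_network_def Let_def)
  also have "\<dots> = a"
    using assms(2) inj_onD[OF target_inj_xm[OF assms(1)]]
    by (intro the_equality) (auto simp: bd_plus_xm)
  finally show ?thesis .
qed

lemma G_tgt:
  assumes "q \<le> n" "a \<in> terms (xm (Suc q))" "e \<in> terms (source a)"
  shows "tgt (G q) e = a"
proof -
  have "tgt (G q) e = (THE b. b \<in> terms (xm (Suc q)) \<and> e \<in> terms (source b))"
    by (simp add: G_network_def Let_def)
  also have "\<dots> = a"
    using assms source_disjoint_xm[OF assms(1)] by (intro the_equality) auto
  finally show ?thesis .
qed

lemma G_edges_out_of: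
  assumes "q \<le> n" "a \<in> terms (xm (Suc q))"
  shows "edges_out_of (G q) a = {target a}"
  using assms target_notin_xm[OF assms(1)]
  by (auto simp: edges_out_of_def G_inputs G_edges1 G_src)

lemma G_edges_into:
  assumes "q \<le> n" "a \<in> terms (xm (Suc q))"
  shows "edges_into (G q) a = terms (source a)"
  using assms out_notin_source[OF assms(1)] G_tgt[OF assms(1)]
  by (auto simp: edges_into_def G_outputs G_edges2)

lemma G_is_network:
  assumes q: "q \<le> n"
  shows "is_network (G q)"
  unfolding is_network_def
proof (intro conjI)
  show "finite (edges (G q))" "finite (verts (G q))" by (simp_all add: G_simps)
  show "inputs (G q) \<subseteq> edges (G q)" by (simp add: G_inputs[OF q] G_edges1)
  show "outputs (G q) \<subseteq> edges (G q)" by (simp add: G_outputs[OF q] G_edges2[OF q])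
  show "src (G q) \<in> edges (G q) - inputs (G q) \<rightarrow> verts (G q)"
    using q by (auto simp: G_inputs G_edges1 G_src G_simps(2))
  show "tgt (G q) \<in> edges (G q) - outputs (G q) \<rightarrow> verts (G q)"
    using q by (auto simp: G_outputs G_edges2 G_tgt G_simps(2))
qed

text \<open>This transfers acyclicity from loop-freeness to the networks.\<close>

lemma G_step: "q \<le> n \<Longrightarrow> step (G q) \<subseteq> arrow"
  using arrowI xm_terms by (fastforce simp: step_def G_edges_out_of G_edges_into G_simps(2))

lemma G_tree: "q \<le> n \<Longrightarrow> tree_network (G q)"
  by unfold_locales
    (auto simp: G_is_network acyclic_network_iff G_edges_out_of G_simps(2)
      intro: acyclic_subset[OF acyclic_arrow G_step])

lemma G_outedge:
  assumes "q \<le> n" "a \<in> terms (xm (Suc q))"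
  shows "tree_network.outedge (G q) a = target a"
  using G_edges_out_of[OF assms] tree_network.outedge_def[OF G_tree[OF assms(1)]] by simp

lemma G_vertex_bd:
  assumes "q \<le> n" "a \<in> terms (xm (Suc q))"
  shows "vertex_bd (G q) a = bd K (frag_of a)"
proof -
  have "a \<in> basis (Suc q)" using assms xm_terms by blast
  then show ?thesis
    using assms by (simp add: vertex_bd_def G_edges_out_of G_edges_into source_set_chain target(4))
qed

section \<open>Boundaries read off from the networks\<close>

lemma inputs_to_subset: "q < n \<Longrightarrow> inputs_to (G (Suc q)) e \<subseteq> verts (G q)"
  by (auto simp: inputs_to_def G_inputs G_simps(2))

lemma G_edges_basis: "q \<le> n \<Longrightarrow> edges (G q) \<subseteq> basis q"
  using xm_terms target(2) by (fastforce simp: G_edges1)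

lemma bd_eq_verts_bd:
  assumes q: "q < n" and e: "e \<in> edges (G (Suc q))"
  shows "bd K (frag_of e) = verts_bd (G q) (inputs_to (G (Suc q)) e)"
proof -
  have q': "Suc q \<le> n" using q by simp
  interpret T: tree_network "G (Suc q)" by (rule G_tree[OF q'])
  have "bd K (frag_of e) = (\<Sum>i\<in>inputs_to (G (Suc q)) e. bd K (frag_of i))"
    using e
  proof (rule T.sum_inputs_to_unique)
    fix v assume v: "v \<in> verts (G (Suc q))"
    then have vx: "v \<in> terms (xm (Suc (Suc q)))" by (simp add: G_simps)
    then have vb: "v \<in> basis (Suc (Suc q))" using xm_terms by blast
    have "bd K (frag_of (target v)) = lin_bd (source v)"
      using lin_bd_source[OF vb] by (simp add: lin_bd_def)
    also have "\<dots> = (\<Sum>e'\<in>terms (source v). bd K (frag_of e'))"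
      unfolding lin_bd_def by (metis source_set_chain[OF vb] frag_extend_set_chain finite_keys)
    finally show "bd K (frag_of (T.outedge v)) = (\<Sum>e'\<in>edges_into (G (Suc q)) v. bd K (frag_of e'))"
      using q' vx by (simp add: G_outedge G_edges_into)
  qed
  also have "\<dots> = verts_bd (G q) (inputs_to (G (Suc q)) e)"
    unfolding verts_bd_def
    using inputs_to_subset[OF q, of e] q by (intro sum.cong) (auto simp: G_vertex_bd G_simps(2))
  finally show ?thesis .
qed

text \<open>Two disjoint decompositions of the boundary of \<open>e\<close> must coincide. The first
  equation is the constellation condition for \<open>G q\<close> and \<open>G (Suc q)\<close>; the
  second finds the terms of \<open>source e\<close> among the edges of \<open>G q\<close>.\<close>

lemma outs_ins_inputs_to:
  assumes q: "q < n" and e: "e \<in> edges (G (Suc q))"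
  defines "W \<equiv> inputs_to (G (Suc q)) e"
  shows "outs (G q) W - ins (G q) W = {target e}" "ins (G q) W - outs (G q) W = terms (source e)"
proof -
  have net: "is_network (G q)" using q by (simp add: G_is_network)
  have eb: "e \<in> basis (Suc q)" using G_edges_basis[of "Suc q"] e q by auto
  have "bd K (frag_of e) = set_chain (outs (G q) W - ins (G q) W) - set_chain (ins (G q) W - outs (G q) W)"
    using bd_eq_verts_bd[OF q e] verts_bd_disjoint[OF net inputs_to_subset[OF q]]
    by (simp add: W_def)
  from target_sourceI[OF eb this] finite_network_sets[OF net]
  show "outs (G q) W - ins (G q) W = {target e}" "ins (G q) W - outs (G q) W = terms (source e)"
    by auto
qed

text \<open>Downward induction from the top element: by atomicity \<open>b\<close> is a term in the
  boundary of some \<open>a\<close>, which by induction is an edge of the next network, and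
  \<open>outs_ins_inputs_to\<close> places the terms of its boundary in \<open>G q\<close>.\<close>

lemma G_edges: "q \<le> n \<Longrightarrow> edges (G q) = basis q"
proof (induction "n - q" arbitrary: q)
  case 0
  have "edges (G n) = basis n" using basis_top by (simp add: G_edges1 xm_top xm_greater)
  moreover have "q = n" using 0 by simp
  ultimately show ?case by simp
next
  case (Suc k)
  then have q: "q < n" and IH: "edges (G (Suc q)) = basis (Suc q)" by auto
  have "b \<in> edges (G q)" if b: "b \<in> basis q" for b
  proof -
    obtain a where a: "a \<in> elems K" "q < edim K a"
      "b \<in> terms (source a) \<or> b \<in> terms (bd_plus K (frag_of a))"
      using opetopic b q unfolding opetopic_dcomplex_def atomic_def basis_of_def by blast
    define p where "p = edim K a - 1"
    have ap: "a \<in> basis (Suc p)" using a by (simp add: basis_of_def p_def)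
    then have "b \<in> basis p" using a(3) target[OF ap] by auto
    \<comment> \<open>Atomicity only provides some \<open>a\<close> of higher dimension; its
      dimension is exactly one higher since \<open>b\<close> is a term in its boundary.\<close>
    then have "p = q" using b by (simp add: basis_of_def)
    then have "a \<in> edges (G (Suc q))" "b \<in> terms (source a) \<or> b = target a"
      using ap IH a(3) target(1)[OF ap] by auto
    then show ?thesis using outs_ins_inputs_to[OF q] by (auto simp: outs_def ins_def)
  qed
  then show ?case using G_edges_basis[of q] q by auto
qed

section \<open>The networks of a reduced complex form an opetope\<close>

lemma G_well_defined: "q \<le> n \<Longrightarrow> G_well_defined n K q"
  by (simp add: G_well_defined_def G_simps(2) G_edges_out_of G_edges_into bd_plus_xm)

lemma G_opetopic:
  assumes q: "q \<le> n"
  shows "opetopic_network (G q)"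
proof -
  \<comment> \<open>An edge that is not an input is a positive boundary, hence not thin.\<close>
  have "e \<notin> thin K" if e: "e \<in> edges (G q)" "e \<notin> inputs (G q)" for e
  proof -
    obtain a where a: "a \<in> terms (xm (Suc q))" "e = target a"
      using e q by (auto simp: G_inputs G_edges1)
    then have "a \<in> basis (Suc q)" using xm_terms by blast
    then obtain b where "b \<notin> thin K" "bd_plus K (frag_of a) = frag_of b"
      using opetopic by (auto simp: opetopic_dcomplex_def basis_of_def)
    then show ?thesis using a bd_plus_xm by (auto simp: frag_of_eq)
  qed
  moreover have "\<exists>e. edges_into (G q) v = {e} \<and> e \<notin> thin_edges (G q)"
    if v: "v \<in> terms (xm (Suc q))" "v \<in> thin K" for v
  proof -
    obtain b where "b \<notin> thin K" "source v = frag_of b"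
      using opetopic v by (auto simp: opetopic_dcomplex_def)
    then show ?thesis using G_edges_into[OF q v(1)] by (simp add: G_simps(3))
  qed
  moreover have "is_network (G q)" "acyclic_network (G q)"
    using G_tree[OF q] by (auto simp: tree_network_def)
  ultimately show ?thesis
    using G_outputs[OF q] unfolding opetopic_network_def G_simps(4)
    by (auto simp: G_simps(2,3))
qed

text \<open>The element \<open>a\<close> with negative boundary \<open>b\<close> need not be a
  vertex of \<open>G q\<close>; it is an edge of \<open>G (Suc q)\<close>. For the set of vertices
  given by the inputs below \<open>a\<close>, \<open>b\<close> is the single bottom edge, and so it
  is the only edge into its target.\<close>

lemma G_reduced:
  assumes red: "reduced_dcomplex K" and q: "q \<le> n"
  shows "reduced_network (G q)"
  unfolding reduced_network_def
proof
  fix b assume b: "b \<in> thin_edges (G q)"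
  then have bb: "b \<in> basis q" "b \<in> thin K" using G_edges[OF q] by (auto simp: G_simps(3))
  then obtain a where a: "a \<in> elems K" "source a = frag_of b"
    using red by (auto simp: reduced_dcomplex_def)
  have "edim K a \<noteq> 0"
  proof
    assume "edim K a = 0"
    then have "bd K (frag_of a) = 0" using a(1) by (intro bd_0) (simp add: basis_of_def)
    moreover have "coef (source a) b = 1" using a(2) by simp
    ultimately show False by (simp add: lookup_bd_minus)
  qed
  then obtain p where "edim K a = Suc p" by (cases "edim K a") auto
  then have ap: "a \<in> basis (Suc p)" using a(1) by (simp add: basis_of_def)
  then have "p = q" using target(3)[OF ap] a(2) bb(1) by (simp add: basis_of_def)
  then have "Suc q \<le> n"
    using opetopic ap by (auto simp: opetopic_dcomplex_def atomic_def basis_of_def)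
  then have qn: "q < n" and e: "a \<in> edges (G (Suc q))" using ap \<open>p = q\<close> G_edges by auto
  let ?W = "inputs_to (G (Suc q)) a"
  interpret T: tree_network "G q" by (rule G_tree[OF q])
  have "\<exists>v\<in>?W. edges_into (G q) v = {b}"
  proof (rule T.single_bottom_edges_into[OF inputs_to_subset[OF qn]])
    fix v assume "v \<in> ?W"
    then have v: "v \<in> terms (xm (Suc q))" using inputs_to_subset[OF qn] by (auto simp: G_simps(2))
    then have "v \<in> basis (Suc q)" using xm_terms by blast
    then show "edges_into (G q) v \<noteq> {}" using G_edges_into[OF q v] source_nonempty by simp
  next
    show "ins (G q) ?W - outs (G q) ?W = {b}" using outs_ins_inputs_to(2)[OF qn e] a(2) by simp
  qed
  then show "\<exists>v\<in>verts (G q). edges_into (G q) v = {b}" using inputs_to_subset[OF qn] by blast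
qed

lemma opetope_of:
  assumes "reduced_dcomplex K"
  shows "is_opetope n (opetope_of n K)"
proof -
  have "constellation (G q) (G (Suc q)) (\<lambda>a. a)" if q: "q < n" for q
  proof -
    have "verts (G q) = inputs (G (Suc q))" using q by (simp add: G_simps G_inputs)
    moreover have "{v \<in> verts (G q). v \<in> inputs_to (G (Suc q)) e} = inputs_to (G (Suc q)) e" for e
      using inputs_to_subset[OF q] by blast
    moreover have "verts (G q) \<subseteq> edges (G (Suc q))" by (auto simp: G_simps(2) G_edges1[of "Suc q"])
    ultimately show ?thesis
      using outs_ins_inputs_to(1)[OF q] by (auto simp: constellation_iff G_simps(3,4) bij_betw_def)
  qed
  moreover have "linear_network (G 0)"
  proof -
    interpret T: tree_network "G 0" by (rule G_tree) simp
    \<comment> \<open>In the lowest dimension the augmentation leaves a single input, and likewise a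
      single edge into each vertex.\<close>
    have x0: "\<exists>i. terms (xm 0) = {i}"
    proof (cases "n = 0")
      case True
      then show ?thesis using xm_top by simp
    next
      case False
      then show ?thesis using xm_less[of 0] source_dim1[of "out (Suc 0)"] out_basis[of "Suc 0"] by simp
    qed
    then obtain i where "inputs (G 0) = {i}" using G_inputs[of 0] by auto
    then show ?thesis
    proof (rule T.linear_network_if[OF _ G_outputs])
      show "\<exists>e. edges_into (G 0) v = {e}" if "v \<in> verts (G 0)" for v
        using that G_edges_into[of 0 v] source_dim1[of v] xm_terms[of "Suc 0"] by (auto simp: G_simps(2))
    qed simp
  qed
  moreover have "thin_edges (G 0) = {}"
  proof -
    have "edges (G 0) \<subseteq> basis 0" by (rule G_edges_basis) simp
    moreover have "thin K \<subseteq> {a \<in> elems K. 0 < edim K a}"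
      using opetopic unfolding opetopic_dcomplex_def by (elim conjE)
    ultimately show ?thesis by (fastforce simp: G_simps(3) basis_of_def)
  qed
  moreover have "edges (G n) = {top_elem n K}" "verts (G n) = {}"
    using basis_top G_edges[of n] xm_greater[of "Suc n"] by (simp_all add: G_simps(2))
  ultimately show ?thesis
    using assms G_opetopic G_reduced by (simp add: is_opetope_def opetope_of_def)
qed

end

section \<open>Isomorphic complexes and isomorphic opetopes\<close>

lemma frag_extend_frag_extend:
  "frag_extend g (frag_extend f c) = frag_extend (\<lambda>a. frag_extend g (f a)) c"
proof -
  have "terms c \<subseteq> UNIV" by simp
  then show ?thesis
    by (induction c rule: frag_induction) (simp_all add: frag_extend_diff)
qed

lemma coef_sum_relabel: "coef_sum (frag_extend (frag_of \<circ> h) c) = coef_sum c"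
  unfolding coef_sum_conv_coef frag_extend_compose by (simp add: comp_def)

text \<open>The common ground of the two notions of isomorphism. Compatibility with augmentations
  follows, both being \<open>coef_sum\<close> on 0-chains.\<close>

definition basis_iso ::
    "(nat \<Rightarrow> 'a \<Rightarrow> 'b) \<Rightarrow> 'a odcomplex \<Rightarrow> 'b odcomplex \<Rightarrow> bool"
  where "basis_iso \<phi> K L \<longleftrightarrow>
    (\<forall>q. bij_betw (\<phi> q) (basis_of K q) (basis_of L q)) \<and>
    (\<forall>q. \<forall>a \<in> basis_of K (Suc q).
      bd L (frag_of (\<phi> (Suc q) a)) = frag_extend (frag_of \<circ> \<phi> q) (bd K (frag_of a))) \<and>
    (\<forall>q. \<forall>a \<in> basis_of K q. \<phi> q a \<in> thin L \<longleftrightarrow> a \<in> thin K)"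

lemma frag_extend_relabel_inverse:
  assumes "terms c \<subseteq> A" "\<And>a. a \<in> A \<Longrightarrow> g (f a) = a"
  shows "frag_extend (frag_of \<circ> g) (frag_extend (frag_of \<circ> f) c) = c"
proof -
  have "frag_extend (frag_of \<circ> g) (frag_extend (frag_of \<circ> f) c) = frag_extend frag_of c"
    unfolding frag_extend_compose using assms by (intro frag_extend_eq) auto
  then show ?thesis by (simp flip: frag_expansion)
qed

lemma terms_relabel:
  assumes "terms c \<subseteq> A" "f ` A \<subseteq> B"
  shows "terms (frag_extend (frag_of \<circ> f) c) \<subseteq> B"
proof -
  have "terms (frag_extend (frag_of \<circ> f) c) \<subseteq> (\<Union>x\<in>terms c. terms ((frag_of \<circ> f) x))"
    by (rule keys_frag_extend)
  also have "\<dots> \<subseteq> B" using assms by auto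
  finally show ?thesis .
qed

lemma relabel_iso:
  assumes "bij_betw h (basis_of K q) (basis_of L q)"
  shows "frag_extend (frag_of \<circ> h) \<in> iso (chain_gp K q) (chain_gp L q)"
proof -
  let ?A = "basis_of K q" and ?B = "basis_of L q"
  let ?g = "inv_into ?A h"
  have h: "h ` ?A \<subseteq> ?B" and g: "?g ` ?B \<subseteq> ?A"
    using assms bij_betw_inv_into[OF assms] by (auto simp: bij_betw_def)
  have "bij_betw (frag_extend (frag_of \<circ> h)) (carrier (chain_gp K q)) (carrier (chain_gp L q))"
  proof (rule bij_betw_byWitness[where f' = "frag_extend (frag_of \<circ> ?g)"])
    show "\<forall>c \<in> carrier (chain_gp K q).
        frag_extend (frag_of \<circ> ?g) (frag_extend (frag_of \<circ> h) c) = c"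
      using assms frag_extend_relabel_inverse[of _ ?A ?g h]
      by (simp add: carrier_chain_gp bij_betw_inv_into_left)
    show "\<forall>c \<in> carrier (chain_gp L q).
        frag_extend (frag_of \<circ> h) (frag_extend (frag_of \<circ> ?g) c) = c"
      using assms frag_extend_relabel_inverse[of _ ?B h ?g]
      by (simp add: carrier_chain_gp bij_betw_inv_into_right)
    show "frag_extend (frag_of \<circ> h) ` carrier (chain_gp K q) \<subseteq> carrier (chain_gp L q)"
      using terms_relabel[OF _ h] by (auto simp: carrier_chain_gp)
    show "frag_extend (frag_of \<circ> ?g) ` carrier (chain_gp L q) \<subseteq> carrier (chain_gp K q)"
      using terms_relabel[OF _ g] by (auto simp: carrier_chain_gp)
  qed
  moreover have "frag_extend (frag_of \<circ> h) \<in> hom (chain_gp K q) (chain_gp L q)"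
    using terms_relabel[OF _ h]
    by (auto simp: hom_def carrier_chain_gp) (simp add: chain_gp_def frag_extend_add)
  ultimately show ?thesis by (simp add: iso_def)
qed

lemma dcomplex_iso_imp_basis_iso:
  assumes K: "opetopic n K" and L: "opetopic n L" and f: "dcomplex_iso f K L"
  shows "\<exists>\<phi>. basis_iso \<phi> K L"
proof -
  interpret K: opetopic n K by (rule K)
  interpret L: opetopic n L by (rule L)
  have iso: "f q \<in> iso (chain_gp K q) (chain_gp L q)"
    and bij: "bij_betw (f q) (frag_of ` basis_of K q) (frag_of ` basis_of L q)"
    and bijt: "bij_betw (f q) (frag_of ` (basis_of K q \<inter> thin K)) (frag_of ` (basis_of L q \<inter> thin L))"
    and bd: "c \<in> carrier (chain_gp K (Suc q)) \<Longrightarrow> bd L (f (Suc q) c) = f q (bd K c)" for q c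
    using f by (auto simp: dcomplex_iso_def)
  define \<phi> where "\<phi> q a = (SOME b. b \<in> basis_of L q \<and> f q (frag_of a) = frag_of b)" for q a
  have \<phi>: "\<phi> q a \<in> basis_of L q \<and> f q (frag_of a) = frag_of (\<phi> q a)" if "a \<in> basis_of K q" for q a
  proof -
    have "f q (frag_of a) \<in> frag_of ` basis_of L q" using bij[of q] that by (auto simp: bij_betw_def)
    then have "\<exists>b. b \<in> basis_of L q \<and> f q (frag_of a) = frag_of b" by blast
    then show ?thesis unfolding \<phi>_def by (rule someI_ex)
  qed
  have bij\<phi>: "bij_betw (\<phi> q) (basis_of K q) (basis_of L q)" for q
    unfolding bij_betw_def
  proof
    show "inj_on (\<phi> q) (basis_of K q)"
    proof (rule inj_onI)
      fix a b assume "a \<in> basis_of K q" "b \<in> basis_of K q" "\<phi> q a = \<phi> q b"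
      then have "f q (frag_of a) = f q (frag_of b)" using \<phi> by simp
      then have "frag_of a = frag_of b"
        using bij_betw_imp_inj_on[OF bij] \<open>a \<in> _\<close> \<open>b \<in> _\<close> by (auto dest: inj_onD)
      then show "a = b" by (simp add: frag_of_eq)
    qed
    have "b \<in> \<phi> q ` basis_of K q" if "b \<in> basis_of L q" for b
    proof -
      have "frag_of b \<in> f q ` frag_of ` basis_of K q" using that bij[of q] by (simp add: bij_betw_def)
      then obtain a where "a \<in> basis_of K q" "f q (frag_of a) = frag_of b" by auto
      then show ?thesis using \<phi>[of a q] by (auto simp: frag_of_eq)
    qed
    then show "\<phi> q ` basis_of K q = basis_of L q" using \<phi> by blast
  qed
  have ext: "f q c = frag_extend (frag_of \<circ> \<phi> q) c" if c: "terms c \<subseteq> basis_of K q" for q c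
  proof -
    have hom: "f q (x + y) = f q x + f q y" if "terms x \<subseteq> basis_of K q" "terms y \<subseteq> basis_of K q" for x y
      using that iso[of q] by (auto simp: iso_def hom_def chain_gp_def)
    have diff: "f q (x - y) = f q x - f q y"
      if "terms x \<subseteq> basis_of K q" "terms y \<subseteq> basis_of K q" for x y
    proof -
      have "terms (x - y) \<subseteq> basis_of K q" using that keys_diff[of x y] by blast
      from hom[OF this that(2)] show ?thesis by simp
    qed
    show ?thesis
    proof (rule free_Abelian_group_induct[OF c, where P = "\<lambda>c. f q c = frag_extend (frag_of \<circ> \<phi> q) c"])
      show "f q 0 = frag_extend (frag_of \<circ> \<phi> q) 0" using diff[of 0 0] by simp
    next
      fix x y assume "terms x \<subseteq> basis_of K q" "terms y \<subseteq> basis_of K q"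
        "f q x = frag_extend (frag_of \<circ> \<phi> q) x" "f q y = frag_extend (frag_of \<circ> \<phi> q) y"
      then show "f q (x - y) = frag_extend (frag_of \<circ> \<phi> q) (x - y)"
        by (simp add: diff frag_extend_diff)
    qed (use \<phi> in simp)
  qed
  have "bd L (frag_of (\<phi> (Suc q) a)) = frag_extend (frag_of \<circ> \<phi> q) (bd K (frag_of a))"
    if a: "a \<in> basis_of K (Suc q)" for q a
  proof -
    have "bd L (f (Suc q) (frag_of a)) = f q (bd K (frag_of a))"
      using a by (intro bd) (simp add: carrier_chain_gp)
    then show ?thesis using \<phi>[OF a] ext K.bd_terms[of "frag_of a" q] a by simp
  qed
  moreover have "\<phi> q a \<in> thin L \<longleftrightarrow> a \<in> thin K" if a: "a \<in> basis_of K q" for q a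
  proof -
    have "a \<in> thin K \<longleftrightarrow> frag_of a \<in> frag_of ` (basis_of K q \<inter> thin K)"
      using a by (auto simp: frag_of_eq)
    also have "\<dots> \<longleftrightarrow> f q (frag_of a) \<in> f q ` frag_of ` (basis_of K q \<inter> thin K)"
      by (rule inj_on_image_mem_iff[OF bij_betw_imp_inj_on[OF bij], symmetric]) (use a in auto)
    also have "\<dots> \<longleftrightarrow> frag_of (\<phi> q a) \<in> frag_of ` (basis_of L q \<inter> thin L)"
      using bijt[of q] \<phi>[OF a] by (simp add: bij_betw_def)
    also have "\<dots> \<longleftrightarrow> \<phi> q a \<in> thin L" using \<phi>[OF a] by (auto simp: frag_of_eq)
    finally show ?thesis by simp
  qed
  ultimately show ?thesis using bij\<phi> unfolding basis_iso_def by (intro exI[of _ \<phi>]) blast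
qed

lemma basis_iso_imp_dcomplex_iso:
  assumes K: "opetopic n K" and L: "opetopic n L" and f: "basis_iso \<phi> K L"
  shows "dcomplex_iso (\<lambda>q. frag_extend (frag_of \<circ> \<phi> q)) K L"
proof -
  interpret K: opetopic n K by (rule K)
  interpret L: opetopic n L by (rule L)
  have bij: "bij_betw (\<phi> q) (basis_of K q) (basis_of L q)"
    and bd: "a \<in> basis_of K (Suc q) \<Longrightarrow>
      bd L (frag_of (\<phi> (Suc q) a)) = frag_extend (frag_of \<circ> \<phi> q) (bd K (frag_of a))"
    and thin: "a \<in> basis_of K q \<Longrightarrow> \<phi> q a \<in> thin L \<longleftrightarrow> a \<in> thin K" for q a
    using f by (auto simp: basis_iso_def)
  let ?f = "\<lambda>q. frag_extend (frag_of \<circ> \<phi> q)"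
  have im: "\<phi> q ` basis_of K q \<subseteq> basis_of L q" for q using bij[of q] by (simp add: bij_betw_def)
  have "bd L (?f (Suc q) c) = ?f q (bd K c)" if c: "c \<in> carrier (chain_gp K (Suc q))" for q c
  proof -
    have c: "terms c \<subseteq> basis_of K (Suc q)" using that by (simp add: carrier_chain_gp)
    have "bd L (?f (Suc q) c) = frag_extend (\<lambda>a. bd L (frag_of a)) (?f (Suc q) c)"
      using L.bd_eq_lin_bd[OF terms_relabel[OF c im]] by (simp add: L.lin_bd_def)
    also have "\<dots> = frag_extend (\<lambda>a. bd L (frag_of (\<phi> (Suc q) a))) c"
      unfolding frag_extend_compose by (simp add: comp_def)
    also have "\<dots> = frag_extend (\<lambda>a. ?f q (bd K (frag_of a))) c"
      using c bd by (intro frag_extend_eq) auto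
    also have "\<dots> = ?f q (bd K c)"
      using K.bd_eq_lin_bd[OF c] by (simp add: K.lin_bd_def frag_extend_frag_extend)
    finally show ?thesis .
  qed
  moreover have "aug L (?f 0 c) = aug K c" if c: "c \<in> carrier (chain_gp K 0)" for c
  proof -
    have c: "terms c \<subseteq> basis_of K 0" using that by (simp add: carrier_chain_gp)
    show ?thesis
      using K.aug_eq_coef_sum[OF K.aug_basis c]
        L.aug_eq_coef_sum[OF L.aug_basis terms_relabel[OF c im]] by (simp add: coef_sum_relabel)
  qed
  moreover have img: "?f q ` frag_of ` A = frag_of ` \<phi> q ` A" for q A
    by (simp add: image_image)
  have "bij_betw (?f q) (frag_of ` A) (frag_of ` \<phi> q ` A)" if "A \<subseteq> basis_of K q" for q A
    unfolding bij_betw_def img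
    using that inj_on_subset[OF bij_betw_imp_inj_on[OF bij] that]
    by (auto simp: inj_on_def frag_of_eq)
  then have "bij_betw (?f q) (frag_of ` basis_of K q) (frag_of ` basis_of L q)"
    "bij_betw (?f q) (frag_of ` (basis_of K q \<inter> thin K)) (frag_of ` \<phi> q ` (basis_of K q \<inter> thin K))" for q
    using bij[of q] by (metis bij_betw_imp_surj_on order_refl, blast)
  moreover have "\<phi> q ` (basis_of K q \<inter> thin K) = basis_of L q \<inter> thin L" for q
    using bij[of q] thin by (fastforce simp: bij_betw_def)
  ultimately show ?thesis
    using relabel_iso[OF bij] by (simp add: dcomplex_iso_def)
qed

text \<open>The vertices of the network in degree \<open>q\<close> have dimension
  \<open>q + 1\<close>, whence the vertex map \<open>\<phi> (Suc q)\<close>. Relabelling preserves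
  targets and sources, hence also \<open>out\<close>, \<open>x_minus\<close> and the incidences
  built from them.\<close>

lemma basis_iso_imp_network_seq_iso:
  assumes K: "opetopic n K" and L: "opetopic n L" and f: "basis_iso \<phi> K L"
  shows "network_seq_iso n \<phi> (\<lambda>q. \<phi> (Suc q)) (opetope_of n K) (opetope_of n L)"
proof -
  interpret K: opetopic n K by (rule K)
  interpret L: opetopic n L by (rule L)
  have bij: "bij_betw (\<phi> q) (basis_of K q) (basis_of L q)"
    and bd: "a \<in> basis_of K (Suc q) \<Longrightarrow>
      bd L (frag_of (\<phi> (Suc q) a)) = frag_extend (frag_of \<circ> \<phi> q) (bd K (frag_of a))"
    and thin: "a \<in> basis_of K q \<Longrightarrow> \<phi> q a \<in> thin L \<longleftrightarrow> a \<in> thin K" for q a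
    using f by (auto simp: basis_iso_def)
  have inj: "inj_on (\<phi> q) (basis_of K q)" and img: "\<phi> q ` basis_of K q = basis_of L q" for q
    using bij[of q] by (auto simp: bij_betw_def)
  have ts: "L.target (\<phi> (Suc q) a) = \<phi> q (K.target a) \<and>
      terms (L.source (\<phi> (Suc q) a)) = \<phi> q ` terms (K.source a)"
    if a: "a \<in> basis_of K (Suc q)" for q a
  proof -
    have sub: "insert (K.target a) (terms (K.source a)) \<subseteq> basis_of K q" using K.target[OF a] by auto
    have b: "\<phi> (Suc q) a \<in> basis_of L (Suc q)" using a img by blast
    have "bd K (frag_of a) = set_chain {K.target a} - set_chain (terms (K.source a))"
      using K.target(4)[OF a] K.source_set_chain[OF a] by simp
    then have "bd L (frag_of (\<phi> (Suc q) a)) =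
        set_chain (\<phi> q ` {K.target a}) - set_chain (\<phi> q ` terms (K.source a))"
      unfolding bd[OF a] using sub inj_on_subset[OF inj]
      by (simp add: frag_extend_diff frag_extend_set_chain_image)
    \<comment> \<open>Injectivity of \<open>\<phi> q\<close> keeps the relabelled target out of the
      relabelled source.\<close>
    from L.target_sourceI[OF b this] show ?thesis
      using inj_on_image_Int[OF inj, of "{K.target a}" q "terms (K.source a)"] K.target(5)[OF a] sub
      by auto
  qed
  have out: "L.out q = \<phi> q (K.out q)" if "q \<le> n" for q
    using that
  proof (induction "n - q" arbitrary: q)
    case 0
    then have "q = n" by simp
    then show ?case using K.basis_top L.basis_top img[of n] by (simp add: K.out_top L.out_top)
  next
    case (Suc k)
    then have q: "q < n" "L.out (Suc q) = \<phi> (Suc q) (K.out (Suc q))" by auto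
    then show ?case
      using ts[OF K.out_basis[of "Suc q"]] K.target_out[OF q(1)] L.target_out[OF q(1)] by simp
  qed
  have xm: "terms (x_minus n L q) = \<phi> q ` terms (x_minus n K q)" for q
  proof -
    consider "q < n" | "q = n" | "n < q" by linarith
    then show ?thesis
    proof cases
      case 1
      then show ?thesis
        using ts[OF K.out_basis[of "Suc q"]] out[of "Suc q"] by (simp add: K.xm_less L.xm_less)
    next
      case 2
      then show ?thesis using out[of n] by (simp add: K.xm_top L.xm_top K.out_top L.out_top)
    qed (simp add: K.xm_greater L.xm_greater)
  qed
  have "onetwork_iso (\<phi> q) (\<phi> (Suc q)) (G_network n K q) (G_network n L q)" if q: "q \<le> n" for q
    unfolding onetwork_iso_def
  proof (intro conjI ballI)
    let ?X = "terms (x_minus n K (Suc q))"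
    show "bij_betw (\<phi> q) (edges (G_network n K q)) (edges (G_network n L q))"
      using bij q by (simp add: K.G_edges L.G_edges)
    show "bij_betw (\<phi> (Suc q)) (verts (G_network n K q)) (verts (G_network n L q))"
      using inj_on_subset[OF inj K.xm_terms] by (simp add: K.G_simps L.G_simps bij_betw_def xm)
    show "\<phi> q ` inputs (G_network n K q) = inputs (G_network n L q)"
      using q by (simp add: K.G_inputs L.G_inputs xm)
    show "\<phi> q ` outputs (G_network n K q) = outputs (G_network n L q)"
      using q by (simp add: K.G_outputs L.G_outputs out)
    show "src (G_network n L q) (\<phi> q e) = \<phi> (Suc q) (src (G_network n K q) e)"
      if e: "e \<in> edges (G_network n K q) - inputs (G_network n K q)" for e
    proof -
      obtain a where a: "a \<in> ?X" "e = K.target a" using e q by (auto simp: K.G_inputs K.G_edges1)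
      moreover have "a \<in> basis_of K (Suc q)" using a(1) K.xm_terms by blast
      ultimately have "\<phi> q e = L.target (\<phi> (Suc q) a)" using ts[of a q] by simp
      moreover have "\<phi> (Suc q) a \<in> terms (x_minus n L (Suc q))" using a xm by blast
      ultimately show ?thesis using a q by (simp add: K.G_src L.G_src)
    qed
    show "tgt (G_network n L q) (\<phi> q e) = \<phi> (Suc q) (tgt (G_network n K q) e)"
      if e: "e \<in> edges (G_network n K q) - outputs (G_network n K q)" for e
    proof -
      obtain a where a: "a \<in> ?X" "e \<in> terms (K.source a)"
        using e q by (auto simp: K.G_outputs K.G_edges2)
      moreover have "a \<in> basis_of K (Suc q)" using a(1) K.xm_terms by blast
      ultimately have "\<phi> q e \<in> terms (L.source (\<phi> (Suc q) a))" using ts[of a q] by simp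
      moreover have "\<phi> (Suc q) a \<in> terms (x_minus n L (Suc q))" using a xm by blast
      ultimately show ?thesis using a q K.G_tgt[OF q a] L.G_tgt[OF q] by simp
    qed
    have th: "\<phi> p ` (A \<inter> thin K) = \<phi> p ` A \<inter> thin L" if "A \<subseteq> basis_of K p" for p A
      using that thin by blast
    show "\<phi> q ` thin_edges (G_network n K q) = thin_edges (G_network n L q)"
      using th[of "basis_of K q" q] q img by (simp add: K.G_simps(3) L.G_simps(3) K.G_edges L.G_edges)
    show "\<phi> (Suc q) ` thin_verts (G_network n K q) = thin_verts (G_network n L q)"
      using th[OF K.xm_terms] by (simp add: K.G_simps L.G_simps xm)
  qed
  then show ?thesis by (simp add: network_seq_iso_def opetope_of_def)
qed

lemma network_seq_iso_imp_basis_iso: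
  assumes K: "opetopic n K" and L: "opetopic n L"
    and f: "network_seq_iso n \<phi> \<psi> (opetope_of n K) (opetope_of n L)"
  shows "basis_iso \<phi> K L"
proof -
  interpret K: opetopic n K by (rule K)
  interpret L: opetopic n L by (rule L)
  have iso: "q \<le> n \<Longrightarrow> onetwork_iso (\<phi> q) (\<psi> q) (G_network n K q) (G_network n L q)"
    and maps: "q < n \<Longrightarrow> v \<in> verts (G_network n K q) \<Longrightarrow> \<psi> q v = \<phi> (Suc q) v" for q v
    using f by (auto simp: network_seq_iso_def opetope_of_def)
  have empty: "basis_of K q = {}" "basis_of L q = {}" if "n < q" for q
    using that K.opetopic L.opetopic by (auto simp: opetopic_dcomplex_def atomic_def basis_of_def)
  have bij: "bij_betw (\<phi> q) (basis_of K q) (basis_of L q)" for q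
  proof (cases "q \<le> n")
    case True
    then show ?thesis using iso[of q] by (simp add: onetwork_iso_def K.G_edges L.G_edges)
  next
    case False
    then show ?thesis using empty[of q] by (simp add: bij_betw_def)
  qed
  have "bd L (frag_of (\<phi> (Suc q) a)) = frag_extend (frag_of \<circ> \<phi> q) (bd K (frag_of a))"
    if a: "a \<in> basis_of K (Suc q)" for q a
  proof -
    have q: "q < n" using empty[of "Suc q"] a by (cases "q < n") auto
    let ?GK = "G_network n K" and ?GL = "G_network n L"
    have aK: "a \<in> edges (?GK (Suc q))" using a q by (simp add: K.G_edges)
    have "\<phi> (Suc q) a \<in> edges (?GL (Suc q))"
      using a q bij[of "Suc q"] by (auto simp: L.G_edges bij_betw_def)
    then have "bd L (frag_of (\<phi> (Suc q) a)) = verts_bd (?GL q) (inputs_to (?GL (Suc q)) (\<phi> (Suc q) a))"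
      by (rule L.bd_eq_verts_bd[OF q])
    also have "inputs_to (?GL (Suc q)) (\<phi> (Suc q) a) = \<phi> (Suc q) ` inputs_to (?GK (Suc q)) a"
      using q by (intro onetwork_iso_inputs_to[OF iso _ _ aK] K.G_is_network L.G_is_network) auto
    \<comment> \<open>Compatibility with the constellations, here identity maps, makes the vertex
      map agree with the edge map one dimension up.\<close>
    also have "\<dots> = \<psi> q ` inputs_to (?GK (Suc q)) a"
      using maps[OF q] K.inputs_to_subset[OF q, of a] by (intro image_cong) auto
    also have "verts_bd (?GL q) (\<psi> q ` inputs_to (?GK (Suc q)) a) =
        frag_extend (frag_of \<circ> \<phi> q) (verts_bd (?GK q) (inputs_to (?GK (Suc q)) a))"
      using q by (intro onetwork_iso_verts_bd[OF iso] K.G_is_network K.inputs_to_subset) auto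
    also have "verts_bd (?GK q) (inputs_to (?GK (Suc q)) a) = bd K (frag_of a)"
      using K.bd_eq_verts_bd[OF q aK] by simp
    finally show ?thesis .
  qed
  moreover have "\<phi> q a \<in> thin L \<longleftrightarrow> a \<in> thin K" if a: "a \<in> basis_of K q" for q a
  proof -
    have q: "q \<le> n" using empty[of q] a by (cases "q \<le> n") auto
    have "\<phi> q ` (basis_of K q \<inter> thin K) = basis_of L q \<inter> thin L"
      using iso[OF q] q by (simp add: onetwork_iso_def K.G_simps(3) L.G_simps(3) K.G_edges L.G_edges)
    moreover have "\<phi> q a \<in> \<phi> q ` (basis_of K q \<inter> thin K) \<longleftrightarrow> a \<in> basis_of K q \<inter> thin K"
      by (rule inj_on_image_mem_iff[OF bij_betw_imp_inj_on[OF bij]]) (use a in auto)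
    moreover have "\<phi> q a \<in> basis_of L q" using bij[of q] a by (auto simp: bij_betw_def)
    ultimately show ?thesis using a by blast
  qed
  ultimately show ?thesis using bij by (simp add: basis_iso_def)
qed

section \<open>The complex of an opetope\<close>

text \<open>Different networks of \<open>S\<close> may have edges with the same name, whereas the
  basis elements of all dimensions share one set; \<open>j\<close> keeps them apart.\<close>

locale opetope_labelling =
  fixes n :: nat and S :: "('e, 'v) network_seq" and j :: "nat \<Rightarrow> 'e \<Rightarrow> 'b"
  assumes opetope: "is_opetope n S"
    and inj: "inj_on (\<lambda>(i, e). j i e) (Sigma {..n} (\<lambda>i. edges (nets S i)))"
begin

abbreviation N :: "nat \<Rightarrow> ('e, 'v) onetwork"
  where "N \<equiv> nets S"

abbreviation c :: "nat \<Rightarrow> 'v \<Rightarrow> 'e"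
  where "c \<equiv> maps S"

text \<open>In \<open>W\<close>, \<open>head\<close> and \<open>tails\<close> the argument
  \<open>e\<close> is an edge of \<open>N (Suc i)\<close> while the values belong to
  \<open>N i\<close>: head and tails will become the positive and negative boundary of
  \<open>e\<close>.\<close>

definition W :: "nat \<Rightarrow> 'e \<Rightarrow> 'v set"
  where "W i e = {v \<in> verts (N i). c i v \<in> inputs_to (N (Suc i)) e}"

definition head :: "nat \<Rightarrow> 'e \<Rightarrow> 'e"
  where "head i e = the_elem (outs (N i) (W i e) - ins (N i) (W i e))"

definition tails :: "nat \<Rightarrow> 'e \<Rightarrow> 'e set"
  where "tails i e = ins (N i) (W i e) - outs (N i) (W i e)"

definition root :: "nat \<Rightarrow> 'e"
  where "root i = (THE e. e \<in> outputs (N i))"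

section \<open>Consequences of the constellation condition\<close>

lemma opetopic_network: "i \<le> n \<Longrightarrow> opetopic_network (N i)"
  using opetope by (simp add: is_opetope_def)

lemma network: "i \<le> n \<Longrightarrow> is_network (N i)" "i \<le> n \<Longrightarrow> acyclic_network (N i)"
  using opetopic_network by (auto simp: opetopic_network_def)

lemma outputs_root: "i \<le> n \<Longrightarrow> outputs (N i) = {root i}"
proof -
  assume "i \<le> n"
  then have ex: "\<exists>!e. e \<in> outputs (N i)" using opetopic_network by (simp add: opetopic_network_def)
  then have "root i \<in> outputs (N i)" unfolding root_def by (rule theI')
  with ex show ?thesis by blast
qed

lemma bij_c: "i < n \<Longrightarrow> bij_betw (c i) (verts (N i)) (inputs (N (Suc i)))"
  using opetope by (simp add: is_opetope_def constellation_iff)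

lemma thin_c: "i < n \<Longrightarrow> v \<in> verts (N i) \<Longrightarrow> v \<in> thin_verts (N i) \<longleftrightarrow> c i v \<in> thin_edges (N (Suc i))"
  using opetope by (simp add: is_opetope_def constellation_iff)

lemma head: "i < n \<Longrightarrow> e \<in> edges (N (Suc i)) \<Longrightarrow> outs (N i) (W i e) - ins (N i) (W i e) = {head i e}"
proof -
  assume "i < n" "e \<in> edges (N (Suc i))"
  then have "\<exists>d. outs (N i) (W i e) - ins (N i) (W i e) = {d}"
    using opetope unfolding W_def by (simp add: is_opetope_def constellation_iff)
  then obtain d where d: "outs (N i) (W i e) - ins (N i) (W i e) = {d}" ..
  show ?thesis unfolding head_def d by simp
qed

lemma inputs_edges: "i \<le> n \<Longrightarrow> inputs (N i) \<subseteq> edges (N i)"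
  using network(1) by (simp add: is_network_def)

lemma W_verts: "W i e \<subseteq> verts (N i)"
  by (auto simp: W_def)

lemma c_edges: "i < n \<Longrightarrow> v \<in> verts (N i) \<Longrightarrow> c i v \<in> inputs (N (Suc i)) \<and> c i v \<in> edges (N (Suc i))"
  using bij_c[of i] inputs_edges[of "Suc i"] by (auto simp: bij_betw_def)

lemma W_c:
  assumes "i < n" "v \<in> verts (N i)"
  shows "W i (c i v) = {v}"
proof -
  have "inputs_to (N (Suc i)) (c i v) = {c i v}"
    using assms c_edges network(1) by (intro inputs_to_input) auto
  then show ?thesis
    using assms bij_betw_imp_inj_on[OF bij_c] by (auto simp: W_def dest: inj_onD)
qed

lemma edges_into_out_disjoint:
  assumes "i \<le> n" "v \<in> verts (N i)"
  shows "edges_out_of (N i) v \<inter> edges_into (N i) v = {}"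
proof -
  have "(e, e) \<in> step (N i)" if "e \<in> edges_out_of (N i) v" "e \<in> edges_into (N i) v" for e
    using that assms by (auto simp: step_def)
  moreover have "acyclic (step (N i))" using network(2)[OF assms(1)] by (simp add: acyclic_network_iff)
  ultimately show ?thesis by (auto simp: acyclic_def)
qed

text \<open>Below the input edge \<open>c i v\<close> lies only that edge, so its set
  \<open>W\<close> is \<open>{v}\<close>, and by acyclicity no edge is both out of and into
  \<open>v\<close>. The constellation condition then says that exactly one edge leaves
  \<open>v\<close>.\<close>

lemma vertex_cell:
  assumes "i < n" "v \<in> verts (N i)"
  shows "edges_out_of (N i) v = {head i (c i v)}" "edges_into (N i) v = tails i (c i v)"
  using head[of i "c i v"] c_edges[OF assms] edges_into_out_disjoint[of i v] assms
  by (auto simp: tails_def W_c outs_Union ins_Union)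

lemma tree: "i \<le> n \<Longrightarrow> tree_network (N i)"
proof unfold_locales
  fix v assume i: "i \<le> n" and v: "v \<in> verts (N i)"
  \<comment> \<open>\<open>N n\<close> has no vertices; at every earlier stage there is a
    constellation to apply.\<close>
  then have "i \<noteq> n" using opetope by (auto simp: is_opetope_def)
  then show "\<exists>e. edges_out_of (N i) v = {e}" using vertex_cell[of i v] i v by simp
qed (use network in auto)

lemma finite_N: "i \<le> n \<Longrightarrow> finite (edges (N i))" "i \<le> n \<Longrightarrow> finite (verts (N i))"
  using finite_network_sets network by blast+

lemma head_edges: "i < n \<Longrightarrow> e \<in> edges (N (Suc i)) \<Longrightarrow> head i e \<in> edges (N i) - inputs (N i)"
  using head[of i e] by (auto simp: outs_def)

lemma tails_edges: "tails i e \<subseteq> edges (N i)"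
  by (auto simp: tails_def ins_def)

lemma finite_tails: "i \<le> n \<Longrightarrow> finite (tails i e)"
  using finite_N tails_edges finite_subset by metis

lemma W_root:
  assumes "i < n"
  shows "W i (root (Suc i)) = verts (N i)"
proof -
  interpret T: tree_network "N (Suc i)" using assms by (intro tree) simp
  have "inputs_to (N (Suc i)) (root (Suc i)) = inputs (N (Suc i))"
    using assms by (intro T.inputs_to_output outputs_root) simp
  then show ?thesis using c_edges[OF assms] by (auto simp: W_def)
qed

lemma root_edges: "i \<le> n \<Longrightarrow> root i \<in> edges (N i)"
  using outputs_root[of i] network(1)[of i] by (auto simp: is_network_def)

text \<open>At the output edge of \<open>N (Suc i)\<close>, which lies above all inputs,
  \<open>W\<close> is the whole vertex set. The constellation condition provides an edge with a
  source and no target, necessarily the output of \<open>N i\<close>, which is therefore not an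
  input.\<close>

lemma root_cell:
  assumes i: "i < n"
  shows "head i (root (Suc i)) = root i" "root i \<notin> inputs (N i)"
    "tails i (root (Suc i)) = inputs (N i)"
proof -
  have net: "is_network (N i)" using network i by simp
  have o: "outs (N i) (verts (N i)) = edges (N i) - inputs (N i)"
    "ins (N i) (verts (N i)) = edges (N i) - {root i}"
    using net outputs_root[of i] i by (auto simp: outs_def ins_def is_network_def)
  have "outs (N i) (W i (root (Suc i))) - ins (N i) (W i (root (Suc i))) = {head i (root (Suc i))}"
    using i by (intro head root_edges) auto
  then have h: "(edges (N i) - inputs (N i)) - (edges (N i) - {root i}) = {head i (root (Suc i))}"
    unfolding W_root[OF i] o .
  then have "head i (root (Suc i)) \<in> (edges (N i) - inputs (N i)) - (edges (N i) - {root i})" by simp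
  then show "head i (root (Suc i)) = root i" and notin: "root i \<notin> inputs (N i)" by auto
  show "tails i (root (Suc i)) = inputs (N i)"
    unfolding tails_def W_root[OF i] o using inputs_edges[of i] i notin by auto
qed

lemma verts_bd_W:
  assumes i: "i < n" and e: "e \<in> edges (N (Suc i))"
  shows "verts_bd (N i) (W i e) = frag_of (head i e) - set_chain (tails i e)"
  using verts_bd_disjoint[OF network(1) W_verts, of i e] head[OF i e] i by (simp add: tails_def)

text \<open>Turns a sum over vertices of \<open>N i\<close> into a sum over the inputs below
  \<open>e\<close>, to which the splitting at a vertex of \<open>N (Suc i)\<close> applies.\<close>

lemma verts_bd_W_sum:
  assumes i: "i < n"
  shows "verts_bd (N i) (W i e) =
    (\<Sum>x\<in>inputs_to (N (Suc i)) e. vertex_bd (N i) (inv_into (verts (N i)) (c i) x))"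
proof -
  have "bij_betw (c i) (W i e) (inputs_to (N (Suc i)) e)"
  proof (rule bij_betw_subset[OF bij_c[OF i] W_verts])
    have "inputs_to (N (Suc i)) e \<subseteq> c i ` verts (N i)"
      using bij_c[OF i] by (auto simp: bij_betw_def inputs_to_def)
    then show "c i ` W i e = inputs_to (N (Suc i)) e" by (auto simp: W_def)
  qed
  then have "(\<Sum>x\<in>inputs_to (N (Suc i)) e. vertex_bd (N i) (inv_into (verts (N i)) (c i) x)) =
      (\<Sum>v\<in>W i e. vertex_bd (N i) (inv_into (verts (N i)) (c i) (c i v)))"
    by (rule sum.reindex_bij_betw[symmetric])
  also have "\<dots> = verts_bd (N i) (W i e)"
    unfolding verts_bd_def using bij_c[OF i] W_verts[of i e]
    by (intro sum.cong) (auto simp: bij_betw_def)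
  finally show ?thesis by simp
qed

section \<open>The complex on the labelled edges\<close>

definition cells :: "(nat \<times> 'e) set"
  where "cells = Sigma {..n} (\<lambda>i. edges (N i))"

definition code :: "'b \<Rightarrow> nat \<times> 'e"
  where "code = inv_into cells (\<lambda>(i, e). j i e)"

lemma code: "i \<le> n \<Longrightarrow> e \<in> edges (N i) \<Longrightarrow> code (j i e) = (i, e)"
  using inv_into_f_f[of "\<lambda>(i, e). j i e" cells "(i, e)"] inj by (simp add: code_def cells_def)

lemma j_eq:
  "i \<le> n \<Longrightarrow> e \<in> edges (N i) \<Longrightarrow> i' \<le> n \<Longrightarrow> e' \<in> edges (N i') \<Longrightarrow> j i e = j i' e' \<longleftrightarrow> i = i' \<and> e = e'"
  using code by (metis prod.inject)

lemma inj_j: "i \<le> n \<Longrightarrow> inj_on (j i) (edges (N i))"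
  by (auto simp: inj_on_def j_eq)

definition cell_bd :: "'b \<Rightarrow> 'b \<Rightarrow>\<^sub>0 int"
  where "cell_bd a = (case fst (code a) of 0 \<Rightarrow> 0
    | Suc i \<Rightarrow> frag_extend (frag_of \<circ> j i) (verts_bd (N i) (W i (snd (code a)))))"

definition complex :: "'b odcomplex"
  where "complex = \<lparr>elems = (\<Union>i\<le>n. j i ` edges (N i)), edim = (\<lambda>a. fst (code a)),
    bd = frag_extend cell_bd, aug = coef_sum, thin = (\<Union>i\<le>n. j i ` thin_edges (N i))\<rparr>"

lemma complex_simps:
  "elems complex = (\<Union>i\<le>n. j i ` edges (N i))" "edim complex = (\<lambda>a. fst (code a))"
  "bd complex = frag_extend cell_bd" "aug complex = coef_sum"
  "thin complex = (\<Union>i\<le>n. j i ` thin_edges (N i))"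
  by (simp_all add: complex_def)

lemma basis_complex: "basis_of complex q = (if q \<le> n then j q ` edges (N q) else {})"
  using code by (force simp: basis_of_def complex_simps)

lemma thin_edges: "i \<le> n \<Longrightarrow> thin_edges (N i) \<subseteq> inputs (N i)" "thin_edges (N 0) = {}"
  using opetope by (auto simp: is_opetope_def opetopic_network_def)

lemma thin_complex:
  assumes "i \<le> n" "e \<in> edges (N i)"
  shows "j i e \<in> thin complex \<longleftrightarrow> e \<in> thin_edges (N i)"
proof -
  have "e = t \<and> i = i'" if "i' \<le> n" "t \<in> thin_edges (N i')" "j i e = j i' t" for i' t
    using that assms thin_edges(1)[of i'] inputs_edges[of i'] j_eq[of i e i' t] by blast
  then show ?thesis using assms(1) by (auto simp: complex_simps)
qed

lemma cell_bd_0: "e \<in> edges (N 0) \<Longrightarrow> cell_bd (j 0 e) = 0"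
  by (simp add: cell_bd_def code)

lemma cell_bd_Suc:
  "i < n \<Longrightarrow> e \<in> edges (N (Suc i)) \<Longrightarrow>
    cell_bd (j (Suc i) e) = frag_extend (frag_of \<circ> j i) (verts_bd (N i) (W i e))"
  by (simp add: cell_bd_def code)

lemma cell_bd_parts:
  assumes i: "i < n" and e: "e \<in> edges (N (Suc i))"
  shows "cell_bd (j (Suc i) e) = frag_of (j i (head i e)) - set_chain (j i ` tails i e)"
proof -
  have "inj_on (j i) (tails i e)" using inj_j[of i] i tails_edges by (meson inj_on_subset less_imp_le)
  then show ?thesis
    using i finite_tails[of i e]
    by (simp add: cell_bd_Suc[OF i e] verts_bd_W[OF i e] frag_extend_diff frag_extend_set_chain_image)
qed

lemma cell_bd_source_target:
  assumes i: "i < n" and e: "e \<in> edges (N (Suc i))"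
  shows "bd_plus complex (frag_of (j (Suc i) e)) = frag_of (j i (head i e))"
    "bd_minus complex (frag_of (j (Suc i) e)) = set_chain (j i ` tails i e)"
proof -
  have "head i e \<notin> tails i e" using head[OF i e] by (auto simp: tails_def)
  then have "j i (head i e) \<notin> j i ` tails i e"
    using j_eq[of i "head i e" i] head_edges[OF i e] tails_edges[of i e] i by auto
  moreover have "basis_sum (frag_of (j i (head i e)))" by (simp add: basis_sum_def)
  ultimately have "frag_of (j i (head i e)) = bd_plus complex (frag_of (j (Suc i) e)) \<and>
      set_chain (j i ` tails i e) = bd_minus complex (frag_of (j (Suc i) e))"
    unfolding bd_plus_minus_iff using i finite_tails[of i e]
    by (simp add: complex_simps cell_bd_parts[OF i e] basis_sum_set_chain)
  then show "bd_plus complex (frag_of (j (Suc i) e)) = frag_of (j i (head i e))"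
    "bd_minus complex (frag_of (j (Suc i) e)) = set_chain (j i ` tails i e)" by auto
qed

lemma terms_cell_bd: "a \<in> basis_of complex (Suc q) \<Longrightarrow> terms (cell_bd a) \<subseteq> basis_of complex q"
proof -
  assume "a \<in> basis_of complex (Suc q)"
  then obtain e where e: "q < n" "e \<in> edges (N (Suc q))" "a = j (Suc q) e"
    by (auto simp: basis_complex split: if_splits)
  have "terms (cell_bd a) \<subseteq> {j q (head q e)} \<union> j q ` tails q e"
    using keys_diff[of "frag_of (j q (head q e))" "set_chain (j q ` tails q e)"] e finite_tails[of q e]
    by (simp add: cell_bd_parts)
  also have "\<dots> \<subseteq> basis_of complex q"
    using head_edges[OF e(1,2)] tails_edges[of q e] e(1) by (auto simp: basis_complex)
  finally show ?thesis .
qed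

text \<open>
  An edge out of a vertex has the same inputs below it as the edges into that vertex together.
\<close>

lemma cell_bd_vertex_bd:
  assumes i: "Suc i < n" and v: "v \<in> verts (N (Suc i))"
  shows "frag_extend (cell_bd \<circ> j (Suc i)) (vertex_bd (N (Suc i)) v) = 0"
proof -
  have i': "Suc i \<le> n" "i < n" using i by auto
  interpret T: tree_network "N (Suc i)" using i by (intro tree) simp
  \<comment> \<open>\<open>F x\<close> is the relabelled boundary of the vertex of
    \<open>N i\<close> that corresponds to the input \<open>x\<close>.\<close>
  define F where "F x = frag_extend (frag_of \<circ> j i)
    (vertex_bd (N i) (inv_into (verts (N i)) (c i) x))" for x
  have cell: "cell_bd (j (Suc i) e) = (\<Sum>x\<in>inputs_to (N (Suc i)) e. F x)"
    if "e \<in> edges (N (Suc i))" for e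
    using finite_network_sets(9)[OF network(1)[OF i'(1)]] that i'
    by (simp add: cell_bd_Suc verts_bd_W_sum frag_extend_sum F_def comp_def)
  have "frag_extend (cell_bd \<circ> j (Suc i)) (vertex_bd (N (Suc i)) v) =
      cell_bd (j (Suc i) (T.outedge v)) - (\<Sum>e\<in>edges_into (N (Suc i)) v. cell_bd (j (Suc i) e))"
    using finite_network_sets[OF network(1)[OF i'(1)]] v
    by (simp add: vertex_bd_def frag_extend_diff frag_extend_set_chain T.edges_out_of)
  also have "\<dots> = (\<Sum>x\<in>inputs_to (N (Suc i)) (T.outedge v). F x) -
      (\<Sum>e\<in>edges_into (N (Suc i)) v. \<Sum>x\<in>inputs_to (N (Suc i)) e. F x)"
    using T.outedge_edges[OF v] by (simp add: cell) (auto intro!: sum.cong simp: cell edges_into_def)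
  also have "\<dots> = 0" using T.sum_inputs_to_outedge[OF v, of F] by simp
  finally show ?thesis .
qed

text \<open>A cell boundary is a sum of relabelled vertex boundaries, each annihilated by
  \<open>cell_bd_vertex_bd\<close>; in dimensions 0 and 1 it suffices that 0-dimensional cells have
  boundary 0.\<close>

lemma bd_cell_bd:
  assumes "a \<in> basis_of complex q"
  shows "frag_extend cell_bd (cell_bd a) = 0"
proof -
  obtain e where e: "q \<le> n" "e \<in> edges (N q)" "a = j q e"
    using assms by (auto simp: basis_complex split: if_splits)
  consider "q = 0" | "q = Suc 0" | i where "q = Suc (Suc i)" by (metis not0_implies_Suc)
  then show ?thesis
  proof cases
    case 1
    then show ?thesis using e by (simp add: cell_bd_0)
  next
    case 2
    have "cell_bd b = 0" if "b \<in> terms (cell_bd a)" for b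
      using that terms_cell_bd[of a 0] assms 2 by (auto simp: basis_complex cell_bd_0)
    then show ?thesis by (rule frag_extend_eq_0)
  next
    case 3
    have i: "Suc i < n" using e 3 by simp
    have fin: "finite (W (Suc i) e)" using W_verts finite_N(2) i finite_subset less_imp_le by metis
    have "frag_extend cell_bd (cell_bd a) =
        frag_extend (cell_bd \<circ> j (Suc i)) (verts_bd (N (Suc i)) (W (Suc i) e))"
      using e 3 i by (simp add: cell_bd_Suc frag_extend_compose)
    also have "\<dots> = (\<Sum>v\<in>W (Suc i) e. frag_extend (cell_bd \<circ> j (Suc i)) (vertex_bd (N (Suc i)) v))"
      unfolding verts_bd_def using fin by (simp add: frag_extend_sum)
    also have "\<dots> = 0"
      using cell_bd_vertex_bd[OF i] W_verts[of "Suc i" e] by (intro sum.neutral) auto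
    finally show ?thesis .
  qed
qed

text \<open>Linearity of \<open>N 0\<close> gives each vertex one edge into it besides the one out
  of it, so its boundary has coefficient sum 1 - 1.\<close>

lemma coef_sum_cell_bd:
  assumes "a \<in> basis_of complex (Suc 0)"
  shows "coef_sum (cell_bd a) = 0"
proof -
  obtain e where e: "0 < n" "e \<in> edges (N (Suc 0))" "a = j (Suc 0) e"
    using assms by (auto simp: basis_complex split: if_splits)
  interpret T: tree_network "N 0" by (rule tree) simp
  have fin: "finite (W 0 e)" using W_verts[of 0 e] finite_N(2)[of 0] finite_subset by blast
  have "coef_sum (vertex_bd (N 0) v) = 0" if "v \<in> W 0 e" for v
  proof -
    have v: "v \<in> verts (N 0)" using that W_verts by blast
    have "linear_network (N 0)" using opetope by (simp add: is_opetope_def)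
    then obtain d where "edges_into (N 0) v = {d}" using T.linear_network_edges_into v by blast
    then show ?thesis using T.edges_out_of[OF v] by (simp add: vertex_bd_def coef_sum_diff)
  qed
  then show ?thesis
    using e fin by (simp add: cell_bd_Suc coef_sum_relabel verts_bd_def coef_sum_sum)
qed

lemma coef_sum_frag_extend: "coef_sum (frag_extend f x) = (\<Sum>a\<in>terms x. coef x a * coef_sum (f a))"
  by (simp add: frag_extend_def coef_sum_sum coef_sum_cmul)

lemma free_aug_complex: "free_aug_dcomplex complex"
  unfolding free_aug_dcomplex_def
proof (intro conjI allI ballI)
  show "bd complex \<in> hom (chain_gp complex (Suc q)) (chain_gp complex q)" for q
  proof (rule homI)
    fix x assume "x \<in> carrier (chain_gp complex (Suc q))"
    then have "(\<Union>a\<in>terms x. terms (cell_bd a)) \<subseteq> basis_of complex q"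
      using terms_cell_bd[of _ q] by (auto simp: carrier_chain_gp)
    then show "bd complex x \<in> carrier (chain_gp complex q)"
      using keys_frag_extend[of cell_bd x] by (simp add: complex_simps carrier_chain_gp)
  qed (simp add: complex_simps chain_gp_def frag_extend_add)
  show "bd complex (bd complex x) = 0" if "x \<in> carrier (chain_gp complex q)" for q x
    unfolding complex_simps frag_extend_frag_extend
    by (rule frag_extend_eq_0) (use that bd_cell_bd[of _ q] in \<open>auto simp: carrier_chain_gp\<close>)
  show "bd complex x = 0" if "x \<in> carrier (chain_gp complex 0)" for x
    using that unfolding complex_simps
    by (intro frag_extend_eq_0) (auto simp: carrier_chain_gp basis_complex cell_bd_0)
  show "aug complex \<in> hom (chain_gp complex 0) integer_group"
    by (rule homI) (simp_all add: complex_simps chain_gp_def coef_sum_conv_coef frag_extend_add lookup_add)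
  show "aug complex (bd complex x) = 0" if "x \<in> carrier (chain_gp complex 1)" for x
    using that coef_sum_cell_bd unfolding complex_simps coef_sum_frag_extend
    by (intro sum.neutral) (auto simp: carrier_chain_gp)
qed

section \<open>The axioms of a reduced opetopic directed complex\<close>

lemma elemsE:
  assumes "a \<in> elems complex"
  obtains i e where "i \<le> n" "e \<in> edges (N i)" "a = j i e" "edim complex a = i"
  using assms code by (auto simp: complex_simps)

lemma single_target_complex: "single_target complex"
proof
  show "\<exists>b\<in>elems complex. bd_plus complex (frag_of a) = frag_of b"
    if a: "a \<in> elems complex" "0 < edim complex a" for a
  proof -
    obtain i e where ie: "i \<le> n" "e \<in> edges (N i)" "a = j i e" "edim complex a = i"
      using elemsE[OF a(1)] .
    with a obtain k where k: "i = Suc k" by (cases i) auto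
    then have "bd_plus complex (frag_of a) = frag_of (j k (head k e))"
      using cell_bd_source_target(1)[of k e] ie by simp
    moreover have "j k (head k e) \<in> elems complex"
      using head_edges[of k e] ie k by (auto simp: complex_simps)
    ultimately show ?thesis by blast
  qed
qed (rule free_aug_complex)

lemma target_complex:
  assumes "i < n" "e \<in> edges (N (Suc i))"
  shows "single_target.target complex (j (Suc i) e) = j i (head i e)"
proof -
  interpret single_target complex by (rule single_target_complex)
  have "j (Suc i) e \<in> basis_of complex (Suc i)" using assms by (simp add: basis_complex)
  then show ?thesis using target(1) cell_bd_source_target(1)[OF assms] by (metis frag_of_eq)
qed

text \<open>The order is reachability by paths within each network; \<open>ins_step_top\<close> puts
  the tails of a cell strictly below its head.\<close>

lemma loop_free_complex: "loop_free complex"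
proof -
  interpret single_target complex by (rule single_target_complex)
  define R where "R = {(j i d, j i d') |i d d'. i \<le> n \<and> d \<in> edges (N i) \<and> d' \<in> edges (N i) \<and>
    (d, d') \<in> (step (N i))\<^sup>*}"
  have R: "(j i d, j i d') \<in> R \<longleftrightarrow> (d, d') \<in> (step (N i))\<^sup>*"
    if "i \<le> n" "d \<in> edges (N i)" "d' \<in> edges (N i)" for i d d'
    using that by (auto simp: R_def j_eq)
  have ac: "acyclic (step (N i))" if "i \<le> n" for i
    using network(2)[OF that] by (simp add: acyclic_network_iff)
  show ?thesis
  proof (rule loop_freeI)
    have "antisym R"
    proof (rule antisymI)
      fix x y assume xy: "(x, y) \<in> R" "(y, x) \<in> R"
      then obtain i d d' where d: "x = j i d" "y = j i d'" "i \<le> n" "d \<in> edges (N i)" "d' \<in> edges (N i)"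
        by (auto simp: R_def)
      then have "(d, d') \<in> (step (N i))\<^sup>*" "(d', d) \<in> (step (N i))\<^sup>*" using xy R by auto
      then show "x = y"
        using ac[OF d(3)] d by (metis acyclic_impl_antisym_rtrancl antisymD)
    qed
    moreover have "trans R"
    proof (rule transI)
      fix x y z assume xy: "(x, y) \<in> R" "(y, z) \<in> R"
      then obtain i d d' where d: "x = j i d" "y = j i d'" "i \<le> n" "d \<in> edges (N i)" "d' \<in> edges (N i)"
        "(d, d') \<in> (step (N i))\<^sup>*"
        by (auto simp: R_def)
      obtain k f f' where f: "y = j k f" "z = j k f'" "k \<le> n" "f \<in> edges (N k)" "f' \<in> edges (N k)"
        "(f, f') \<in> (step (N k))\<^sup>*"
        using xy(2) by (auto simp: R_def)
      \<comment> \<open>Labels determine the dimension, so composable pairs come from the same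
        network.\<close>
      have "k = i" "f = d'" using d f j_eq[of i d' k f] by auto
      then show "(x, z) \<in> R" using d f R[of i d f'] by (auto intro: rtrancl_trans)
    qed
    moreover have "refl_on (elems complex) R" "R \<subseteq> elems complex \<times> elems complex"
      by (auto simp: R_def refl_on_def complex_simps)
    ultimately show "partial_order_on (elems complex) R"
      by (simp add: partial_order_on_def preorder_on_def)
    fix q a x assume a: "a \<in> basis_of complex (Suc q)" and x: "x \<in> terms (source a)"
    obtain e where e: "q < n" "e \<in> edges (N (Suc q))" "a = j (Suc q) e"
      using a by (auto simp: basis_complex split: if_splits)
    then obtain d where d: "x = j q d" "d \<in> tails q e"
      using x cell_bd_source_target(2)[of q e] finite_tails[of q e] by auto
    interpret T: tree_network "N q" using e by (intro tree) simp
    have "(d, head q e) \<in> (step (N q))\<^sup>+"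
      using d(2) by (intro T.ins_step_top[OF W_verts head[OF e(1,2)]]) (auto simp: tails_def)
    moreover have "d \<noteq> head q e" using d(2) head[OF e(1,2)] by (auto simp: tails_def)
    moreover have "d \<in> edges (N q)" "head q e \<in> edges (N q)"
      using d(2) tails_edges head_edges[OF e(1,2)] by auto
    ultimately show "(x, target a) \<in> R \<and> x \<noteq> target a"
      using d(1) e R[of q d "head q e"] j_eq[of q d q "head q e"]
      by (simp add: target_complex trancl_into_rtrancl)
  qed
qed

text \<open>Below the top every edge of \<open>N q\<close> has a vertex \<open>v\<close> as its
  source or target, and so is a term in the boundary of the cell labelled by
  \<open>c q v\<close>.\<close>

lemma atomic_complex: "atomic n complex"
  unfolding atomic_def
proof (intro conjI ballI impI)
  show "edim complex a \<le> n" if "a \<in> elems complex" for a using that by (auto elim: elemsE)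
  obtain e where "edges (N n) = {e}" using opetope by (auto simp: is_opetope_def)
  then show "\<exists>!g. g \<in> basis_of complex n" by (simp add: basis_complex)
next
  fix b assume b: "b \<in> elems complex" "edim complex b < n"
  obtain q d where d: "q < n" "d \<in> edges (N q)" "b = j q d" "edim complex b = q"
    using elemsE[OF b(1)] b(2) by metis
  have "\<exists>v\<in>verts (N q). d = head q (c q v) \<or> d \<in> tails q (c q v)"
  proof (cases "d \<in> inputs (N q)")
    case False
    then have "src (N q) d \<in> verts (N q)" "d \<in> edges_out_of (N q) (src (N q) d)"
      using d network(1)[of q] by (auto simp: is_network_def edges_out_of_def)
    then show ?thesis using vertex_cell[OF d(1)] by blast
  next
    case True
    \<comment> \<open>An input edge could lack a target only by being the output as well, which
      \<open>root_cell\<close> excludes.\<close>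
    then have "d \<notin> outputs (N q)" using root_cell(2)[OF d(1)] outputs_root[of q] d(1) by auto
    then have "tgt (N q) d \<in> verts (N q)" "d \<in> edges_into (N q) (tgt (N q) d)"
      using d network(1)[of q] by (auto simp: is_network_def edges_into_def)
    then show ?thesis using vertex_cell[OF d(1)] by blast
  qed
  then obtain v where v: "v \<in> verts (N q)" "d = head q (c q v) \<or> d \<in> tails q (c q v)" by blast
  let ?a = "j (Suc q) (c q v)"
  have e: "c q v \<in> edges (N (Suc q))" using c_edges[OF d(1) v(1)] by simp
  then have "?a \<in> elems complex" "edim complex ?a = Suc q"
    using d(1) code[of "Suc q"] by (auto simp: complex_simps)
  moreover have "b \<in> terms (bd_minus complex (frag_of ?a)) \<or> b \<in> terms (bd_plus complex (frag_of ?a))"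
    using cell_bd_source_target[OF d(1) e] v(2) d finite_tails[of q] by auto
  ultimately show "\<exists>a\<in>elems complex. edim complex b < edim complex a \<and>
      (b \<in> terms (bd_minus complex (frag_of a)) \<or> b \<in> terms (bd_plus complex (frag_of a)))"
    using d(4) by (intro bexI[of _ ?a]) auto
qed

text \<open>A head has a source in its network, whereas thin edges are inputs. A thin cell of
  dimension \<open>k + 1\<close> corresponds to a thin vertex of \<open>N k\<close>, whose only
  incoming edge is not thin.\<close>

lemma opetopic_complex: "opetopic n complex"
proof
  have "unital complex"
    using single_target.unitalI[OF single_target_complex] by (simp add: complex_simps)
  moreover have "a \<in> elems complex \<and> 0 < edim complex a" if a: "a \<in> thin complex" for a
  proof -
    obtain i t where t: "i \<le> n" "t \<in> thin_edges (N i)" "a = j i t" using a by (auto simp: complex_simps)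
    then have "t \<in> edges (N i)" "i \<noteq> 0" using thin_edges inputs_edges[of i] by (auto intro: gr0I)
    then show ?thesis using t code[of i t] by (auto simp: complex_simps)
  qed
  moreover have "\<exists>b\<in>elems complex - thin complex. bd_plus complex (frag_of a) = frag_of b"
    if a: "a \<in> elems complex" "0 < edim complex a" for a
  proof -
    obtain i e where ie: "i \<le> n" "e \<in> edges (N i)" "a = j i e" "edim complex a = i"
      using elemsE[OF a(1)] .
    with a obtain k where k: "i = Suc k" by (cases i) auto
    have "head k e \<in> edges (N k)" "head k e \<notin> thin_edges (N k)"
      using head_edges[of k e] thin_edges(1)[of k] ie k by auto
    then have "j k (head k e) \<in> elems complex - thin complex"
      using thin_complex[of k] ie k by (auto simp: complex_simps(1))
    then show ?thesis using cell_bd_source_target(1)[of k e] ie k by auto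
  qed
  moreover have "\<exists>b\<in>elems complex - thin complex. bd_minus complex (frag_of a) = frag_of b"
    if a: "a \<in> thin complex" for a
  proof -
    obtain i t where t: "i \<le> n" "t \<in> thin_edges (N i)" "a = j i t" using a by (auto simp: complex_simps)
    then obtain k where k: "i = Suc k" using thin_edges(2) by (cases i) auto
    then have kn: "k < n" using t by simp
    then obtain v where v: "v \<in> verts (N k)" "t = c k v"
      using thin_edges(1)[of i] t k bij_c[of k] by (auto simp: bij_betw_def)
    then have "v \<in> thin_verts (N k)" using thin_c kn t k by simp
    then obtain d where d: "edges_into (N k) v = {d}" "d \<notin> thin_edges (N k)"
      using opetopic_network[of k] kn by (auto simp: opetopic_network_def)
    have "bd_minus complex (frag_of a) = frag_of (j k d)"
      using cell_bd_source_target(2)[OF kn conjunct2[OF c_edges[OF kn v(1)]]] v(2) t(3) k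
      unfolding vertex_cell(2)[OF kn v(1), symmetric] d(1) by simp
    moreover have "d \<in> edges (N k)" using d(1) by (auto simp: edges_into_def)
    then have "j k d \<in> elems complex - thin complex"
      using thin_complex[of k d] d(2) kn by (auto simp: complex_simps(1))
    ultimately show ?thesis by blast
  qed
  ultimately show "opetopic_dcomplex n complex"
    unfolding opetopic_dcomplex_def
    using free_aug_complex atomic_complex loop_free_complex by auto
qed

text \<open>A thin edge \<open>t\<close> is the only edge into some vertex \<open>v\<close>, so the
  cell of \<open>c q v\<close> has the label of \<open>t\<close> as negative boundary; the two cells
  differ in dimension.\<close>

lemma reduced_complex: "reduced_dcomplex complex"
  unfolding reduced_dcomplex_def
proof
  fix b assume "b \<in> thin complex"
  then obtain q t where t: "q \<le> n" "t \<in> thin_edges (N q)" "b = j q t" by (auto simp: complex_simps)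
  then have "reduced_network (N q)" using opetope by (simp add: is_opetope_def)
  then obtain v where v: "v \<in> verts (N q)" "edges_into (N q) v = {t}"
    using t(2) unfolding reduced_network_def by blast
  then have "q \<noteq> n" using opetope by (auto simp: is_opetope_def)
  then have q: "q < n" using t by simp
  let ?a = "j (Suc q) (c q v)"
  have e: "c q v \<in> edges (N (Suc q))" using c_edges[OF q v(1)] by simp
  have "bd_minus complex (frag_of ?a) = frag_of b"
    using cell_bd_source_target(2)[OF q e] t(3)
    unfolding vertex_cell(2)[OF q v(1), symmetric] v(2) by simp
  moreover have "?a \<in> elems complex" using e q by (auto simp: complex_simps)
  moreover have "?a \<noteq> b"
    using t thin_edges(1)[of q] inputs_edges[of q] j_eq[of "Suc q" "c q v" q t] e q by auto
  ultimately show "\<exists>a\<in>elems complex. a \<noteq> b \<and> bd_minus complex (frag_of a) = frag_of b" by blast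
qed

text \<open>A vertex of \<open>G_network n complex q\<close> is the label of an input edge of
  \<open>N (Suc q)\<close>, hence the passage of the vertex map through the constellation.\<close>

lemma network_seq_iso_complex:
  "network_seq_iso n j (\<lambda>i v. j (Suc i) (c i v)) S (opetope_of n complex)"
proof -
  interpret K: opetopic n complex by (rule opetopic_complex)
  have top: "edges (N n) = {root n}" "inputs (N n) = {root n}" "verts (N n) = {}"
  proof -
    show "verts (N n) = {}" using opetope by (auto simp: is_opetope_def)
    then have "inputs (N n) = edges (N n)" using network(1)[of n] by (auto simp: is_network_def)
    moreover show "edges (N n) = {root n}"
      using opetope root_edges[of n] by (auto simp: is_opetope_def)
    ultimately show "inputs (N n) = {root n}" by simp
  qed
  have out: "K.out q = j q (root q)" if "q \<le> n" for q
    using that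
  proof (induction "n - q" arbitrary: q)
    case 0
    then have "q = n" by simp
    moreover have "basis_of complex n = {j n (root n)}" using top by (simp add: basis_complex)
    ultimately show ?case using K.basis_top by (simp add: K.out_top)
  next
    case (Suc k)
    then have q: "q < n" "K.out (Suc q) = j (Suc q) (root (Suc q))" by auto
    then show ?case
      using K.target_out[OF q(1)] target_complex[OF q(1) root_edges] root_cell(1)[OF q(1)] by simp
  qed
  have xm: "terms (x_minus n complex q) = j q ` inputs (N q)" if "q \<le> n" for q
  proof (cases "q = n")
    case True
    then show ?thesis using top out[of n] by (simp add: K.xm_top K.out_top)
  next
    case False
    then have q: "q < n" using that by simp
    have e: "root (Suc q) \<in> edges (N (Suc q))" using q by (intro root_edges) simp
    show ?thesis
      using K.xm_less[OF q] out[of "Suc q"] q cell_bd_source_target(2)[OF q e] root_cell(3)[OF q]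
        finite_tails[of q "root (Suc q)"] by simp
  qed
  have "onetwork_iso (j q) (\<lambda>v. j (Suc q) (c q v)) (N q) (G_network n complex q)" if q: "q \<le> n" for q
    unfolding onetwork_iso_def
  proof (intro conjI ballI)
    have verts: "terms (x_minus n complex (Suc q)) = (\<lambda>v. j (Suc q) (c q v)) ` verts (N q)"
    proof (cases "q = n")
      case True
      then show ?thesis using top by (simp add: K.xm_greater)
    next
      case False
      then show ?thesis
        using q xm[of "Suc q"] bij_betw_imp_surj_on[OF bij_c[of q]] by (simp flip: image_image)
    qed
    have lt: "q < n" if "v \<in> verts (N q)" for v using that top(3) q by (cases "q = n") auto
    have cell: "K.target (j (Suc q) (c q v)) = j q (head q (c q v))"
      "terms (K.source (j (Suc q) (c q v))) = j q ` edges_into (N q) v"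
      "edges_out_of (N q) v = {head q (c q v)}" if v: "v \<in> verts (N q)" for v
      using target_complex[of q "c q v"] cell_bd_source_target(2)[of q "c q v"] c_edges[of q v]
        vertex_cell[of q v] finite_tails[of q] lt[OF v] v by auto
    show "bij_betw (j q) (edges (N q)) (edges (G_network n complex q))"
      using q inj_j by (simp add: K.G_edges basis_complex bij_betw_def)
    show "bij_betw (\<lambda>v. j (Suc q) (c q v)) (verts (N q)) (verts (G_network n complex q))"
      unfolding bij_betw_def
    proof
      show "inj_on (\<lambda>v. j (Suc q) (c q v)) (verts (N q))"
      proof (rule inj_onI)
        fix v w assume vw: "v \<in> verts (N q)" "w \<in> verts (N q)" "j (Suc q) (c q v) = j (Suc q) (c q w)"
        then have "c q v = c q w"
          using lt[OF vw(1)] c_edges[of q] j_eq[of "Suc q" "c q v" "Suc q" "c q w"] by simp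
        then show "v = w" using bij_betw_imp_inj_on[OF bij_c] vw lt by (meson inj_onD)
      qed
    qed (simp add: K.G_simps verts)
    show "j q ` inputs (N q) = inputs (G_network n complex q)"
      using q by (simp add: K.G_inputs xm)
    show "j q ` outputs (N q) = outputs (G_network n complex q)"
      using q by (simp add: K.G_outputs out outputs_root)
    show "src (G_network n complex q) (j q e) = j (Suc q) (c q (src (N q) e))"
      if e: "e \<in> edges (N q) - inputs (N q)" for e
    proof -
      let ?v = "src (N q) e"
      have v: "?v \<in> verts (N q)" "e \<in> edges_out_of (N q) ?v"
        using e network(1)[OF q] by (auto simp: is_network_def edges_out_of_def)
      then have "j q e = K.target (j (Suc q) (c q ?v))" using cell(1,3)[OF v(1)] by auto
      then show ?thesis using K.G_src[OF q, of "j (Suc q) (c q ?v)"] verts v(1) by auto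
    qed
    show "tgt (G_network n complex q) (j q e) = j (Suc q) (c q (tgt (N q) e))"
      if e: "e \<in> edges (N q) - outputs (N q)" for e
    proof -
      let ?v = "tgt (N q) e"
      have v: "?v \<in> verts (N q)" "e \<in> edges_into (N q) ?v"
        using e network(1)[OF q] by (auto simp: is_network_def edges_into_def)
      then have "j q e \<in> terms (K.source (j (Suc q) (c q ?v)))" using cell(2)[OF v(1)] by auto
      then show ?thesis using K.G_tgt[OF q, of "j (Suc q) (c q ?v)"] verts v(1) by auto
    qed
    have thin_sub: "thin_edges (N q) \<subseteq> edges (N q)" using thin_edges(1)[OF q] inputs_edges[OF q] by blast
    show "j q ` thin_edges (N q) = thin_edges (G_network n complex q)"
      using q thin_sub thin_complex[OF q] by (auto simp: K.G_simps(3) K.G_edges basis_complex)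
    have "thin_verts (N q) \<subseteq> verts (N q)" using opetopic_network[OF q] by (simp add: opetopic_network_def)
    moreover have "j (Suc q) (c q v) \<in> thin complex \<longleftrightarrow> v \<in> thin_verts (N q)" if "v \<in> verts (N q)" for v
      using thin_complex[of "Suc q" "c q v"] c_edges[of q v] thin_c[of q v] lt[OF that] that by simp
    ultimately show "(\<lambda>v. j (Suc q) (c q v)) ` thin_verts (N q) = thin_verts (G_network n complex q)"
      by (auto simp: K.G_simps(2,4) verts)
  qed
  then show ?thesis by (simp add: network_seq_iso_def opetope_of_def)
qed

end

text \<open>An opetope has finitely many edges in all, so an infinite type has room for distinct
  labels.\<close>

lemma opetope_realizable:
  fixes S :: "('e, 'v) network_seq"
  assumes inf: "infinite (UNIV :: 'b set)" and S: "is_opetope n S"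
  shows "\<exists>(K :: 'b odcomplex) \<phi> \<psi>. opetopic_dcomplex n K \<and> reduced_dcomplex K \<and>
    network_seq_iso n \<phi> \<psi> S (opetope_of n K)"
proof -
  let ?D = "Sigma {..n} (\<lambda>i. edges (nets S i))"
  have "finite ?D"
    using S by (auto simp: is_opetope_def opetopic_network_def is_network_def)
  moreover obtain B :: "'b set" where "finite B" "card B = card ?D"
    using infinite_arbitrarily_large[OF inf] by blast
  ultimately obtain h where "bij_betw h ?D B"
    using finite_same_card_bij by metis
  then have "opetope_labelling n S (\<lambda>i e. h (i, e))"
    using S by unfold_locales (auto simp: bij_betw_def inj_on_def)
  then interpret opetope_labelling n S "\<lambda>i e. h (i, e)" .
  show ?thesis
    using opetopic_complex reduced_complex network_seq_iso_complex by (auto simp: opetopic_def)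
qed

theorem theorem2p7:
  fixes n :: nat
  assumes "infinite (UNIV :: 'a set)"
  shows
    "(\<forall>K \<in> (reduced_opetopic_dcomplexes n :: 'a odcomplex set).
        (\<forall>q \<le> n. G_well_defined n K q) \<and> opetope_of n K \<in> opetopes n)
     \<and> (\<lambda>K :: 'a odcomplex. opetope_iso_rel n `` {opetope_of n K}) respects dcomplex_iso_rel n
     \<and> bij_betw
         (\<lambda>C :: 'a odcomplex set. \<Union>K \<in> C. opetope_iso_rel n `` {opetope_of n K})
         (reduced_opetopic_dcomplexes n // dcomplex_iso_rel n)
         (opetopes n // opetope_iso_rel n)"
proof -
  let ?X = "reduced_opetopic_dcomplexes n :: 'a odcomplex set"
  let ?R = "dcomplex_iso_rel n :: ('a odcomplex \<times> 'a odcomplex) set"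
  let ?Y = "opetopes n :: ('a, 'a) network_seq set"
  let ?T = "opetope_iso_rel n :: (('a, 'a) network_seq \<times> ('a, 'a) network_seq) set"
  let ?F = "\<lambda>K :: 'a odcomplex. ?T `` {opetope_of n K}"
  let ?G = "\<lambda>C :: 'a odcomplex set. \<Union>K \<in> C. ?F K"
  have X: "opetopic n K" "reduced_dcomplex K" if "K \<in> ?X" for K
    using that by (auto simp: reduced_opetopic_dcomplexes_def opetopic_def)
  have Y: "opetope_of n K \<in> ?Y" if "K \<in> ?X" for K
    using opetopic.opetope_of[OF X[OF that]] by (simp add: opetopes_def)
  \<comment> \<open>One direction gives well-definedness on classes, the other injectivity.\<close>
  have iff: "(K, L) \<in> ?R \<longleftrightarrow> (opetope_of n K, opetope_of n L) \<in> ?T" if KL: "K \<in> ?X" "L \<in> ?X" for K L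
  proof
    assume "(K, L) \<in> ?R"
    then obtain f where "dcomplex_iso f K L" by (auto simp: dcomplex_iso_rel_def)
    then obtain \<phi> where "basis_iso \<phi> K L" using dcomplex_iso_imp_basis_iso X KL by metis
    then show "(opetope_of n K, opetope_of n L) \<in> ?T"
      using basis_iso_imp_network_seq_iso X Y KL unfolding opetope_iso_rel_def by blast
  next
    assume "(opetope_of n K, opetope_of n L) \<in> ?T"
    then obtain \<phi> \<psi> where "network_seq_iso n \<phi> \<psi> (opetope_of n K) (opetope_of n L)"
      by (auto simp: opetope_iso_rel_def)
    then have "basis_iso \<phi> K L" using network_seq_iso_imp_basis_iso X KL by metis
    then show "(K, L) \<in> ?R"
      using basis_iso_imp_dcomplex_iso X KL unfolding dcomplex_iso_rel_def by blast
  qed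
  note eqR = equiv_dcomplex_iso_rel[where n = n and 'a = 'a]
  note eqT = equiv_opetope_iso_rel[where n = n and 'e = 'a and 'v = 'a]
  have RX: "K \<in> ?X \<and> L \<in> ?X" if "(K, L) \<in> ?R" for K L
    using that by (auto simp: dcomplex_iso_rel_def)
  have resp: "?F respects ?R"
    unfolding congruent_def using iff RX equiv_class_eq[OF eqT] by blast
  have G: "?G (?R `` {K}) = ?F K" if "K \<in> ?X" for K
    using UN_equiv_class[OF eqR resp that] .
  have "bij_betw ?G (?X // ?R) (?Y // ?T)"
    unfolding bij_betw_def
  proof
    show "inj_on ?G (?X // ?R)"
    proof (rule inj_onI)
      fix C D assume CD: "C \<in> ?X // ?R" "D \<in> ?X // ?R" "?G C = ?G D"
      obtain K L where KL: "K \<in> ?X" "C = ?R `` {K}" "L \<in> ?X" "D = ?R `` {L}"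
        using CD(1,2) by (auto elim!: quotientE)
      then have "?F K = ?F L" using CD(3) G by simp
      then have "(opetope_of n K, opetope_of n L) \<in> ?T"
        using eq_equiv_class[OF _ eqT Y[OF KL(3)]] by blast
      then show "C = D" using KL iff equiv_class_eq[OF eqR] by blast
    qed
    have "?G C \<in> ?Y // ?T" if C: "C \<in> ?X // ?R" for C
    proof -
      obtain K where K: "K \<in> ?X" "C = ?R `` {K}" using C by (auto elim!: quotientE)
      then show ?thesis using G[OF K(1)] Y[OF K(1)] by (simp add: quotientI)
    qed
    \<comment> \<open>Surjectivity: the representative \<open>S\<close> is isomorphic to the opetope
      of a complex over the same type \<open>'a\<close>.\<close>
    moreover have "C \<in> ?G ` (?X // ?R)" if C: "C \<in> ?Y // ?T" for C
    proof -
      obtain S where S: "S \<in> ?Y" "C = ?T `` {S}" using C by (auto elim!: quotientE)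
      then obtain K :: "'a odcomplex" and \<phi> \<psi> where K: "opetopic_dcomplex n K" "reduced_dcomplex K"
        "network_seq_iso n \<phi> \<psi> S (opetope_of n K)"
        using opetope_realizable[OF assms] by (metis opetopes_def mem_Collect_eq)
      then have KX: "K \<in> ?X" by (simp add: reduced_opetopic_dcomplexes_def)
      then have "(S, opetope_of n K) \<in> ?T" using K S Y by (auto simp: opetope_iso_rel_def)
      then have "C = ?G (?R `` {K})" using S(2) G[OF KX] equiv_class_eq[OF eqT] by simp
      then show ?thesis using KX by (blast intro: quotientI)
    qed
    ultimately show "?G ` (?X // ?R) = ?Y // ?T" by blast
  qed
  moreover have "G_well_defined n K q" if "K \<in> ?X" "q \<le> n" for K q
    using opetopic.G_well_defined[OF X(1)[OF that(1)] that(2)] .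
  ultimately show ?thesis using Y resp by blast
qed

end
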